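(* There exists $C>0$ such that for every $T>0$, if $p>1+d$ and $\sigma>d/2$, then for every smooth vector field $G(t,s,x,v)\in\mathbb R^d$ and all $H\in \mathrm L^2(0,T;\mathrm L^2(\mathbb T^d))$, $$\big\|\mathrm K^{\mathrm{free}}_G[H]\big\|_{\mathrm L^2(0,T;\mathrm L^2(\mathbb T^d))}+\big\|\mathrm K^{\mathrm{fric}}_G[H]\big\|_{\mathrm L^2(0,T;\mathrm L^2(\mathbb T^d))}\le C\sup_{0\le s,t\le T}\|G(t,s)\|_{\mathcal H^p_\sigma}\,\|H\|_{\mathrm L^2(0,T;\mathrm L^2(\mathbb T^d))}.$$
   Context: Here $d\ge1$, $\mathbb T^d=\mathbb R^d/(2\pi\mathbb Z)^d$ with normalized Lebesgue measure, and for $p\in\mathbb N$, $\sigma\ge0$, $$\|\mathrm f\|_{\mathcal H^p_\sigma}=\Big(\sum_{|\alpha|+|\beta|\le p}\int_{\mathbb T^d}\int_{\mathbb R^d}(1+|v|^2)^{\sigma}|\partial_x^\alpha\partial_v^\beta \mathrm f(x,v)|^2\,dx\,dv\Big)^{1/2}.$$ For a smooth vector field $G(t,s,x,v)\in\mathbb R^d$ and a function $H(t,x)$, the averaging operators are $$\mathrm K^{\mathrm{free}}_G[H](t,x)=\int_0^t\int_{\mathbb R^d}[\nabla_xH](s,x-(t-s)v)\cdot G(t,s,x,v)\,dv\,ds,$$ $$\mathrm K^{\mathrm{fric}}_G[H](t,x)=\int_0^t\int_{\mathbb R^d}[\nabla_xH](s,x+(1-e^{t-s})v)\cdot G(t,s,x,v)\,dv\,ds.$$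 *)

theory Defs
  imports "HOL-Analysis.Analysis"
begin

text \<open>Smoothness. Meant for open \<open>S\<close>; the iterated derivatives are taken along all directions.\<close>

primrec Ck_on :: "nat \<Rightarrow> ('a::real_normed_vector \<Rightarrow> 'b::real_normed_vector) \<Rightarrow> 'a set \<Rightarrow> bool" where
  "Ck_on 0 f S \<longleftrightarrow> continuous_on S f"
| "Ck_on (Suc k) f S \<longleftrightarrow>
     (\<forall>x\<in>S. f differentiable (at x)) \<and> (\<forall>b. Ck_on k (\<lambda>x. frechet_derivative f (at x) b) S)"

definition smooth_on :: "('a::real_normed_vector \<Rightarrow> 'b::real_normed_vector) \<Rightarrow> 'a set \<Rightarrow> bool" where
  "smooth_on f S \<longleftrightarrow> (\<forall>k. Ck_on k f S)"

definition partial :: "'a::real_normed_vector \<Rightarrow> ('a \<Rightarrow> 'b::real_normed_vector) \<Rightarrow> 'a \<Rightarrow> 'b" where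
  "partial b f x = vector_derivative (\<lambda>h. f (x + h *\<^sub>R b)) (at 0)"

definition grad :: "(real^'d::finite \<Rightarrow> real) \<Rightarrow> real^'d \<Rightarrow> real^'d" where
  "grad f x = (\<chi> i. partial (axis i 1) f x)"

text \<open>
  \<open>\<partial>\<^sub>x\<^sup>\<alpha> \<partial>\<^sub>v\<^sup>\<beta> f\<close> for multi-indices \<open>\<alpha>, \<beta>\<close>. The index type carries no order, so the coordinates are
  enumerated in some fixed order, which is irrelevant for smooth \<open>f\<close>.
\<close>

definition coords :: "'d::finite list" where
  "coords = (SOME is. distinct is \<and> set is = UNIV)"

definition multi_partial ::
  "('d::finite \<Rightarrow> nat) \<Rightarrow> ('d \<Rightarrow> nat) \<Rightarrow> ((real^'d) \<times> (real^'d) \<Rightarrow> 'b::real_normed_vector)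
     \<Rightarrow> (real^'d) \<times> (real^'d) \<Rightarrow> 'b" where
  "multi_partial \<alpha> \<beta> f =
     foldr (\<lambda>i. partial (axis i 1, 0) ^^ \<alpha> i) coords
       (foldr (\<lambda>i. partial (0, axis i 1) ^^ \<beta> i) coords f)"

text \<open>
  Functions on the torus are functions on \<open>\<real>\<^sup>d\<close> with period \<open>2\<pi>\<close> in each coordinate, integrated over
  one period cell against normalized Lebesgue measure.
\<close>

definition periodic :: "(real^'d::finite \<Rightarrow> 'b) \<Rightarrow> bool" where
  "periodic f \<longleftrightarrow> (\<forall>x i. f (x + axis i (2 * pi)) = f x)"

definition torus :: "(real^'d::finite) measure" where
  "torus = uniform_measure lborel (cbox 0 (\<chi> i. 2 * pi))"

text \<open>
  All norms take values in \<open>[0, \<infinity>]\<close> and are defined through the nonnegative Lebesgue integral, so that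
  an infinite norm really is \<open>\<infinity>\<close>.
\<close>

definition ennreal_sqrt :: "ennreal \<Rightarrow> ennreal" where
  "ennreal_sqrt a = (if a = \<infinity> then \<infinity> else ennreal (sqrt (enn2real a)))"

definition Hps_norm ::
  "nat \<Rightarrow> real \<Rightarrow> ((real^'d::finite) \<times> (real^'d) \<Rightarrow> 'b::real_normed_vector) \<Rightarrow> ennreal" where
  "Hps_norm p \<sigma> f = ennreal_sqrt
     (\<Sum>(\<alpha>, \<beta>) \<in> {(\<alpha>, \<beta>). (\<Sum>i\<in>UNIV. \<alpha> i) + (\<Sum>i\<in>UNIV. \<beta> i) \<le> p}.
        \<integral>\<^sup>+x. (\<integral>\<^sup>+v. ennreal ((1 + (norm v)\<^sup>2) powr \<sigma> * (norm (multi_partial \<alpha> \<beta> f (x, v)))\<^sup>2)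
          \<partial>lborel) \<partial>torus)"

definition L2_norm :: "real \<Rightarrow> (real \<Rightarrow> real^'d::finite \<Rightarrow> real) \<Rightarrow> ennreal" where
  "L2_norm T H =
     ennreal_sqrt (\<integral>\<^sup>+t\<in>{0..T}. (\<integral>\<^sup>+x. ennreal ((H t x)\<^sup>2) \<partial>torus) \<partial>lborel)"

text \<open>
  (Representatives of) elements of \<open>L\<^sup>2(0,T; L\<^sup>2(torus))\<close>; every class has a jointly Borel
  representative.
\<close>

definition in_L2 :: "real \<Rightarrow> (real \<Rightarrow> real^'d::finite \<Rightarrow> real) \<Rightarrow> bool" where
  "in_L2 T H \<longleftrightarrow>
     (\<forall>t\<in>{0..T}. periodic (H t)) \<and>
     (\<lambda>(t, x). H t x) \<in> borel_measurable (restrict_space lborel {0..T} \<Otimes>\<^sub>M lborel) \<and>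
     L2_norm T H < \<infinity>"

text \<open>Smoothness up to the boundary of the time interval: smooth on a neighbourhood of it.\<close>

definition smooth_function :: "real \<Rightarrow> (real \<Rightarrow> real^'d::finite \<Rightarrow> real) \<Rightarrow> bool" where
  "smooth_function T H \<longleftrightarrow>
     (\<forall>t\<in>{0..T}. periodic (H t)) \<and>
     (\<exists>S. open S \<and> {0..T} \<times> UNIV \<subseteq> S \<and> smooth_on (\<lambda>(t, x). H t x) S)"

definition smooth_field ::
  "real \<Rightarrow> (real \<Rightarrow> real \<Rightarrow> real^'d::finite \<Rightarrow> real^'d \<Rightarrow> real^'d) \<Rightarrow> bool" where
  "smooth_field T G \<longleftrightarrow>
     (\<forall>t\<in>{0..T}. \<forall>s\<in>{0..T}. \<forall>v. periodic (\<lambda>x. G t s x v)) \<and>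
     (\<exists>S. open S \<and> {0..T} \<times> {0..T} \<times> UNIV \<times> UNIV \<subseteq> S \<and> smooth_on (\<lambda>(t, s, x, v). G t s x v) S)"

definition sup_Hps_norm ::
  "real \<Rightarrow> nat \<Rightarrow> real \<Rightarrow> (real \<Rightarrow> real \<Rightarrow> real^'d::finite \<Rightarrow> real^'d \<Rightarrow> real^'d) \<Rightarrow> ennreal" where
  "sup_Hps_norm T p \<sigma> G = (SUP (t, s) \<in> {0..T} \<times> {0..T}. Hps_norm p \<sigma> (\<lambda>(x, v). G t s x v))"

definition K_free ::
  "(real \<Rightarrow> real \<Rightarrow> real^'d::finite \<Rightarrow> real^'d \<Rightarrow> real^'d) \<Rightarrow> (real \<Rightarrow> real^'d \<Rightarrow> real)
     \<Rightarrow> real \<Rightarrow> real^'d \<Rightarrow> real" where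
  "K_free G H t x =
     (LBINT s:{0..t}. (LBINT v. grad (H s) (x - (t - s) *\<^sub>R v) \<bullet> G t s x v))"

definition K_fric ::
  "(real \<Rightarrow> real \<Rightarrow> real^'d::finite \<Rightarrow> real^'d \<Rightarrow> real^'d) \<Rightarrow> (real \<Rightarrow> real^'d \<Rightarrow> real)
     \<Rightarrow> real \<Rightarrow> real^'d \<Rightarrow> real" where
  "K_fric G H t x =
     (LBINT s:{0..t}. (LBINT v. grad (H s) (x + (1 - exp (t - s)) *\<^sub>R v) \<bullet> G t s x v))"

text \<open>
  For \<open>H\<close> merely in \<open>L\<^sup>2\<close> the gradient in \<open>K_free G H\<close> and \<open>K_fric G H\<close> is not a function; the operators
  are understood as the continuous extensions to \<open>L\<^sup>2\<close> of the integral formulas on smooth functions.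
  \<open>extends_to T K H U\<close> says that \<open>U\<close> is the value at \<open>H\<close> of the extension of \<open>K\<close>: \<open>K H\<^sub>n \<rightarrow> U\<close> in \<open>L\<^sup>2\<close>
  whenever \<open>H\<^sub>n\<close> are smooth and \<open>H\<^sub>n \<rightarrow> H\<close> in \<open>L\<^sup>2\<close>. Smooth functions being dense, \<open>U\<close> is unique up to
  null sets; for smooth \<open>H\<close> the constant sequence shows that \<open>U\<close> is \<open>K H\<close>.
\<close>

definition extends_to ::
  "real \<Rightarrow> ((real \<Rightarrow> real^'d::finite \<Rightarrow> real) \<Rightarrow> real \<Rightarrow> real^'d \<Rightarrow> real)
     \<Rightarrow> (real \<Rightarrow> real^'d \<Rightarrow> real) \<Rightarrow> (real \<Rightarrow> real^'d \<Rightarrow> real) \<Rightarrow> bool" where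
  "extends_to T K H U \<longleftrightarrow>
     in_L2 T U \<and>
     (\<forall>Hn. (\<forall>n::nat. smooth_function T (Hn n)) \<and>
           (\<lambda>n. L2_norm T (\<lambda>t x. Hn n t x - H t x)) \<longlonglongrightarrow> 0 \<longrightarrow>
           (\<forall>n. in_L2 T (K (Hn n))) \<and>
           (\<lambda>n. L2_norm T (\<lambda>t x. K (Hn n) t x - U t x)) \<longlonglongrightarrow> 0)"

end

theory Submission
  imports Defs
begin

text \<open>
  Both operators have the form
  \<open>averaging \<phi> G H\<close> with displacement \<open>\<phi> (t - s)\<close>, where \<open>\<phi> \<tau> \<ge> \<tau>\<close>.
  The \<open>n\<close>-th Fourier coefficient in \<open>x\<close> is the sum over \<open>k\<close> of the time integrals of
  \<open>H\<^sub>k(s) \<i>k \<bullet> G\<^sub>n\<^sub>-\<^sub>k(t, s, \<phi>(t - s) k)\<close>, with \<open>G\<close> transformed in both \<open>x\<close> and \<open>v\<close>. Integrating by parts \<open>p\<close> times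
  and using that the weight \<open>(1 + |v|\<^sup>2)\<^sup>-\<^sup>\<sigma>\<close> is integrable for \<open>\<sigma> > d/2\<close>, this kernel is at most
  \<open>|k| (1 + |n - k| + (t - s)|k|)\<^sup>-\<^sup>p\<close> times the norm of \<open>G\<close>. Integrating over \<open>t - s\<close> gains a factor \<open>|k|\<close>
  and leaves \<open>(1 + |n - k|)\<^sup>1\<^sup>-\<^sup>p\<close>, which is summable in \<open>k\<close> and in \<open>n\<close> precisely because \<open>p - 1 > d\<close>.
  Schur's test in time and frequency then bounds the operator on smooth functions uniformly in \<open>T\<close>,
  and density of trigonometric polynomials extends it.
\<close>

section \<open>Weights and lattice sums\<close>

text \<open>The obstacle is the gradient on \<open>H\<close>: it puts a factor |k| into the kernel
  that no regularity of \<open>H\<close> can absorb. It is compensated through the transport: mode k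
  evaluated at x - c v oscillates in v with frequency c k, so smoothness of the field in v, not of
  \<open>H\<close>, yields decay in c |k|. The time integral of the kernel is taken over the whole
  half-line, which is why no constant depends on the length of the time interval. For friction c =
  exp \<tau> - 1 \<ge> \<tau>, so the decay is at least that of free transport. Only repeated
  derivatives in one coordinate direction at a time are used: a bound for every coordinate of the
  joint frequency in (x, v) bounds the largest one, hence all of them. Two kinds of estimate
  coexist. Crude ones depend on the supremum of the gradient of \<open>H\<close>; they only make
  Fubini and Parseval applicable. The quantitative one sees \<open>H\<close> through its L2 norm
  alone and therefore survives the passage to the limit. Distances are kept squared, with (a - c)^2
  \<le> 2 (a - b)^2 + 2 (b - c)^2 as triangle inequality; this costs a factor 2 in the bound of the
  extended operators.\<close>

lemma nn_integral_powr_finite: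
  fixes \<rho> :: "'a \<Rightarrow> real" and s A :: real and d :: nat
  assumes [measurable]: "\<rho> \<in> borel_measurable M"
    and ge1: "\<And>x. x \<in> space M \<Longrightarrow> \<rho> x \<ge> 1"
    and growth: "\<And>R. R \<ge> 1 \<Longrightarrow> emeasure M {x\<in>space M. \<rho> x \<le> R} \<le> ennreal (A * R ^ d)"
    and "A \<ge> 0" and "s > d"
  shows "(\<integral>\<^sup>+x. ennreal (\<rho> x powr (-s)) \<partial>M) < \<infinity>"
proof -
  \<comment> \<open>Dyadic shells: where 2^n \<le> \<rho> < 2^(n+1) the integrand is at most
    \<open>c n\<close>. Each shell is then enlarged to a full sublevel set of \<rho>, so that the
    growth hypothesis applies directly. The measure is left abstract because both Lebesgue measure
    and counting measure are needed.\<close>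
  define c :: "nat \<Rightarrow> real" where "c n = 2 powr (- (s * n))" for n
  have pw: "ennreal (\<rho> x powr (-s)) \<le> (\<Sum>n. ennreal (c n) * indicator {x\<in>space M. \<rho> x \<le> 2 ^ Suc n} x)"
    if x: "x \<in> space M" for x
  proof -
    define n where "n = nat \<lfloor>log 2 (\<rho> x)\<rfloor>"
    have pos: "0 < \<rho> x" "0 \<le> log 2 (\<rho> x)" using ge1[OF x] by auto
    have n: "real n \<le> log 2 (\<rho> x)" "log 2 (\<rho> x) < real n + 1"
      using pos unfolding n_def by (auto simp: floor_less_iff)
    have lo: "2 powr n \<le> \<rho> x" using n(1) pos by (subst (asm) le_log_iff) auto
    have "\<rho> x < 2 powr (real n + 1)" using n(2) pos by (subst (asm) log_less_iff) auto
    also have "2 powr (real n + 1) = (2::real) ^ Suc n"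
      by (simp add: powr_add powr_realpow)
    finally have hi: "\<rho> x \<le> 2 ^ Suc n" by simp
    define f where "f n = ennreal (c n) * indicator {x\<in>space M. \<rho> x \<le> 2 ^ Suc n} x" for n
    have "\<rho> x powr (-s) \<le> (2 powr n) powr (-s)"
      using lo \<open>s > d\<close> by (intro powr_mono2') auto
    also have "\<dots> = c n" by (simp add: c_def powr_powr mult.commute)
    finally have "ennreal (\<rho> x powr (-s)) \<le> sum f {n}"
      using hi x by (auto simp: f_def ennreal_leI)
    also have "\<dots> \<le> suminf f" by (rule sum_le_suminf) auto
    finally show ?thesis unfolding f_def .
  qed
  have "(\<integral>\<^sup>+x. ennreal (\<rho> x powr (-s)) \<partial>M) \<le>
      (\<integral>\<^sup>+x. (\<Sum>n. ennreal (c n) * indicator {x\<in>space M. \<rho> x \<le> 2 ^ Suc n} x) \<partial>M)"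
    by (intro nn_integral_mono pw)
  also have "\<dots> = (\<Sum>n. ennreal (c n) * emeasure M {x\<in>space M. \<rho> x \<le> 2 ^ Suc n})"
    by (subst nn_integral_suminf) (auto simp: nn_integral_cmult)
  \<comment> \<open>Shell n contributes 2^(-s n) times at most A 2^((n+1) d): a geometric series of
    ratio 2^(d - s), which is below 1.\<close>
  also have "\<dots> \<le> (\<Sum>n. ennreal (A * 2 ^ d * (2 powr (d - s)) ^ n))"
  proof (intro suminf_le)
    fix n
    have "ennreal (c n) * emeasure M {x\<in>space M. \<rho> x \<le> 2 ^ Suc n} \<le> ennreal (c n) * ennreal (A * (2 ^ Suc n) ^ d)"
      by (intro mult_left_mono growth) (auto simp del: power_Suc)
    also have "\<dots> = ennreal (c n * (A * (2 ^ Suc n) ^ d))"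
      using \<open>A \<ge> 0\<close> by (simp add: ennreal_mult' c_def)
    also have "c n * (A * (2 ^ Suc n) ^ d) = A * 2 ^ d * (2 powr (d - s)) ^ n"
    proof -
      have "((2::real) ^ Suc n) ^ d = 2 ^ d * 2 powr (real d * n)"
        by (simp add: power_mult_distrib flip: powr_realpow) (simp add: powr_powr powr_realpow[symmetric] mult.commute)
      moreover have "(2 powr (d - s)) ^ n = 2 powr ((d - s) * n)"
        by (simp add: powr_powr flip: powr_realpow)
      moreover have "2 powr ((d - s) * n) = c n * 2 powr (real d * n)"
        by (simp add: c_def flip: powr_add) (simp add: algebra_simps)
      ultimately show ?thesis by simp
    qed
    finally show "ennreal (c n) * emeasure M {x\<in>space M. \<rho> x \<le> 2 ^ Suc n} \<le> ennreal (A * 2 ^ d * (2 powr (d - s)) ^ n)" .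
  qed auto
  also have "\<dots> < \<infinity>"
  proof -
    have "2 powr (d - s) < 1" using \<open>s > d\<close> by (simp add: powr_less_one)
    then have "summable (\<lambda>n. A * 2 ^ d * (2 powr (d - s)) ^ n)"
      by (intro summable_mult summable_geometric) auto
    then show ?thesis using \<open>A \<ge> 0\<close> by (subst suminf_ennreal2) auto
  qed
  finally show ?thesis .
qed

text \<open>With \<rho> = sqrt (1 + |v|^2) the exponent becomes 2 \<sigma>, which exceeds d. A
  sublevel set of \<rho> lies in a cube of side 2 R, whence the growth constant 2^d.\<close>

lemma weight_integral_finite:
  assumes "\<sigma> > CARD('d::finite) / 2"
  shows "(\<integral>\<^sup>+v. ennreal ((1 + (norm (v::real^'d))\<^sup>2) powr (-\<sigma>)) \<partial>lborel) < \<infinity>"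
proof -
  have "(\<integral>\<^sup>+v. ennreal (sqrt (1 + (norm (v::real^'d))\<^sup>2) powr (-(2*\<sigma>))) \<partial>lborel) < \<infinity>"
  proof (rule nn_integral_powr_finite[where d = "CARD('d)" and A = "2 ^ CARD('d)"])
    fix R :: real assume R: "R \<ge> 1"
    let ?one = "(\<Sum>i\<in>Basis. i) :: real^'d"
    have "emeasure lborel {v\<in>space lborel. sqrt (1 + (norm (v::real^'d))\<^sup>2) \<le> R} \<le> emeasure lborel (cbox (- R *\<^sub>R ?one) (R *\<^sub>R ?one))"
    proof (intro emeasure_mono subsetI)
      fix v :: "real^'d" assume "v \<in> {v\<in>space lborel. sqrt (1 + (norm v)\<^sup>2) \<le> R}"
      then have le: "sqrt (1 + (norm v)\<^sup>2) \<le> R" by simp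
      have "norm v \<le> sqrt (1 + (norm v)\<^sup>2)" by (rule real_le_rsqrt) simp
      with le have nv: "norm v \<le> R" by simp
      have "\<bar>v \<bullet> i\<bar> \<le> R" if "i \<in> Basis" for i
        using Basis_le_norm[OF that, of v] nv by linarith
      then show "v \<in> cbox (- R *\<^sub>R ?one) (R *\<^sub>R ?one)"
        by (auto simp: mem_box inner_sum_left abs_le_iff inner_Basis if_distrib cong: if_cong)
           (smt (verit, best))+
    qed auto
    also have "\<dots> = (\<Prod>b\<in>(Basis::(real^'d) set). (R *\<^sub>R ?one - (- R *\<^sub>R ?one)) \<bullet> b)"
      using R by (intro emeasure_lborel_cbox) auto
    also have "\<dots> = (\<Prod>b\<in>(Basis::(real^'d) set). 2 * R)"
    proof (intro arg_cong[where f = ennreal] prod.cong refl)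
      fix b :: "real^'d" assume "b \<in> Basis"
      then have "?one \<bullet> b = 1" by (simp add: inner_sum_left inner_Basis)
      then show "(R *\<^sub>R ?one - (- R *\<^sub>R ?one)) \<bullet> b = 2 * R"
        by (simp only: inner_diff_left inner_scaleR_left)
    qed
    also have "\<dots> = ennreal (2 ^ CARD('d) * R ^ CARD('d))"
      by (simp add: power_mult_distrib)
    finally show "emeasure lborel {v\<in>space lborel. sqrt (1 + (norm (v::real^'d))\<^sup>2) \<le> R} \<le> ennreal (2 ^ CARD('d) * R ^ CARD('d))" .
  qed (use assms in auto)
  moreover have "sqrt (1 + (norm v)\<^sup>2) powr (-(2*\<sigma>)) = (1 + (norm v)\<^sup>2) powr (-\<sigma>)" for v :: "real^'d"
    by (simp add: powr_half_sqrt[symmetric] powr_powr add_nonneg_nonneg)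
  ultimately show ?thesis by simp
qed

definition freq :: "int^'d::finite \<Rightarrow> real^'d" where "freq k = (\<chi> i. of_int (k $ i))"

lemma freq_simps: "freq (k + l) = freq k + freq l" "freq (k - l) = freq k - freq l"
  "freq (- k) = - freq k" "freq 0 = 0"
  by (auto simp: freq_def vec_eq_iff)

text \<open>Frequencies are measured by the sum of absolute coordinates: each coordinate is
  controlled by one coordinate derivative, and the sum is at most d times the largest
  coordinate.\<close>

definition l1 :: "real^'d::finite \<Rightarrow> real" where "l1 x = (\<Sum>i\<in>UNIV. \<bar>x $ i\<bar>)"

lemma l1_nonneg [simp]: "0 \<le> l1 x" by (auto simp: l1_def intro: sum_nonneg)

lemma component_le_l1: "\<bar>x $ i\<bar> \<le> l1 x"
  unfolding l1_def by (rule member_le_sum) auto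

lemma l1_scaleR: "l1 (c *\<^sub>R x) = \<bar>c\<bar> * l1 x"
  by (simp add: l1_def abs_mult sum_distrib_left)

lemma norm_le_l1: "norm x \<le> l1 x"
  unfolding l1_def by (rule norm_le_l1_cart)

lemma card_int_box: "card {k::int^'d::finite. \<forall>i. k $ i \<in> {- m..m}} = card {-m..m} ^ CARD('d)"
proof -
  have "bij_betw vec_nth {k::int^'d. \<forall>i. k $ i \<in> {- m..m}} (PiE UNIV (\<lambda>_. {-m..m}))"
    by (rule bij_betw_byWitness[where f' = vec_lambda]) (auto simp: vec_nth_inverse)
  then show ?thesis by (simp add: bij_betw_same_card card_PiE)
qed

text \<open>The counting-measure instance: a sublevel set sits in a cube of (2 floor R + 1)^d
  lattice points, which is at most (3 R)^d because R \<ge> 1.\<close>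

lemma lattice_sum_finite:
  assumes "s > CARD('d::finite)"
  shows "(\<integral>\<^sup>+k. ennreal ((1 + l1 (freq (k::int^'d))) powr (-s)) \<partial>count_space UNIV) < \<infinity>"
proof (rule nn_integral_powr_finite[where d = "CARD('d)" and A = "3 ^ CARD('d)"])
  fix R :: real assume R: "R \<ge> 1"
  let ?B = "{k::int^'d. \<forall>i. k $ i \<in> {- \<lfloor>R\<rfloor>..\<lfloor>R\<rfloor>}}"
  have fin: "finite ?B"
    using card_int_box[where 'd = 'd, of "\<lfloor>R\<rfloor>"] R by (intro card_ge_0_finite) simp
  have "{k::int^'d. 1 + l1 (freq k) \<le> R} \<subseteq> ?B"
  proof (intro subsetI CollectI allI)
    fix k :: "int^'d" and i assume "k \<in> {k. 1 + l1 (freq k) \<le> R}"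
    then have "\<bar>of_int (k $ i)\<bar> \<le> R" using component_le_l1[of "freq k" i] by (simp add: freq_def)
    then show "k $ i \<in> {- \<lfloor>R\<rfloor>..\<lfloor>R\<rfloor>}" by (simp add: le_floor_iff minus_le_iff[of "\<lfloor>R\<rfloor>"]) linarith
  qed
  then have "emeasure (count_space UNIV) {k::int^'d. 1 + l1 (freq k) \<le> R} \<le> emeasure (count_space UNIV) ?B"
    by (intro emeasure_mono) auto
  also have "\<dots> = ennreal (real (card ?B))" using fin by (simp add: ennreal_of_nat_eq_real_of_nat)
  also have "real (card ?B) = (2 * of_int \<lfloor>R\<rfloor> + 1) ^ CARD('d)"
    unfolding card_int_box using R by simp
  also have "\<dots> \<le> ennreal ((3 * R) ^ CARD('d))"
    using R by (intro ennreal_leI power_mono) linarith+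
  finally show "emeasure (count_space UNIV) {k\<in>space (count_space UNIV). 1 + l1 (freq (k::int^'d)) \<le> R} \<le> ennreal (3 ^ CARD('d) * R ^ CARD('d))"
    by (simp add: power_mult_distrib)
qed (use assms in auto)

section \<open>Integration over the torus\<close>

text \<open>Single coordinate steps generate the lattice: natural multiples by induction, negative
  ones by stepping back, and then the coordinates are added one after another.\<close>

lemma periodic_freq:
  fixes f :: "real^'d::finite \<Rightarrow> 'b"
  assumes "periodic f"
  shows "f (x + (2 * pi) *\<^sub>R freq k) = f x"
proof -
  have nat_step: "f (y + axis i (2 * pi * real n)) = f y" for y i n
  proof (induction n arbitrary: y)
    case (Suc n)
    have "y + axis i (2 * pi * real (Suc n)) = (y + axis i (2 * pi * real n)) + axis i (2 * pi)"
      by (simp add: vec_eq_iff axis_def algebra_simps)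
    then show ?case using assms Suc by (simp add: periodic_def flip: add.assoc)
  qed (simp add: axis_def flip: zero_vec_def)
  have int_step: "f (y + axis i (2 * pi * of_int n)) = f y" for y i n
  proof (cases "n \<ge> 0")
    case True
    then show ?thesis using nat_step[of y i "nat n"] by simp
  next
    case False
    have "(y + axis i (2 * pi * of_int n)) + axis i (2 * pi * real (nat (- n))) = y"
      using False by (simp add: vec_eq_iff axis_def algebra_simps)
    then show ?thesis using nat_step[of "y + axis i (2 * pi * of_int n)" i "nat (- n)"] by metis
  qed
  have "f (x + (\<Sum>i\<in>J. axis i (2 * pi * of_int (k $ i)))) = f x" if "finite J" for J
    using that
  proof (induction J)
    case (insert i J)
    then show ?case
      using int_step[of "x + (\<Sum>i\<in>J. axis i (2 * pi * of_int (k $ i)))" i "k $ i"]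
      by (simp add: add_ac)
  qed simp
  moreover have "(\<Sum>i\<in>UNIV. axis i (2 * pi * of_int (k $ i))) = (2 * pi) *\<^sub>R freq k"
    by (simp add: freq_def vec_eq_iff axis_def if_distrib cong: if_cong)
  ultimately show ?thesis by (metis finite)
qed

section \<open>Reduction modulo the period lattice\<close>

definition wrap_index :: "real^'d::finite \<Rightarrow> int^'d" where
  "wrap_index x = (\<chi> i. \<lfloor>x $ i / (2 * pi)\<rfloor>)"

definition wrap :: "real^'d::finite \<Rightarrow> real^'d" where
  "wrap x = x + (2 * pi) *\<^sub>R freq (- wrap_index x)"

text \<open>Half-open, unlike the closed box behind \<open>torus\<close>, so that its lattice
  translates tile the space without overlap. The two sets differ by a null set, see
  \<open>AE_box_cell\<close>.\<close>

definition cell :: "(real^'d::finite) set" where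
  "cell = {x. \<forall>i. 0 \<le> x $ i \<and> x $ i < 2 * pi}"

lemma periodic_wrap: "periodic f \<Longrightarrow> f (wrap x) = f x"
  unfolding wrap_def by (rule periodic_freq)

text \<open>Exactly one lattice translate of a point lies in the cell. This uniqueness is what makes
  the indicators of all translates add up to 1.\<close>

lemma shift_mem_cell_iff: "x + (2 * pi) *\<^sub>R freq k \<in> cell \<longleftrightarrow> k = - wrap_index x"
proof -
  have "0 \<le> x $ i + 2 * pi * of_int (k $ i) \<and> x $ i + 2 * pi * of_int (k $ i) < 2 * pi
      \<longleftrightarrow> \<lfloor>x $ i / (2 * pi)\<rfloor> = - k $ i" for i
    by (simp add: floor_eq_iff field_simps) (auto simp: algebra_simps)
  then show ?thesis
    by (simp add: cell_def freq_def wrap_index_def vec_eq_iff) (metis minus_equation_iff)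
qed

lemma wrap_in_cell: "wrap x \<in> cell"
  unfolding wrap_def by (simp add: shift_mem_cell_iff)

lemma wrap_cell: "x \<in> cell \<Longrightarrow> wrap x = x"
  using shift_mem_cell_iff[of x 0] by (auto simp: wrap_def freq_simps)

lemma wrap_shift: "wrap (x + (2 * pi) *\<^sub>R freq k) = wrap x"
proof -
  have "wrap_index (x + (2 * pi) *\<^sub>R freq k) = wrap_index x + k"
    by (simp add: wrap_index_def freq_def vec_eq_iff add_divide_distrib)
  then show ?thesis by (simp add: wrap_def freq_simps algebra_simps)
qed

lemma periodic_wrap_comp: "periodic (\<lambda>x::real^'d::finite. f (wrap x))"
proof -
  have "axis i (2 * pi) = (2 * pi) *\<^sub>R freq (axis i 1)" for i :: 'd
    by (simp add: vec_eq_iff axis_def freq_def)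
  then show ?thesis by (simp add: periodic_def wrap_shift)
qed

lemma cell_borel [measurable]: "cell \<in> sets borel"
  unfolding cell_def by measurable

lemma wrap_measurable [measurable]: "wrap \<in> borel_measurable borel"
proof (rule borel_measurable_euclidean_space[THEN iffD2], rule ballI)
  fix b :: "real^'d" assume "b \<in> Basis"
  then obtain i where b: "b = axis i 1" by (auto simp: Basis_vec_def)
  have "(\<lambda>x::real^'d. x $ i + 2 * pi * of_int (- \<lfloor>x $ i / (2 * pi)\<rfloor>)) \<in> borel_measurable borel"
    by measurable
  then show "(\<lambda>x::real^'d. wrap x \<bullet> b) \<in> borel_measurable borel"
    by (simp add: b wrap_def freq_def wrap_index_def inner_axis)
qed

lemma sets_torus [measurable_cong, simp]: "sets torus = sets borel"
  by (simp add: torus_def)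

lemma space_torus [simp]: "space torus = UNIV"
  by (simp add: torus_def)

abbreviation torus_volume :: "'d::finite itself \<Rightarrow> real" where
  "torus_volume _ \<equiv> (2 * pi) ^ CARD('d)"

lemma two_pi_box: "cbox 0 (\<chi> i. 2 * pi) = cbox 0 ((2 * pi) *\<^sub>R (\<Sum>b\<in>Basis. b) :: real^'d::finite)"
proof -
  have "(\<chi> i. 2 * pi) = ((2 * pi) *\<^sub>R (\<Sum>b\<in>Basis. b) :: real^'d)"
  proof (rule euclidean_eqI)
    fix b :: "real^'d" assume b: "b \<in> Basis"
    then obtain i where "b = axis i 1" by (auto simp: Basis_vec_def)
    moreover have "(\<Sum>b\<in>Basis. b) \<bullet> b = 1"
      using b by (simp add: inner_sum_left inner_Basis)
    ultimately show "(\<chi> i. 2 * pi) \<bullet> b = (2 * pi) *\<^sub>R (\<Sum>b\<in>Basis. b) \<bullet> b"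
      by (simp only: inner_scaleR_left) (simp add: inner_axis)
  qed
  then show ?thesis by simp
qed

lemma emeasure_two_pi_box: "emeasure lborel (cbox 0 (\<chi> i. 2 * pi) :: (real^'d::finite) set) = ennreal (torus_volume TYPE('d))"
proof -
  let ?one = "(\<Sum>b\<in>Basis. b) :: real^'d"
  have one: "?one \<bullet> b = 1" if "b \<in> Basis" for b using that by (simp add: inner_sum_left inner_Basis)
  have "emeasure lborel (cbox 0 ((2 * pi) *\<^sub>R ?one)) = (\<Prod>b\<in>(Basis::(real^'d) set). ((2 * pi) *\<^sub>R ?one - 0) \<bullet> b)"
    by (intro emeasure_lborel_cbox) (simp only: inner_scaleR_left one inner_zero_left, simp)
  also have "\<dots> = (\<Prod>b\<in>(Basis::(real^'d) set). 2 * pi)"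
    by (intro arg_cong[where f = ennreal] prod.cong refl) (simp only: diff_zero inner_scaleR_left one)
  finally show ?thesis unfolding two_pi_box by simp
qed

lemma emeasure_torus_UNIV [simp]: "emeasure torus UNIV = 1"
  unfolding torus_def
  by (subst emeasure_uniform_measure) (auto simp: emeasure_two_pi_box intro!: ennreal_divide_self)

interpretation torus: finite_measure "torus :: (real^'d::finite) measure"
  by (rule finite_measureI) simp

text \<open>The cell lies between the open and the closed box, whose difference is the negligible
  boundary.\<close>

lemma AE_box_cell: "AE x in lborel. x \<in> cbox 0 (\<chi> i. 2 * pi) \<longleftrightarrow> x \<in> (cell :: (real^'d::finite) set)"
proof -
  let ?a = "0 :: real^'d" and ?b = "(\<chi> i. 2 * pi) :: real^'d"
  have "negligible (cbox ?a ?b - box ?a ?b)" by (rule negligible_frontier_interval)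
  then have "cbox ?a ?b - box ?a ?b \<in> null_sets lebesgue" by (simp add: negligible_iff_null_sets)
  then have "cbox ?a ?b - box ?a ?b \<in> null_sets lborel"
    by (simp add: null_sets_completion_iff)
  then have "AE x in lborel. x \<notin> cbox ?a ?b - box ?a ?b" by (rule AE_not_in)
  moreover have "box ?a ?b \<subseteq> cell" "cell \<subseteq> cbox ?a ?b"
    by (auto simp: cell_def mem_box_cart less_imp_le)
  ultimately show ?thesis by (auto elim!: eventually_mono)
qed

lemma nn_integral_torus:
  fixes f :: "real^'d::finite \<Rightarrow> ennreal"
  assumes [measurable]: "f \<in> borel_measurable borel"
  shows "(\<integral>\<^sup>+x. f x \<partial>torus) = (\<integral>\<^sup>+x. f x * indicator cell x \<partial>lborel) / ennreal (torus_volume TYPE('d))"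
proof -
  have "(\<integral>\<^sup>+x. f x * indicator (cbox 0 (\<chi> i. 2 * pi)) x \<partial>lborel) = (\<integral>\<^sup>+x. f x * indicator cell x \<partial>lborel)"
    by (rule nn_integral_cong_AE) (use AE_box_cell in \<open>auto elim!: eventually_mono simp: indicator_def\<close>)
  then show ?thesis
    unfolding torus_def by (subst nn_integral_uniform_measure) (auto simp: emeasure_two_pi_box)
qed

lemma AE_torus_cell: "AE x in torus. x \<in> cell"
proof -
  have "AE x in torus. x \<in> cbox 0 (\<chi> i. 2 * pi) \<longrightarrow> x \<in> (cell :: (real^'d::finite) set)"
    unfolding torus_def using AE_box_cell
    by (intro AE_uniform_measureI) (auto elim!: eventually_mono)
  moreover have "AE x in torus. x \<in> cbox 0 ((\<chi> i. 2 * pi) :: real^'d)"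
    unfolding torus_def by (intro AE_uniform_measureI) auto
  ultimately show ?thesis by (auto elim: eventually_elim2)
qed

section \<open>Translation invariance on the torus and on phase space\<close>

lemma nn_integral_lborel_shift:
  fixes f :: "'a::euclidean_space \<Rightarrow> ennreal"
  assumes [measurable]: "f \<in> borel_measurable borel"
  shows "(\<integral>\<^sup>+x. f (h + x) \<partial>lborel) = (\<integral>\<^sup>+x. f x \<partial>lborel)"
  by (subst lborel_distr_plus[symmetric, of h], subst nn_integral_distr) auto

text \<open>Both sides of the translation identity are compared through the tiling of space by the
  lattice translates of the cell.\<close>

lemma nn_integral_torus_shift:
  fixes f :: "real^'d::finite \<Rightarrow> ennreal"
  assumes [measurable]: "f \<in> borel_measurable borel" and per: "periodic f"
  shows "(\<integral>\<^sup>+x. f (x + h) \<partial>torus) = (\<integral>\<^sup>+x. f x \<partial>torus)"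
proof -
  let ?C = "count_space (UNIV :: (int^'d) set)"
  let ?i = "indicator (cell :: (real^'d) set) :: real^'d \<Rightarrow> ennreal"
  have tile: "(\<integral>\<^sup>+k. ?i (y + (2 * pi) *\<^sub>R freq k) \<partial>?C) = 1" for y
    by (subst nn_integral_count_space'[of "{- wrap_index y}"])
      (auto simp: indicator_def shift_mem_cell_iff)
  have "(\<integral>\<^sup>+x. f (x + h) * ?i x \<partial>lborel) = (\<integral>\<^sup>+x. f x * ?i (x - h) \<partial>lborel)"
    by (subst nn_integral_lborel_shift[symmetric, of _ h]) (auto simp: add.commute)
  also have "\<dots> = (\<integral>\<^sup>+y. (\<integral>\<^sup>+k. f y * ?i (y - h) * ?i (y + (2 * pi) *\<^sub>R freq k) \<partial>?C) \<partial>lborel)"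
    by (subst nn_integral_cmult) (auto simp: tile)
  also have "\<dots> = (\<integral>\<^sup>+k. (\<integral>\<^sup>+y. f y * ?i (y - h) * ?i (y + (2 * pi) *\<^sub>R freq k) \<partial>lborel) \<partial>?C)"
    by (rule nn_integral_count_space_nn_integral) auto
  also have "\<dots> = (\<integral>\<^sup>+k. (\<integral>\<^sup>+y. f y * ?i ((y - h) + (2 * pi) *\<^sub>R freq (- k)) * ?i y \<partial>lborel) \<partial>?C)"
  proof (rule nn_integral_cong)
    fix k
    show "(\<integral>\<^sup>+y. f y * ?i (y - h) * ?i (y + (2 * pi) *\<^sub>R freq k) \<partial>lborel)
        = (\<integral>\<^sup>+y. f y * ?i ((y - h) + (2 * pi) *\<^sub>R freq (- k)) * ?i y \<partial>lborel)"
      using periodic_freq[OF per, of _ "-k"]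
      by (subst nn_integral_lborel_shift[symmetric, of _ "(2 * pi) *\<^sub>R freq (- k)"])
         (auto simp: freq_simps algebra_simps)
  qed
  also have "\<dots> = (\<integral>\<^sup>+y. (\<integral>\<^sup>+k. f y * ?i ((y - h) + (2 * pi) *\<^sub>R freq (- k)) * ?i y \<partial>?C) \<partial>lborel)"
    by (rule nn_integral_count_space_nn_integral[symmetric]) auto
  also have "\<dots> = (\<integral>\<^sup>+y. f y * ?i y \<partial>lborel)"
  proof (rule nn_integral_cong)
    fix y
    have "(\<integral>\<^sup>+k. f y * ?i ((y - h) + (2 * pi) *\<^sub>R freq (- k)) * ?i y \<partial>?C)
        = (\<integral>\<^sup>+k. f y * ?i y * ?i ((y - h) + (2 * pi) *\<^sub>R freq (- k)) \<partial>?C)"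
      by (simp add: mult_ac)
    also have "\<dots> = (\<integral>\<^sup>+k. f y * ?i y * ?i ((y - h) + (2 * pi) *\<^sub>R freq k) \<partial>?C)"
      by (rule nn_integral_bij_count_space[where g = uminus]) (auto intro!: bij_betwI[where g = uminus])
    also have "\<dots> = f y * ?i y" by (subst nn_integral_cmult) (auto simp: tile)
    finally show "(\<integral>\<^sup>+k. f y * ?i ((y - h) + (2 * pi) *\<^sub>R freq (- k)) * ?i y \<partial>?C) = f y * ?i y" .
  qed
  finally show ?thesis by (simp add: nn_integral_torus)
qed

text \<open>Invariance phrased as a push-forward, so that Bochner integrals inherit it through
  change of variables. The shift is followed by \<open>wrap\<close> because \<open>torus\<close>
  charges only one period cell; periodic integrands do not notice.\<close>

lemma distr_torus_wrap_shift: "distr torus borel (\<lambda>x. wrap (x + h)) = torus"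
proof (rule measure_eqI)
  fix A assume "A \<in> sets (distr torus borel (\<lambda>x. wrap (x + h)))"
  then have [measurable]: "A \<in> sets borel" by simp
  have "emeasure (distr torus borel (\<lambda>x. wrap (x + h))) A = (\<integral>\<^sup>+x. indicator A (wrap (x + h)) \<partial>torus)"
    by (subst nn_integral_indicator[symmetric], simp, subst nn_integral_distr) auto
  also have "\<dots> = (\<integral>\<^sup>+x. indicator A (wrap x) \<partial>torus)"
    by (rule nn_integral_torus_shift) (auto intro: periodic_wrap_comp)
  also have "\<dots> = (\<integral>\<^sup>+x. indicator A x \<partial>torus)"
    by (rule nn_integral_cong_AE) (use AE_torus_cell in \<open>auto elim!: eventually_mono simp: wrap_cell\<close>)
  finally show "emeasure (distr torus borel (\<lambda>x. wrap (x + h))) A = emeasure torus A" by simp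
qed simp

lemma sigma_finite_torus: "sigma_finite_measure torus"
  by unfold_locales

interpretation torus_lborel: pair_sigma_finite "torus :: (real^'d::finite) measure" "lborel :: 'a::euclidean_space measure"
  by unfold_locales

interpretation lborel_torus: pair_sigma_finite "lborel :: 'a::euclidean_space measure" "torus :: (real^'d::finite) measure"
  by unfold_locales

lemma sets_torus_lborel [measurable_cong, simp]:
  "sets ((torus :: (real^'d::finite) measure) \<Otimes>\<^sub>M (lborel :: 'a::euclidean_space measure)) = sets borel"
  by (subst sets_pair_measure_cong[OF sets_torus sets_lborel]) (rule arg_cong[OF borel_prod])

lemma space_torus_lborel [simp]:
  "space ((torus :: (real^'d::finite) measure) \<Otimes>\<^sub>M (lborel :: 'a::euclidean_space measure)) = UNIV"
  by (simp add: space_pair_measure)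

text \<open>A product of two push-forwards; only the spatial component has to be brought back to the
  cell.\<close>

lemma distr_torus_lborel_shift:
  "distr (torus \<Otimes>\<^sub>M lborel) borel (\<lambda>(x, v). (wrap (x + a), v + w)) = torus \<Otimes>\<^sub>M lborel"
proof -
  have l: "distr lborel borel (\<lambda>v. v + w) = lborel"
    using lborel_distr_plus[of w] by (simp add: add.commute[of w] cong: distr_cong)
  have "distr torus borel (\<lambda>x. wrap (x + a)) \<Otimes>\<^sub>M distr lborel borel (\<lambda>v. v + w)
     = distr (torus \<Otimes>\<^sub>M lborel) (borel \<Otimes>\<^sub>M borel) (\<lambda>(x, v). (wrap (x + a), v + w))"
    by (rule pair_measure_distr) (auto simp: l lborel.sigma_finite_measure_axioms)
  then show ?thesis by (simp add: l distr_torus_wrap_shift borel_prod)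
qed

definition xperiodic :: "((real^'d::finite) \<times> 'a \<Rightarrow> 'b) \<Rightarrow> bool" where
  "xperiodic f \<longleftrightarrow> (\<forall>v. periodic (\<lambda>x. f (x, v)))"

lemma xperiodic_wrap: "xperiodic f \<Longrightarrow> f (wrap x, v) = f (x, v)"
  unfolding xperiodic_def by (metis periodic_wrap)

lemma integrable_phase_shift:
  fixes f :: "(real^'d::finite) \<times> 'a::euclidean_space \<Rightarrow> 'b::{banach, second_countable_topology}"
  assumes per: "xperiodic f" and int: "integrable (torus \<Otimes>\<^sub>M lborel) f"
  shows "integrable (torus \<Otimes>\<^sub>M lborel) (\<lambda>z. f (z + b))"
    and "(\<integral>z. f (z + b) \<partial>(torus \<Otimes>\<^sub>M lborel)) = (\<integral>z. f z \<partial>(torus \<Otimes>\<^sub>M lborel))"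
proof -
  let ?T = "\<lambda>(x::real^'d, v::'a). (wrap (x + fst b), v + snd b)"
  have [measurable]: "f \<in> borel_measurable borel"
    using borel_measurable_integrable[OF int] by simp
  have T: "?T \<in> measurable (torus \<Otimes>\<^sub>M lborel) borel"
    unfolding borel_prod[symmetric] case_prod_beta'
    by (intro measurable_Pair measurable_compose[OF measurable_fst] measurable_compose[OF measurable_snd]) auto
  have fT: "f (?T z) = f (z + b)" for z
    by (cases z; cases b) (simp add: xperiodic_wrap[OF per])
  have "integrable (distr (torus \<Otimes>\<^sub>M lborel) borel ?T) f"
    using int by (simp add: distr_torus_lborel_shift)
  then show "integrable (torus \<Otimes>\<^sub>M lborel) (\<lambda>z. f (z + b))"
    by (subst (asm) integrable_distr_eq[OF T]) (auto simp: fT)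
  have "(\<integral>z. f z \<partial>(torus \<Otimes>\<^sub>M lborel)) = (\<integral>z. f z \<partial>(distr (torus \<Otimes>\<^sub>M lborel) borel ?T))"
    by (simp add: distr_torus_lborel_shift)
  also have "\<dots> = (\<integral>z. f (z + b) \<partial>(torus \<Otimes>\<^sub>M lborel))"
    by (subst integral_distr[OF T]) (auto simp: fT)
  finally show "(\<integral>z. f (z + b) \<partial>(torus \<Otimes>\<^sub>M lborel)) = (\<integral>z. f z \<partial>(torus \<Otimes>\<^sub>M lborel))" ..
qed

lemma integral_torus_shift:
  fixes f :: "real^'d::finite \<Rightarrow> 'b::{banach, second_countable_topology}"
  assumes per: "periodic f" and [measurable]: "f \<in> borel_measurable borel"
  shows "(\<integral>x. f (x + h) \<partial>torus) = (\<integral>x. f x \<partial>torus)"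
proof -
  have "(\<integral>x. f x \<partial>torus) = (\<integral>x. f x \<partial>(distr torus borel (\<lambda>x. wrap (x + h))))"
    by (simp add: distr_torus_wrap_shift)
  also have "\<dots> = (\<integral>x. f (x + h) \<partial>torus)"
    by (subst integral_distr) (auto simp: periodic_wrap[OF per])
  finally show ?thesis ..
qed

section \<open>Density of polynomials in square-integrable functions\<close>

text \<open>Replaces Minkowski's inequality throughout: all approximation arguments then stay with
  squared integrals in the extended reals and need no roots.\<close>

lemma sq_diff_le: "ennreal ((a - c)\<^sup>2) \<le> 2 * ennreal ((a - b)\<^sup>2) + 2 * ennreal ((b - c)\<^sup>2)"
proof -
  have "0 \<le> ((a - b) - (b - c))\<^sup>2" by simp
  then have "(a - c)\<^sup>2 \<le> 2 * (a - b)\<^sup>2 + 2 * (b - c)\<^sup>2" by (simp add: power2_eq_square algebra_simps)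
  then have "ennreal ((a - c)\<^sup>2) \<le> ennreal (2 * (a - b)\<^sup>2 + 2 * (b - c)\<^sup>2)" by (rule ennreal_leI)
  then show ?thesis by (simp add: ennreal_mult')
qed

lemma nn_integral_sq_diff_le:
  fixes f g h :: "'a \<Rightarrow> real"
  assumes [measurable]: "f \<in> borel_measurable M" "g \<in> borel_measurable M" "h \<in> borel_measurable M"
  shows "(\<integral>\<^sup>+x. ennreal ((f x - h x)\<^sup>2) \<partial>M) \<le>
    2 * (\<integral>\<^sup>+x. ennreal ((f x - g x)\<^sup>2) \<partial>M) + 2 * (\<integral>\<^sup>+x. ennreal ((g x - h x)\<^sup>2) \<partial>M)"
proof -
  have "(\<integral>\<^sup>+x. ennreal ((f x - h x)\<^sup>2) \<partial>M) \<le> (\<integral>\<^sup>+x. 2 * ennreal ((f x - g x)\<^sup>2) + 2 * ennreal ((g x - h x)\<^sup>2) \<partial>M)"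
    by (intro nn_integral_mono sq_diff_le)
  then show ?thesis by (simp add: nn_integral_add nn_integral_cmult)
qed

lemma ennreal_quarters: "0 \<le> \<epsilon> \<Longrightarrow> 2 * ennreal (\<epsilon>/4) + 2 * ennreal (\<epsilon>/4) = ennreal \<epsilon>"
proof -
  assume "0 \<le> \<epsilon>"
  then have "2 * ennreal (\<epsilon>/4) = ennreal (\<epsilon>/2)"
    by (subst ennreal_numeral[symmetric], subst ennreal_mult'[symmetric]) auto
  then show ?thesis using \<open>0 \<le> \<epsilon>\<close> by (simp add: ennreal_plus[symmetric] del: ennreal_plus)
qed

text \<open>Membership in the L2 closure of the polynomials, with the distance measured
  squared.\<close>

definition poly_approx :: "'a::euclidean_space measure \<Rightarrow> ('a \<Rightarrow> real) \<Rightarrow> bool" where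
  "poly_approx M h \<longleftrightarrow>
     (\<forall>\<epsilon>>0. \<exists>q. real_polynomial_function q \<and> (\<integral>\<^sup>+x. ennreal ((h x - q x)\<^sup>2) \<partial>M) \<le> ennreal \<epsilon>)"

lemma real_polynomial_function_borel [measurable_dest]:
  fixes q :: "'a::euclidean_space \<Rightarrow> real"
  shows "real_polynomial_function q \<Longrightarrow> q \<in> borel_measurable borel"
  by (intro borel_measurable_continuous_onI continuous_on_polymonial_function)
    (simp add: real_polynomial_function_eq)

text \<open>The closure is closed. This allows the climb from continuous functions to indicators of
  compact sets, to indicators of Borel sets and finally, via simple functions, to all of L2.\<close>

lemma poly_approx_limit:
  fixes h :: "'a::euclidean_space \<Rightarrow> real"
  assumes sets: "sets M = sets borel" and [measurable]: "h \<in> borel_measurable borel"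
    and ap: "\<And>\<epsilon>. \<epsilon> > 0 \<Longrightarrow> \<exists>g\<in>borel_measurable borel. poly_approx M g \<and> (\<integral>\<^sup>+x. ennreal ((h x - g x)\<^sup>2) \<partial>M) \<le> ennreal \<epsilon>"
  shows "poly_approx M h"
  unfolding poly_approx_def
proof (intro allI impI)
  fix \<epsilon> :: real assume "\<epsilon> > 0"
  note sets[measurable_cong]
  from ap[of "\<epsilon>/4"] \<open>\<epsilon> > 0\<close> obtain g where [measurable]: "g \<in> borel_measurable borel"
    and g: "poly_approx M g" "(\<integral>\<^sup>+x. ennreal ((h x - g x)\<^sup>2) \<partial>M) \<le> ennreal (\<epsilon>/4)" by auto
  from g(1) \<open>\<epsilon> > 0\<close> obtain q where q: "real_polynomial_function q"
    and qg: "(\<integral>\<^sup>+x. ennreal ((g x - q x)\<^sup>2) \<partial>M) \<le> ennreal (\<epsilon>/4)"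
    unfolding poly_approx_def by (meson divide_pos_pos zero_less_numeral)
  have [measurable]: "q \<in> borel_measurable borel" using q by (rule real_polynomial_function_borel)
  have "(\<integral>\<^sup>+x. ennreal ((h x - q x)\<^sup>2) \<partial>M) \<le> 2 * (\<integral>\<^sup>+x. ennreal ((h x - g x)\<^sup>2) \<partial>M) + 2 * (\<integral>\<^sup>+x. ennreal ((g x - q x)\<^sup>2) \<partial>M)"
    by (rule nn_integral_sq_diff_le) auto
  also have "\<dots> \<le> 2 * ennreal (\<epsilon>/4) + 2 * ennreal (\<epsilon>/4)"
    using g(2) qg by (intro add_mono mult_left_mono) auto
  also have "\<dots> = ennreal \<epsilon>" using \<open>\<epsilon> > 0\<close> by (intro ennreal_quarters) auto
  finally show "\<exists>q. real_polynomial_function q \<and> (\<integral>\<^sup>+x. ennreal ((h x - q x)\<^sup>2) \<partial>M) \<le> ennreal \<epsilon>"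
    using q by auto
qed

lemma poly_approx_scale_add:
  fixes f g :: "'a::euclidean_space \<Rightarrow> real"
  assumes sets: "sets M = sets borel"
    and [measurable]: "f \<in> borel_measurable borel" "g \<in> borel_measurable borel"
    and f: "poly_approx M f" and g: "poly_approx M g"
  shows "poly_approx M (\<lambda>x. c * f x + g x)"
  unfolding poly_approx_def
proof (intro allI impI)
  fix \<epsilon> :: real assume "\<epsilon> > 0"
  note sets[measurable_cong]
  \<comment> \<open>Chosen so that c^2 \<delta> \<le> \<epsilon> / 4; the summand 1 keeps the
    quotient meaningful when c = 0.\<close>
  define \<delta> where "\<delta> = \<epsilon> / (4 * (1 + c\<^sup>2))"
  have \<delta>: "\<delta> > 0" "\<epsilon> / 4 > 0" "c\<^sup>2 * \<delta> \<le> \<epsilon>/4" using \<open>\<epsilon> > 0\<close> by (auto simp: \<delta>_def field_simps add_pos_nonneg)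
  obtain p where p: "real_polynomial_function p"
    and pf: "(\<integral>\<^sup>+x. ennreal ((f x - p x)\<^sup>2) \<partial>M) \<le> ennreal \<delta>"
    using f \<delta>(1) unfolding poly_approx_def by blast
  obtain q where q: "real_polynomial_function q"
    and qg: "(\<integral>\<^sup>+x. ennreal ((g x - q x)\<^sup>2) \<partial>M) \<le> ennreal (\<epsilon> / 4)"
    using g \<delta>(2) unfolding poly_approx_def by blast
  note [measurable] = real_polynomial_function_borel[OF p] real_polynomial_function_borel[OF q]
  have "(\<integral>\<^sup>+x. ennreal (((c * f x + g x) - (c * p x + q x))\<^sup>2) \<partial>M)
     \<le> 2 * (\<integral>\<^sup>+x. ennreal (((c * f x + g x) - (c * p x + g x))\<^sup>2) \<partial>M)
     + 2 * (\<integral>\<^sup>+x. ennreal (((c * p x + g x) - (c * p x + q x))\<^sup>2) \<partial>M)"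
    by (rule nn_integral_sq_diff_le) auto
  also have "(\<integral>\<^sup>+x. ennreal (((c * f x + g x) - (c * p x + g x))\<^sup>2) \<partial>M) = ennreal (c\<^sup>2) * (\<integral>\<^sup>+x. ennreal ((f x - p x)\<^sup>2) \<partial>M)"
    by (subst nn_integral_cmult[symmetric])
       (auto simp: ennreal_mult'[symmetric] power_mult_distrib[symmetric] right_diff_distrib)
  also have "(\<integral>\<^sup>+x. ennreal (((c * p x + g x) - (c * p x + q x))\<^sup>2) \<partial>M) = (\<integral>\<^sup>+x. ennreal ((g x - q x)\<^sup>2) \<partial>M)"
    by simp
  also have "2 * (ennreal (c\<^sup>2) * (\<integral>\<^sup>+x. ennreal ((f x - p x)\<^sup>2) \<partial>M)) + 2 * (\<integral>\<^sup>+x. ennreal ((g x - q x)\<^sup>2) \<partial>M)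
      \<le> 2 * ennreal (\<epsilon>/4) + 2 * ennreal (\<epsilon>/4)"
  proof (rule add_mono)
    have "ennreal (c\<^sup>2) * (\<integral>\<^sup>+x. ennreal ((f x - p x)\<^sup>2) \<partial>M) \<le> ennreal (c\<^sup>2) * ennreal \<delta>"
      using pf by (intro mult_left_mono) auto
    also have "\<dots> \<le> ennreal (\<epsilon>/4)" using \<delta> by (subst ennreal_mult'[symmetric]) (auto intro: ennreal_leI)
    finally show "2 * (ennreal (c\<^sup>2) * (\<integral>\<^sup>+x. ennreal ((f x - p x)\<^sup>2) \<partial>M)) \<le> 2 * ennreal (\<epsilon>/4)"
      by (intro mult_left_mono) auto
    show "2 * (\<integral>\<^sup>+x. ennreal ((g x - q x)\<^sup>2) \<partial>M) \<le> 2 * ennreal (\<epsilon>/4)"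
      using qg by (intro mult_left_mono) auto
  qed
  also have "\<dots> = ennreal \<epsilon>" using \<open>\<epsilon> > 0\<close> by (intro ennreal_quarters) auto
  finally show "\<exists>q. real_polynomial_function q \<and> (\<integral>\<^sup>+x. ennreal ((c * f x + g x - q x)\<^sup>2) \<partial>M) \<le> ennreal \<epsilon>"
    using real_polynomial_function.intros(3)[OF real_polynomial_function.intros(4)[OF real_polynomial_function.intros(2)[of c] p] q]
    by (intro exI[of _ "\<lambda>x. c * p x + q x"]) auto
qed

text \<open>Stone--Weierstrass on the compact set that carries the measure: uniform approximation
  there is L2 approximation because the measure is finite.\<close>

lemma poly_approx_continuous:
  fixes f :: "'a::euclidean_space \<Rightarrow> real"
  assumes sets: "sets M = sets borel" and fin: "finite_measure M"
    and Z: "compact Z" "AE x in M. x \<in> Z" and f: "continuous_on UNIV f"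
  shows "poly_approx M f"
  unfolding poly_approx_def
proof (intro allI impI)
  fix \<epsilon> :: real assume "\<epsilon> > 0"
  interpret finite_measure M by fact
  note sets[measurable_cong]
  define m where "m = measure M UNIV"
  have m: "emeasure M (space M) = ennreal m" "m \<ge> 0"
    using sets_eq_imp_space_eq[OF sets] by (simp_all add: m_def emeasure_eq_measure)
  \<comment> \<open>A uniform error e costs e^2 times the total mass m, which has to stay below
    \<epsilon>; 1 + m in the denominator also covers m = 0.\<close>
  define e where "e = sqrt (\<epsilon> / (2 * (1 + m)))"
  have e: "e > 0" "e\<^sup>2 * m \<le> \<epsilon>"
  proof -
    show "e > 0" using \<open>\<epsilon> > 0\<close> m(2) by (simp add: e_def add_pos_nonneg)
    have "\<epsilon> * m \<le> \<epsilon> * (2 * (1 + m))" using \<open>\<epsilon> > 0\<close> m(2) by (intro mult_left_mono) auto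
    moreover have "e\<^sup>2 = \<epsilon> / (2 * (1 + m))" using \<open>\<epsilon> > 0\<close> m(2) by (simp add: e_def)
    ultimately show "e\<^sup>2 * m \<le> \<epsilon>" using m(2) by (simp add: divide_le_eq)
  qed
  obtain q where q: "real_polynomial_function q" "\<And>x. x \<in> Z \<Longrightarrow> \<bar>f x - q x\<bar> < e"
    using Stone_Weierstrass_real_polynomial_function[OF Z(1) continuous_on_subset[OF f] e(1)] by auto
  have "(\<integral>\<^sup>+x. ennreal ((f x - q x)\<^sup>2) \<partial>M) \<le> (\<integral>\<^sup>+x. ennreal (e\<^sup>2) \<partial>M)"
  proof (rule nn_integral_mono_AE)
    show "AE x in M. ennreal ((f x - q x)\<^sup>2) \<le> ennreal (e\<^sup>2)"
      using Z(2)
    proof eventually_elim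
      case (elim x)
      have "(f x - q x)\<^sup>2 \<le> e\<^sup>2" using q(2)[OF elim] by (intro power2_le_iff_abs_le[THEN iffD2]) auto
      then show ?case by (rule ennreal_leI)
    qed
  qed
  also have "\<dots> = ennreal (e\<^sup>2 * m)" using m by (simp add: ennreal_mult)
  also have "\<dots> \<le> ennreal \<epsilon>" using e(2) by (rule ennreal_leI)
  finally show "\<exists>q. real_polynomial_function q \<and> (\<integral>\<^sup>+x. ennreal ((f x - q x)\<^sup>2) \<partial>M) \<le> ennreal \<epsilon>"
    using q(1) by auto
qed

text \<open>Inner regularity replaces the Borel set by a compact subset of almost the same measure,
  whose indicator is a pointwise limit of continuous ramps.\<close>

lemma poly_approx_indicator:
  fixes B :: "'a::euclidean_space set"
  assumes sets: "sets M = sets borel" and fin: "finite_measure M"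
    and Z: "compact Z" "AE x in M. x \<in> Z" and [measurable]: "B \<in> sets borel"
  shows "poly_approx M (indicator B)"
proof (rule poly_approx_limit[OF sets])
  interpret finite_measure M by fact
  note sets[measurable_cong]
  fix \<epsilon> :: real assume "\<epsilon> > 0"
  have "emeasure M B = (SUP K \<in> {K. K \<subseteq> B \<and> compact K}. emeasure M K)"
    by (rule inner_regular[OF sets]) (auto simp: emeasure_eq_measure)
  from SUP_approx_ennreal[OF \<open>\<epsilon> > 0\<close> _ this] obtain K where K: "K \<subseteq> B" "compact K" "emeasure M B < emeasure M K + ennreal \<epsilon>"
    by (metis (no_types, lifting) compact_empty emeasure_finite empty_iff empty_subsetI infinity_ennreal_def mem_Collect_eq)
  have [measurable]: "K \<in> sets borel" using K(2) by (simp add: compact_imp_closed)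
  have apK: "poly_approx M (indicator K)"
  \<comment> \<open>\<open>infdist\<close> to the empty set is 0 by convention, so the ramps below
    would be constantly 1; the empty set is approximated by the zero polynomial instead.\<close>
  proof (cases "K = {}")
    case True
    then show ?thesis unfolding poly_approx_def
      by (auto intro!: exI[of _ "\<lambda>_. 0"] real_polynomial_function.intros(2))
  next
    case False
    \<comment> \<open>Equal to 1 on K and to 0 beyond distance 1/n. Since K is closed, every point
      outside K has positive distance, hence pointwise convergence to the indicator, dominated by
      1.\<close>
    define f where "f n x = max 0 (1 - real n * infdist x K)" for n x
    have cf: "continuous_on UNIV (f n)" for n unfolding f_def by (intro continuous_intros)
    then have [measurable]: "f n \<in> borel_measurable borel" for n by (rule borel_measurable_continuous_onI)
    have lim: "(\<lambda>n. f n x) \<longlonglongrightarrow> indicator K x" for x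
    proof (cases "x \<in> K")
      case True then show ?thesis by (simp add: f_def)
    next
      case xK: False
      then have pos: "infdist x K > 0"
        using K(2) False by (simp add: compact_imp_closed infdist_pos_not_in_closed)
      obtain N :: nat where N: "1 / infdist x K < N" using reals_Archimedean2 by blast
      have "f n x = 0" if "n \<ge> N" for n
      proof -
        have "1 < real N * infdist x K" using N pos by (simp add: field_simps)
        also have "\<dots> \<le> real n * infdist x K" using that pos by (intro mult_right_mono) auto
        finally show ?thesis by (simp add: f_def)
      qed
      then have "\<forall>\<^sub>F n in sequentially. f n x = indicator K x"
        using xK by (auto simp: eventually_sequentially)
      then show ?thesis by (rule tendsto_eventually)
    qed
    have "(\<lambda>n. \<integral>\<^sup>+x. ennreal ((indicator K x - f n x)\<^sup>2) \<partial>M) \<longlonglongrightarrow> (\<integral>\<^sup>+x. 0 \<partial>M)"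
    proof (rule nn_integral_dominated_convergence[where w = "\<lambda>_. 1"])
      show "AE x in M. ennreal ((indicator K x - f n x)\<^sup>2) \<le> 1" for n
      proof (rule AE_I2)
        fix x
        have "\<bar>indicator K x - f n x\<bar> \<le> 1"
          using infdist_nonneg[of x K] by (auto simp: f_def indicator_def max_def)
        then show "ennreal ((indicator K x - f n x)\<^sup>2) \<le> 1"
          by (simp add: abs_square_le_1)
      qed
      show "AE x in M. (\<lambda>n. ennreal ((indicator K x - f n x)\<^sup>2)) \<longlonglongrightarrow> 0"
      proof (rule AE_I2)
        fix x
        have "(\<lambda>n. (indicator K x - f n x)\<^sup>2) \<longlonglongrightarrow> (indicator K x - indicator K x)\<^sup>2"
          by (intro tendsto_intros lim)
        then show "(\<lambda>n. ennreal ((indicator K x - f n x)\<^sup>2)) \<longlonglongrightarrow> 0"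
          using tendsto_ennrealI by fastforce
      qed
    qed (auto simp: emeasure_eq_measure)
    then have "(\<lambda>n. \<integral>\<^sup>+x. ennreal ((indicator K x - f n x)\<^sup>2) \<partial>M) \<longlonglongrightarrow> 0" by simp
    note lim0 = this
    show ?thesis
    proof (rule poly_approx_limit[OF sets])
      fix e :: real assume "e > 0"
      with order_tendstoD(2)[OF lim0, of "ennreal e"]
      have "\<forall>\<^sub>F n in sequentially. (\<integral>\<^sup>+x. ennreal ((indicator K x - f n x)\<^sup>2) \<partial>M) < ennreal e" by simp
      then obtain n where "(\<integral>\<^sup>+x. ennreal ((indicator K x - f n x)\<^sup>2) \<partial>M) \<le> ennreal e"
        by (meson eventually_happens less_imp_le trivial_limit_sequentially)
      then show "\<exists>g\<in>borel_measurable borel. poly_approx M g \<and> (\<integral>\<^sup>+x. ennreal ((indicator K x - g x)\<^sup>2) \<partial>M) \<le> ennreal e"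
        using poly_approx_continuous[OF sets fin Z cf] by (intro bexI[of _ "f n"]) auto
    qed simp
  qed
  have "(\<integral>\<^sup>+x. ennreal ((indicator B x - indicator K x)\<^sup>2) \<partial>M) = (\<integral>\<^sup>+x. indicator (B - K) x \<partial>M)"
    using K(1) by (intro nn_integral_cong) (auto simp: indicator_def)
  also have "\<dots> = emeasure M B - emeasure M K"
    using K(1) by (subst nn_integral_indicator, simp, subst emeasure_Diff) (auto simp: emeasure_eq_measure)
  also have "\<dots> \<le> ennreal \<epsilon>"
    using K(3) by (simp add: ennreal_minus_le_iff add.commute less_imp_le)
  finally show "\<exists>g\<in>borel_measurable borel. poly_approx M g \<and> (\<integral>\<^sup>+x. ennreal ((indicator B x - g x)\<^sup>2) \<partial>M) \<le> ennreal \<epsilon>"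
    using apK by (intro bexI[of _ "indicator K"]) auto
qed simp

theorem polynomials_dense_L2:
  fixes h :: "'a::euclidean_space \<Rightarrow> real"
  assumes sets: "sets M = sets borel" and fin: "finite_measure M"
    and Z: "compact Z" "AE x in M. x \<in> Z" and [measurable]: "h \<in> borel_measurable borel"
    and hfin: "(\<integral>\<^sup>+x. ennreal ((h x)\<^sup>2) \<partial>M) < \<infinity>"
  shows "poly_approx M h"
proof (rule poly_approx_limit[OF sets])
  interpret finite_measure M by fact
  note sets[measurable_cong]
  have sp: "space M = UNIV" using sets_eq_imp_space_eq[OF sets] by simp
  obtain s where s: "\<And>i. simple_function M (s i)" "\<And>x. (\<lambda>i. s i x) \<longlonglongrightarrow> h x" "\<And>i x. \<bar>s i x\<bar> \<le> 2 * \<bar>h x\<bar>"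
    using borel_measurable_implies_sequence_metric[of h M 0] sp by auto
  have [measurable]: "s i \<in> borel_measurable borel" for i
    using borel_measurable_simple_function[OF s(1)] by simp
  have aps: "poly_approx M (s i)" for i
  proof -
    have fin: "finite (s i ` UNIV)" using s(1)[of i] sp by (simp add: simple_function_def)
    have B: "s i -` {y} \<in> sets borel" for y
      using measurable_sets[of "s i" borel borel "{y}"] by simp
    have "poly_approx M (\<lambda>x. \<Sum>y\<in>Y. y * indicator (s i -` {y}) x)" if "finite Y" for Y
      using that
    proof (induction Y)
      case empty
      then show ?case unfolding poly_approx_def
        by (auto intro!: exI[of _ "\<lambda>_. 0"] real_polynomial_function.intros(2))
    next
      case (insert y Y)
      have "poly_approx M (\<lambda>x. y * indicator (s i -` {y}) x + (\<Sum>y\<in>Y. y * indicator (s i -` {y}) x))"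
        using insert.IH B by (intro poly_approx_scale_add[OF sets] poly_approx_indicator[OF sets assms(2) Z]) auto
      then show ?case by (simp only: sum.insert[OF insert.hyps])
    qed
    note ap = this[OF fin]
    have "s i x = (\<Sum>y\<in>s i ` UNIV. y * indicator (s i -` {y}) x)" for x
      using simple_function_indicator_representation_banach[OF s(1), of x i]
      by (simp only: sp Int_UNIV_right real_scaleR_def mult.commute UNIV_I)
    then show ?thesis by (intro back_subst[where P = "poly_approx M", OF ap] ext) (rule sym)
  qed
  fix \<epsilon> :: real assume "\<epsilon> > 0"
  have "(\<lambda>n. \<integral>\<^sup>+x. ennreal ((h x - s n x)\<^sup>2) \<partial>M) \<longlonglongrightarrow> (\<integral>\<^sup>+x. 0 \<partial>M)"
  \<comment> \<open>The simple approximants satisfy |s| \<le> 2 |h|, so |h - s| \<le> 3 |h|; the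
    square explains the factor 9.\<close>
  proof (rule nn_integral_dominated_convergence[where w = "\<lambda>x. 9 * ennreal ((h x)\<^sup>2)"])
    show "AE x in M. ennreal ((h x - s n x)\<^sup>2) \<le> 9 * ennreal ((h x)\<^sup>2)" for n
    proof (rule AE_I2)
      fix x
      have "\<bar>h x - s n x\<bar> \<le> \<bar>3 * h x\<bar>" using s(3)[of n x] by linarith
      then have "(h x - s n x)\<^sup>2 \<le> (3 * h x)\<^sup>2" by (rule abs_le_square_iff[THEN iffD1])
      then have "ennreal ((h x - s n x)\<^sup>2) \<le> ennreal (9 * (h x)\<^sup>2)"
        by (intro ennreal_leI) (simp add: power_mult_distrib)
      then show "ennreal ((h x - s n x)\<^sup>2) \<le> 9 * ennreal ((h x)\<^sup>2)" by (simp add: ennreal_mult')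
    qed
    show "AE x in M. (\<lambda>n. ennreal ((h x - s n x)\<^sup>2)) \<longlonglongrightarrow> 0"
    proof (rule AE_I2)
      fix x
      have "(\<lambda>n. (h x - s n x)\<^sup>2) \<longlonglongrightarrow> (h x - h x)\<^sup>2" by (intro tendsto_intros s)
      then show "(\<lambda>n. ennreal ((h x - s n x)\<^sup>2)) \<longlonglongrightarrow> 0" using tendsto_ennrealI by fastforce
    qed
    show "(\<integral>\<^sup>+x. 9 * ennreal ((h x)\<^sup>2) \<partial>M) < \<infinity>"
      using hfin by (simp add: nn_integral_cmult ennreal_mult_less_top)
  qed auto
  then have "(\<lambda>n. \<integral>\<^sup>+x. ennreal ((h x - s n x)\<^sup>2) \<partial>M) \<longlonglongrightarrow> 0" by simp
  from order_tendstoD(2)[OF this, of "ennreal \<epsilon>"] \<open>\<epsilon> > 0\<close>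
  have "\<forall>\<^sub>F n in sequentially. (\<integral>\<^sup>+x. ennreal ((h x - s n x)\<^sup>2) \<partial>M) < ennreal \<epsilon>" by simp
  then obtain n where "(\<integral>\<^sup>+x. ennreal ((h x - s n x)\<^sup>2) \<partial>M) \<le> ennreal \<epsilon>"
    by (meson eventually_happens less_imp_le trivial_limit_sequentially)
  then show "\<exists>g\<in>borel_measurable borel. poly_approx M g \<and> (\<integral>\<^sup>+x. ennreal ((h x - g x)\<^sup>2) \<partial>M) \<le> ennreal \<epsilon>"
    using aps[of n] by (intro bexI[of _ "s n"]) auto
qed simp

section \<open>Trigonometric polynomials\<close>

definition mode :: "int^'d::finite \<Rightarrow> real^'d \<Rightarrow> complex" where
  "mode k x = cis (freq k \<bullet> x)"

lemma mode_zero [simp]: "mode 0 x = 1"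
  by (simp add: mode_def freq_simps)

lemma mode_add: "mode (k + l) x = mode k x * mode l x"
  by (simp add: mode_def freq_simps inner_add_left cis_mult)

lemma mode_minus: "mode (- k) x = cnj (mode k x)"
  by (simp add: mode_def freq_simps cis_cnj)

lemma mode_diff: "mode (k - l) x = mode k x * cnj (mode l x)"
  using mode_add[of k "- l" x] by (simp add: mode_minus)

lemma norm_mode [simp]: "cmod (mode k x) = 1"
  by (simp add: mode_def)

lemma mode_shift: "mode k (x + h) = mode k x * mode k h"
  by (simp add: mode_def inner_add_right cis_mult)

lemma periodic_mode: "periodic (mode k)"
proof -
  have "mode k (axis i (2 * pi)) = 1" for i
    using cis_multiple_2pi[of "of_int (k $ i)"]
    by (simp add: mode_def inner_axis freq_def mult.commute)
  then show ?thesis by (simp add: periodic_def mode_shift)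
qed

lemma continuous_mode: "continuous_on S (mode k)"
  unfolding mode_def cis_conv_exp by (intro continuous_intros)

lemma mode_measurable [measurable]: "mode k \<in> borel_measurable borel"
  by (intro borel_measurable_continuous_onI continuous_mode)

lemma integrable_mode: "integrable torus (mode k)"
  by (rule torus.integrable_const_bound[where B = 1]) auto

lemma measure_torus [simp]: "measure torus UNIV = 1"
  by (simp add: measure_def)

text \<open>For nonzero k, translating by half a period of the mode in a coordinate where k does not
  vanish multiplies the mode by -1, so by invariance the integral equals its own negative.\<close>

lemma integral_mode: "(\<integral>x. mode k x \<partial>torus) = (if k = 0 then 1 else 0)"
proof (cases "k = 0")
  case True
  then show ?thesis by simp
next
  case False
  then obtain i where i: "k $ i \<noteq> 0" by (auto simp: vec_eq_iff)
  define h :: "real^'a" where "h = axis i (pi / of_int (k $ i))"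
  have "mode k h = -1"
    using i by (simp add: h_def mode_def inner_axis freq_def)
  then have "(\<integral>x. mode k x \<partial>torus) = - (\<integral>x. mode k x \<partial>torus)"
    using integral_torus_shift[OF periodic_mode, of k h] by (simp add: mode_shift)
  then show ?thesis using False by simp
qed

inductive trig :: "(real^'d::finite \<Rightarrow> complex) \<Rightarrow> bool" where
  trig_mode: "trig (\<lambda>x. c * mode k x)"
| trig_add: "trig f \<Longrightarrow> trig g \<Longrightarrow> trig (\<lambda>x. f x + g x)"

lemma trig_mult:
  assumes f: "trig f" and g: "trig g"
  shows "trig (\<lambda>x. f x * g x)"
  using f
proof induction
  case (trig_mode c k)
  show ?case using g
  proof induction
    case (trig_mode c' k')
    have "trig (\<lambda>x. (c * c') * mode (k + k') x)" by (rule trig.trig_mode)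
    then show ?case by (simp add: mode_add mult_ac)
  next
    case (trig_add f g)
    then show ?case by (auto simp: distrib_left intro: trig.trig_add)
  qed
next
  case (trig_add f f')
  then show ?case by (auto simp: distrib_right intro: trig.trig_add)
qed

lemma trig_const: "trig (\<lambda>x. c)"
  using trig_mode[of c 0] by simp

lemma trig_sum: "finite I \<Longrightarrow> (\<And>i. i \<in> I \<Longrightarrow> trig (f i)) \<Longrightarrow> trig (\<lambda>x. \<Sum>i\<in>I. f i x)"
  by (induction I rule: finite_induct) (auto intro: trig_const trig_add)

lemma cos_coordinate: "of_real (cos (x $ i)) = (mode (axis i 1) x + mode (- axis i 1) x) / 2"
  and sin_coordinate: "of_real (sin (x $ i)) = (mode (axis i 1) x - mode (- axis i 1) x) / (2 * \<i>)"
proof -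
  have "freq (axis i 1) \<bullet> x = x $ i"
    by (simp add: freq_def inner_vec_def axis_def if_distrib if_distribR cong: if_cong)
  then have "mode (axis i 1) x = cis (x $ i)" by (simp add: mode_def)
  then show "of_real (cos (x $ i)) = (mode (axis i 1) x + mode (- axis i 1) x) / 2"
    "of_real (sin (x $ i)) = (mode (axis i 1) x - mode (- axis i 1) x) / (2 * \<i>)"
    by (auto simp: mode_minus complex_eq_iff)
qed

lemma trig_cos: "trig (\<lambda>x. of_real (cos (x $ i)))"
  unfolding cos_coordinate
  using trig_add[OF trig_mode[of "1/2" "axis i 1"] trig_mode[of "1/2" "- axis i 1"]]
  by (simp add: add_divide_distrib)

lemma trig_sin: "trig (\<lambda>x. of_real (sin (x $ i)))"
proof -
  have "of_real (sin (x $ i)) = (-\<i>/2) * mode (axis i 1) x + (\<i>/2) * mode (- axis i 1) x" for x :: "real^'a"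
    by (simp add: sin_coordinate field_simps)
  then show ?thesis
    using trig_add[OF trig_mode[of "-\<i>/2" "axis i 1"] trig_mode[of "\<i>/2" "- axis i 1"]] by (simp only:)
qed

lemma trig_finite_sum:
  assumes "trig f"
  shows "\<exists>F a. finite F \<and> (\<forall>x. f x = (\<Sum>k\<in>F. a k * mode k x))"
proof -
  \<comment> \<open>The induction carries a coefficient function whose support is the index set:
    adding two trigonometric polynomials is then pointwise addition, and cancellation merely shrinks
    the support.\<close>
  from assms have "\<exists>a. finite {k. a k \<noteq> 0} \<and> (\<forall>x. f x = (\<Sum>k | a k \<noteq> 0. a k * mode k x))"
  proof induction
    case (trig_mode c k)
    show ?case
    proof (cases "c = 0")
      case True
      then show ?thesis by (intro exI[of _ "\<lambda>_. 0"]) auto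
    next
      case False
      then have "{l. (if l = k then c else 0) \<noteq> 0} = {k}" by auto
      then show ?thesis by (intro exI[of _ "\<lambda>l. if l = k then c else 0"]) simp
    qed
  next
    case (trig_add f g)
    then obtain a b where a: "finite {k. a k \<noteq> 0}" "\<And>x. f x = (\<Sum>k | a k \<noteq> 0. a k * mode k x)"
      and b: "finite {k. b k \<noteq> 0}" "\<And>x. g x = (\<Sum>k | b k \<noteq> 0. b k * mode k x)" by auto
    let ?U = "{k. a k \<noteq> 0} \<union> {k. b k \<noteq> 0}"
    have sub: "{k. a k + b k \<noteq> 0} \<subseteq> ?U" by auto
    have "f x + g x = (\<Sum>k | a k + b k \<noteq> 0. (a k + b k) * mode k x)" for x
    proof -
      have "f x = (\<Sum>k\<in>?U. a k * mode k x)" unfolding a(2)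
        using a(1) b(1) by (intro sum.mono_neutral_left) auto
      moreover have "g x = (\<Sum>k\<in>?U. b k * mode k x)" unfolding b(2)
        using a(1) b(1) by (intro sum.mono_neutral_left) auto
      moreover have "(\<Sum>k | a k + b k \<noteq> 0. (a k + b k) * mode k x) = (\<Sum>k\<in>?U. (a k + b k) * mode k x)"
        using a(1) b(1) sub by (intro sum.mono_neutral_left) auto
      ultimately show ?thesis by (simp add: sum.distrib distrib_right)
    qed
    then show ?case using a(1) b(1) sub
      by (intro exI[of _ "\<lambda>k. a k + b k"]) (auto intro: finite_subset)
  qed
  then show ?thesis by blast
qed

text \<open>The cylinder is embedded into Euclidean space, where polynomials are dense.\<close>

definition cyl_embed :: "real \<times> (real^'d::finite) \<Rightarrow> real \<times> (real^'d) \<times> (real^'d)" where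
  "cyl_embed z = (fst z, (\<chi> j. cos (snd z $ j)), (\<chi> j. sin (snd z $ j)))"

text \<open>The clamping makes \<open>arccos\<close> continuous on the whole line, so that the
  inverse of the embedding is Borel everywhere.\<close>

definition clamp_arccos :: "real \<Rightarrow> real" where
  "clamp_arccos c = arccos (max (-1) (min 1 c))"

text \<open>Recovers the angle in [0, 2 pi] from its cosine and the sign of its sine. It inverts
  \<open>cyl_embed\<close> on the cell only and jumps at angle 0; Borel measurability is enough for
  transporting an L2 function.\<close>

definition cyl_unembed :: "real \<times> (real^'d::finite) \<times> (real^'d) \<Rightarrow> real \<times> (real^'d)" where
  "cyl_unembed w = (fst w, (\<chi> j. if snd (snd w) $ j \<ge> 0 then clamp_arccos (fst (snd w) $ j)
                             else 2 * pi - clamp_arccos (fst (snd w) $ j)))"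

lemma measurable_vec_lambda:
  fixes f :: "'d::finite \<Rightarrow> 'a \<Rightarrow> real"
  assumes "\<And>j. f j \<in> borel_measurable M"
  shows "(\<lambda>x. \<chi> j. f j x) \<in> borel_measurable M"
proof (rule borel_measurable_euclidean_space[THEN iffD2], rule ballI)
  fix b :: "real^'d" assume "b \<in> Basis"
  then obtain i where "b = axis i 1" by (auto simp: Basis_vec_def)
  then show "(\<lambda>x. (\<chi> j. f j x) \<bullet> b) \<in> borel_measurable M"
    using assms[of i] by (simp add: inner_axis)
qed

lemma measurable_vec_nth [measurable]: "(\<lambda>x::real^'d::finite. x $ i) \<in> borel_measurable borel"
  by (intro borel_measurable_continuous_onI continuous_intros)

lemma cyl_embed_continuous: "continuous_on UNIV cyl_embed"
  unfolding cyl_embed_def by (intro continuous_intros)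

lemma cyl_embed_measurable [measurable]: "cyl_embed \<in> borel_measurable borel"
  by (intro borel_measurable_continuous_onI cyl_embed_continuous)

lemma clamp_arccos_measurable [measurable]: "clamp_arccos \<in> borel_measurable borel"
  unfolding clamp_arccos_def
  by (intro borel_measurable_continuous_onI continuous_intros) auto

lemma borel_measurable_fst [measurable]: "fst \<in> borel_measurable borel"
  and borel_measurable_snd [measurable]: "snd \<in> borel_measurable borel"
  by (intro borel_measurable_continuous_onI continuous_intros)+

lemma cyl_unembed_measurable [measurable]: "cyl_unembed \<in> borel_measurable borel"
  unfolding cyl_unembed_def
  by (subst borel_prod[symmetric]) (intro measurable_Pair measurable_vec_lambda; measurable)

lemma cyl_unembed_embed:
  assumes "x \<in> cell" shows "cyl_unembed (cyl_embed (t, x)) = (t, x)"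
proof -
  have "(if sin (x $ j) \<ge> 0 then clamp_arccos (cos (x $ j)) else 2 * pi - clamp_arccos (cos (x $ j))) = x $ j" for j
  proof -
    have x: "0 \<le> x $ j" "x $ j < 2 * pi" using assms by (auto simp: cell_def)
    have c: "clamp_arccos (cos y) = arccos (cos y)" for y
      by (simp add: clamp_arccos_def min_absorb2 max_absorb2)
    show ?thesis
    proof (cases "x $ j \<le> pi")
      case True
      then show ?thesis using x sin_ge_zero[of "x $ j"] by (simp add: c arccos_cos)
    next
      case False
      have "cos (x $ j) = cos (2 * pi - x $ j)" by simp
      then have "arccos (cos (x $ j)) = 2 * pi - x $ j"
        using False x by (simp only: arccos_cos)
      moreover have "sin (x $ j) < 0" using False x by (intro sin_lt_zero) auto
      ultimately show ?thesis by (simp add: c)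
    qed
  qed
  note coord = this
  show ?thesis
    unfolding cyl_embed_def cyl_unembed_def fst_conv snd_conv vec_lambda_beta coord by simp
qed

text \<open>Lebesgue measure on the time interval, but as a measure on the whole line: its
  sigma-algebra is the Borel one, so no restricted spaces occur in the product with
  \<open>torus\<close>.\<close>

definition slab :: "real \<Rightarrow> real measure" where
  "slab T = density lborel (indicator {0..T})"

lemma sets_slab [measurable_cong, simp]: "sets (slab T) = sets borel"
  and space_slab [simp]: "space (slab T) = UNIV"
  by (simp_all add: slab_def)

lemma nn_integral_slab:
  "f \<in> borel_measurable borel \<Longrightarrow> (\<integral>\<^sup>+t. f t \<partial>slab T) = (\<integral>\<^sup>+t\<in>{0..T}. f t \<partial>lborel)"
  unfolding slab_def by (subst nn_integral_density) (auto simp: mult.commute)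

lemma AE_slab: "AE t in slab T. t \<in> {0..T}"
  unfolding slab_def by (subst AE_density) (auto intro!: AE_I2 simp: indicator_def split: if_splits)

lemma emeasure_slab: "emeasure (slab T) UNIV = ennreal T"
proof -
  have "emeasure (slab T) UNIV = (\<integral>\<^sup>+t\<in>{0..T}. 1 \<partial>lborel)"
    using nn_integral_slab[of "\<lambda>_. 1" T] by simp
  then show ?thesis by (cases "T \<ge> 0") (auto simp: ennreal_neg)
qed

interpretation slab: finite_measure "slab T" for T
  by (rule finite_measureI) (simp add: emeasure_slab)

abbreviation cyl :: "real \<Rightarrow> (real \<times> (real^'d::finite)) measure" where
  "cyl T \<equiv> slab T \<Otimes>\<^sub>M torus"

lemma sets_cyl [measurable_cong, simp]: "sets (cyl T) = sets borel"
  by (subst sets_pair_measure_cong[OF sets_slab sets_torus]) (rule arg_cong[OF borel_prod])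

lemma space_cyl [simp]: "space (cyl T) = UNIV"
  by (simp add: space_pair_measure)

interpretation cyl: pair_sigma_finite "slab T" "torus :: (real^'d::finite) measure" for T
  by unfold_locales

lemma finite_measure_cyl: "finite_measure (cyl T)"
  by (rule finite_measure_pair_measure) unfold_locales

interpretation cyl: finite_measure "cyl T" for T
  by (rule finite_measure_cyl)

lemma AE_cyl: "AE z in (cyl T :: (real \<times> (real^'d::finite)) measure). fst z \<in> {0..T} \<and> snd z \<in> cell"
proof -
  have "{z::real \<times> (real^'d). fst z \<in> {0..T} \<and> snd z \<in> cell} = {0..T} \<times> cell" by auto
  then have m: "{z::real \<times> (real^'d). fst z \<in> {0..T} \<and> snd z \<in> cell} \<in> sets (cyl T)"
    by (simp only:) (intro pair_measureI; simp)
  have "AE t in slab T. AE x in (torus :: (real^'d) measure). t \<in> {0..T} \<and> x \<in> cell"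
    using AE_slab by eventually_elim (use AE_torus_cell in \<open>auto elim: eventually_mono\<close>)
  then show ?thesis
    using cyl.AE_pair_measure[where P = "\<lambda>z. fst z \<in> {0..T} \<and> snd z \<in> cell"] m by simp
qed

text \<open>The measure on the cylinder is pushed forward by \<open>cyl_embed\<close> to a finite
  measure carried by a compact set of Euclidean space. There the transported function is
  approximated by a polynomial, and the error is pulled back unchanged, the embedding being inverted
  almost everywhere.\<close>

theorem trig_dense_cyl:
  fixes f :: "real \<times> (real^'d::finite) \<Rightarrow> real"
  assumes [measurable]: "f \<in> borel_measurable borel"
    and fin: "(\<integral>\<^sup>+z. ennreal ((f z)\<^sup>2) \<partial>cyl T) < \<infinity>" and "\<epsilon> > 0"
  shows "\<exists>q. real_polynomial_function q \<and> (\<integral>\<^sup>+z. ennreal ((f z - q (cyl_embed z))\<^sup>2) \<partial>cyl T) \<le> ennreal \<epsilon>"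
proof -
  define \<nu> where "\<nu> = distr (cyl T) borel (cyl_embed :: real \<times> (real^'d) \<Rightarrow> _)"
  have sets: "sets \<nu> = sets borel" by (simp add: \<nu>_def)
  have emb: "cyl_embed \<in> measurable (cyl T) borel" by simp
  have fin_\<nu>: "finite_measure \<nu>" unfolding \<nu>_def by (rule cyl.finite_measure_distr[OF emb])
  define Z :: "(real \<times> (real^'d) \<times> (real^'d)) set" where
    "Z = {0..T} \<times> cbox (\<chi> i. -1) (\<chi> i. 1) \<times> cbox (\<chi> i. -1) (\<chi> i. 1)"
  have cZ: "compact Z" unfolding Z_def by (intro compact_Times compact_cbox compact_Icc)
  have "AE z in cyl T. cyl_embed z \<in> Z"
    using AE_cyl by eventually_elim (auto simp: Z_def cyl_embed_def mem_box_cart)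
  then have Z: "AE w in \<nu>. w \<in> Z"
    unfolding \<nu>_def using cZ by (subst AE_distr_iff[OF emb]) (auto intro: borel_closed compact_imp_closed)
  define h where "h = f \<circ> cyl_unembed"
  have [measurable]: "h \<in> borel_measurable borel" unfolding h_def by measurable
  have hf: "AE z in cyl T. h (cyl_embed z) = f z"
    using AE_cyl by eventually_elim (auto simp: h_def cyl_unembed_embed)
  have "(\<integral>\<^sup>+w. ennreal ((h w)\<^sup>2) \<partial>\<nu>) = (\<integral>\<^sup>+z. ennreal ((h (cyl_embed z))\<^sup>2) \<partial>cyl T)"
    unfolding \<nu>_def by (subst nn_integral_distr[OF emb]) auto
  also have "\<dots> = (\<integral>\<^sup>+z. ennreal ((f z)\<^sup>2) \<partial>cyl T)"
    by (rule nn_integral_cong_AE) (use hf in \<open>auto elim: eventually_mono\<close>)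
  finally have "poly_approx \<nu> h"
    using fin by (intro polynomials_dense_L2[OF sets fin_\<nu> cZ Z]) auto
  then obtain q where q: "real_polynomial_function q" "(\<integral>\<^sup>+w. ennreal ((h w - q w)\<^sup>2) \<partial>\<nu>) \<le> ennreal \<epsilon>"
    using \<open>\<epsilon> > 0\<close> unfolding poly_approx_def by blast
  note [measurable] = real_polynomial_function_borel[OF q(1)]
  have "(\<integral>\<^sup>+w. ennreal ((h w - q w)\<^sup>2) \<partial>\<nu>) = (\<integral>\<^sup>+z. ennreal ((h (cyl_embed z) - q (cyl_embed z))\<^sup>2) \<partial>cyl T)"
    unfolding \<nu>_def by (subst nn_integral_distr[OF emb]) auto
  also have "\<dots> = (\<integral>\<^sup>+z. ennreal ((f z - q (cyl_embed z))\<^sup>2) \<partial>cyl T)"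
    by (rule nn_integral_cong_AE) (use hf in \<open>auto elim: eventually_mono\<close>)
  finally show ?thesis using q by auto
qed

text \<open>The base case shared by two inductions over polynomials: one shows that, at frozen time,
  a polynomial in the embedded coordinates is a trigonometric polynomial, the other that it is
  smooth in time and space.\<close>

lemma linear_cyl_embed:
  fixes f :: "real \<times> (real^'d::finite) \<times> (real^'d) \<Rightarrow> real"
  assumes "bounded_linear f"
  shows "f (cyl_embed (t, x)) = t * f (1, 0, 0) + (\<Sum>j\<in>UNIV. cos (x $ j) * f (0, axis j 1, 0))
    + (\<Sum>j\<in>UNIV. sin (x $ j) * f (0, 0, axis j 1))"
proof -
  interpret bounded_linear f by fact
  have v: "v = (\<Sum>j\<in>UNIV. (v $ j) *\<^sub>R axis j 1)" for v :: "real^'d"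
    by (simp add: vec_eq_iff axis_def if_distrib cong: if_cong)
  have "f (t, c, s) = t * f (1, 0, 0) + (\<Sum>j\<in>UNIV. (c $ j) * f (0, axis j 1, 0)) + (\<Sum>j\<in>UNIV. (s $ j) * f (0, 0, axis j 1))" for c s
  proof -
    have "(t, c, s) = t *\<^sub>R (1, 0, 0) + (0, c, 0) + (0, 0, s)" by simp
    then have "f (t, c, s) = f (t *\<^sub>R (1, 0, 0)) + f (0, c, 0) + f (0, 0, s)" by (metis add)
    also have "(0, c, 0) = (\<Sum>j\<in>UNIV. (c $ j) *\<^sub>R (0::real, axis j 1, 0::real^'d))"
      using v[of c] by (simp add: sum_prod)
    also have "(0, 0, s) = (\<Sum>j\<in>UNIV. (s $ j) *\<^sub>R (0::real, 0::real^'d, axis j 1))"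
      using v[of s] by (simp add: sum_prod)
    finally show ?thesis by (simp add: sum scaleR del: scaleR_Pair)
  qed
  then show ?thesis by (simp add: cyl_embed_def)
qed

lemma trig_polynomial_embed:
  assumes "real_polynomial_function q"
  shows "trig (\<lambda>x. of_real (q (cyl_embed (t, x))))"
  using assms
proof induction
  case (linear f)
  show ?case
    by (subst linear_cyl_embed[OF linear], unfold of_real_add of_real_sum of_real_mult)
      (intro trig_add trig_const trig_sum trig_mult trig_cos trig_sin; simp)
qed (auto intro: trig_const trig_add trig_mult)

section \<open>Parseval's identity\<close>

lemma borel_measurable_cnj [measurable (raw)]:
  "f \<in> borel_measurable M \<Longrightarrow> (\<lambda>x. cnj (f x)) \<in> borel_measurable M"
  by (rule borel_measurable_continuous_on[OF continuous_on_cnj[OF continuous_on_id]])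

definition coef :: "(real^'d::finite \<Rightarrow> real) \<Rightarrow> int^'d \<Rightarrow> complex" where
  "coef f k = (\<integral>x. of_real (f x) * cnj (mode k x) \<partial>torus)"

definition trig_sum_of :: "(int^'d::finite \<Rightarrow> complex) \<Rightarrow> (int^'d) set \<Rightarrow> real^'d \<Rightarrow> complex" where
  "trig_sum_of a F x = (\<Sum>k\<in>F. a k * mode k x)"

lemma trig_sum_of_measurable [measurable]: "trig_sum_of a F \<in> borel_measurable borel"
  unfolding trig_sum_of_def by measurable

lemma integral_trig_sum_sq:
  assumes "finite F"
  shows "integrable torus (\<lambda>x. (cmod (trig_sum_of a F x))\<^sup>2)"
    and "(\<integral>x. (cmod (trig_sum_of a F x))\<^sup>2 \<partial>torus) = (\<Sum>k\<in>F. (cmod (a k))\<^sup>2)"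
proof -
  have eq: "complex_of_real ((cmod (trig_sum_of a F x))\<^sup>2) = (\<Sum>k\<in>F. \<Sum>l\<in>F. a k * cnj (a l) * mode (k - l) x)" for x
    by (simp only: complex_norm_square) (simp add: trig_sum_of_def sum_product mode_diff mult_ac)
  have int: "integrable torus (\<lambda>x. complex_of_real ((cmod (trig_sum_of a F x))\<^sup>2))"
    unfolding eq by (intro Bochner_Integration.integrable_sum integrable_mult_right integrable_mode)
  then show "integrable torus (\<lambda>x. (cmod (trig_sum_of a F x))\<^sup>2)"
    unfolding complex_of_real_integrable_eq .
  have "complex_of_real (\<integral>x. (cmod (trig_sum_of a F x))\<^sup>2 \<partial>torus) = (\<integral>x. complex_of_real ((cmod (trig_sum_of a F x))\<^sup>2) \<partial>torus)"
    by (rule integral_complex_of_real[symmetric])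
  also have "\<dots> = (\<Sum>k\<in>F. \<Sum>l\<in>F. a k * cnj (a l) * (\<integral>x. mode (k - l) x \<partial>torus))"
    unfolding eq by (simp add: Bochner_Integration.integral_sum integrable_mode)
  also have "\<dots> = (\<Sum>k\<in>F. \<Sum>l\<in>F. if k = l then a k * cnj (a l) else 0)"
    by (intro sum.cong refl) (simp add: integral_mode)
  also have "\<dots> = (\<Sum>k\<in>F. complex_of_real ((cmod (a k))\<^sup>2))"
    using assms by (simp only: complex_norm_square) simp
  finally show "(\<integral>x. (cmod (trig_sum_of a F x))\<^sup>2 \<partial>torus) = (\<Sum>k\<in>F. (cmod (a k))\<^sup>2)"
    by (simp only: of_real_sum[symmetric] of_real_eq_iff)
qed

lemma integrable_torus_of_sq:
  fixes f :: "real^'d::finite \<Rightarrow> real"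
  assumes [measurable]: "f \<in> borel_measurable borel" and "integrable torus (\<lambda>x. (f x)\<^sup>2)"
  shows "integrable torus f"
  by (rule torus.square_integrable_imp_integrable) (use assms in auto)

text \<open>Completing the square with the orthonormality of the modes. Only the last sum depends on
  \<open>a\<close>, so the Fourier coefficients are the best choice for a given frequency set, and
  the minimal error is the defect in Bessel's inequality.\<close>

lemma integral_sq_diff_trig_sum:
  fixes f :: "real^'d::finite \<Rightarrow> real"
  assumes [measurable]: "f \<in> borel_measurable borel" and sq: "integrable torus (\<lambda>x. (f x)\<^sup>2)"
    and F: "finite F"
  shows "integrable torus (\<lambda>x. (cmod (of_real (f x) - trig_sum_of a F x))\<^sup>2)"
    and "(\<integral>x. (cmod (of_real (f x) - trig_sum_of a F x))\<^sup>2 \<partial>torus)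
      = (\<integral>x. (f x)\<^sup>2 \<partial>torus) - (\<Sum>k\<in>F. (cmod (coef f k))\<^sup>2) + (\<Sum>k\<in>F. (cmod (a k - coef f k))\<^sup>2)"
proof -
  note int = integrable_torus_of_sq[OF assms(1,2)]
  have ex: "(cmod (of_real (f x) - trig_sum_of a F x))\<^sup>2
      = (f x)\<^sup>2 - 2 * (\<Sum>k\<in>F. Re (cnj (a k) * (of_real (f x) * cnj (mode k x)))) + (cmod (trig_sum_of a F x))\<^sup>2" for x
  proof -
    have "(cmod (of_real (f x) - z))\<^sup>2 = (f x)\<^sup>2 - 2 * Re (cnj z * of_real (f x)) + (cmod z)\<^sup>2" for z
      unfolding cmod_power2 by (simp add: power2_eq_square algebra_simps)
    moreover have "Re (cnj (trig_sum_of a F x) * of_real (f x))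
        = (\<Sum>k\<in>F. Re (cnj (a k) * (of_real (f x) * cnj (mode k x))))"
      unfolding Re_sum[symmetric] trig_sum_of_def cnj_sum sum_distrib_right
      by (intro arg_cong[where f = Re] sum.cong) (auto simp: mult_ac)
    ultimately show ?thesis by simp
  qed
  have i1: "integrable torus (\<lambda>x. of_real (f x) * cnj (mode k x))" for k
    by (rule Bochner_Integration.integrable_bound[OF int]) (auto simp: norm_mult)
  have i2: "integrable torus (\<lambda>x. Re (cnj (a k) * (of_real (f x) * cnj (mode k x))))" for k
    by (intro integrable_Re integrable_mult_right i1)
  note i3 = integral_trig_sum_sq[OF F, of a]
  show "integrable torus (\<lambda>x. (cmod (of_real (f x) - trig_sum_of a F x))\<^sup>2)"
    unfolding ex using sq i2 i3(1)
    by (intro Bochner_Integration.integrable_add Bochner_Integration.integrable_diff integrable_mult_right Bochner_Integration.integrable_sum) auto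
  have re: "(\<integral>x. Re (cnj (a k) * (of_real (f x) * cnj (mode k x))) \<partial>torus) = Re (cnj (a k) * coef f k)" for k
    using i1[of k] by (simp only: integral_Re integrable_mult_right coef_def integral_mult_right_zero)
  have "(\<integral>x. (cmod (of_real (f x) - trig_sum_of a F x))\<^sup>2 \<partial>torus)
     = (\<integral>x. (f x)\<^sup>2 \<partial>torus) - 2 * (\<Sum>k\<in>F. Re (cnj (a k) * coef f k)) + (\<Sum>k\<in>F. (cmod (a k))\<^sup>2)"
  proof -
    have S: "integrable torus (\<lambda>x. \<Sum>k\<in>F. Re (cnj (a k) * (of_real (f x) * cnj (mode k x))))"
      by (intro Bochner_Integration.integrable_sum i2)
    have "(\<integral>x. (\<Sum>k\<in>F. Re (cnj (a k) * (of_real (f x) * cnj (mode k x)))) \<partial>torus) = (\<Sum>k\<in>F. Re (cnj (a k) * coef f k))"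
      by (subst Bochner_Integration.integral_sum[OF i2]) (simp only: re)
    then show ?thesis
      unfolding ex using sq S i3
      by (simp only: Bochner_Integration.integral_add Bochner_Integration.integral_diff
          Bochner_Integration.integrable_diff integrable_mult_right integral_mult_right_zero)
  qed
  also have "\<dots> = (\<integral>x. (f x)\<^sup>2 \<partial>torus) - (\<Sum>k\<in>F. (cmod (coef f k))\<^sup>2) + (\<Sum>k\<in>F. (cmod (a k - coef f k))\<^sup>2)"
  proof -
    have "(cmod (z - w))\<^sup>2 = (cmod z)\<^sup>2 - 2 * Re (cnj z * w) + (cmod w)\<^sup>2" for z w
      unfolding cmod_power2 by (simp add: power2_eq_square algebra_simps)
    then show ?thesis by (simp add: sum.distrib sum_subtractf sum_distrib_left)
  qed
  finally show "(\<integral>x. (cmod (of_real (f x) - trig_sum_of a F x))\<^sup>2 \<partial>torus)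
      = (\<integral>x. (f x)\<^sup>2 \<partial>torus) - (\<Sum>k\<in>F. (cmod (coef f k))\<^sup>2) + (\<Sum>k\<in>F. (cmod (a k - coef f k))\<^sup>2)" .
qed

text \<open>Density on the torus is deduced from the cylinder over the unit time interval:
  \<open>f\<close> is regarded as constant in time, and a good time slice of the approximating
  polynomial is selected.\<close>

lemma trig_dense_torus:
  fixes f :: "real^'d::finite \<Rightarrow> real"
  assumes [measurable]: "f \<in> borel_measurable borel" and sq: "integrable torus (\<lambda>x. (f x)\<^sup>2)"
    and "\<epsilon> > 0"
  shows "\<exists>F. finite F \<and> (\<forall>F'. finite F' \<and> F \<subseteq> F' \<longrightarrow>
    (\<integral>x. (cmod (of_real (f x) - trig_sum_of (coef f) F' x))\<^sup>2 \<partial>torus) \<le> \<epsilon>)"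
proof -
  have [measurable]: "(\<lambda>z::real \<times> (real^'d). f (snd z)) \<in> borel_measurable borel"
    by (rule measurable_compose[OF borel_measurable_snd assms(1)])
  have f_fin: "(\<integral>\<^sup>+x. ennreal ((f x)\<^sup>2) \<partial>torus) < \<infinity>"
    using sq by (simp add: integrable_iff_bounded)
  have "(\<integral>\<^sup>+z. ennreal ((f (snd z))\<^sup>2) \<partial>cyl 1) = (\<integral>\<^sup>+t. (\<integral>\<^sup>+x. ennreal ((f x)\<^sup>2) \<partial>torus) \<partial>slab 1)"
    by (subst torus.nn_integral_fst[symmetric]) auto
  also have "\<dots> < \<infinity>" using f_fin by (simp add: emeasure_slab)
  finally obtain q where q: "real_polynomial_function q"
    and le: "(\<integral>\<^sup>+z. ennreal ((f (snd z) - q (cyl_embed z))\<^sup>2) \<partial>cyl 1) \<le> ennreal (\<epsilon> / 2)"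
    using trig_dense_cyl[of "\<lambda>z. f (snd z)" 1 "\<epsilon> / 2"] \<open>\<epsilon> > 0\<close> by auto
  note [measurable] = real_polynomial_function_borel[OF q]
  define I where "I t = (\<integral>\<^sup>+x. ennreal ((f x - q (cyl_embed (t, x)))\<^sup>2) \<partial>torus)" for t
  \<comment> \<open>The unit slab has mass 1. If every slice had error above \<epsilon>, the total
    would be at least \<epsilon>, whereas it is at most \<epsilon> / 2.\<close>
  have "\<exists>t. I t \<le> ennreal \<epsilon>"
  proof (rule ccontr)
    assume "\<not> ?thesis"
    then have "(\<integral>\<^sup>+t. ennreal \<epsilon> \<partial>slab 1) \<le> (\<integral>\<^sup>+t. I t \<partial>slab 1)"
      by (intro nn_integral_mono) (simp add: not_le less_imp_le)
    also have "\<dots> = (\<integral>\<^sup>+z. ennreal ((f (snd z) - q (cyl_embed z))\<^sup>2) \<partial>cyl 1)"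
      unfolding I_def by (subst torus.nn_integral_fst[symmetric]) auto
    finally have "ennreal \<epsilon> \<le> ennreal (\<epsilon> / 2)"
      using le by (simp add: emeasure_slab)
    then show False using \<open>\<epsilon> > 0\<close> by (simp add: ennreal_le_iff)
  qed
  then obtain t where t: "I t \<le> ennreal \<epsilon>" by auto
  obtain F a where F: "finite F" and a: "\<And>x. of_real (q (cyl_embed (t, x))) = (\<Sum>k\<in>F. a k * mode k x)"
    using trig_finite_sum[OF trig_polynomial_embed[OF q, of t]] by blast
  show ?thesis
  proof (intro exI[of _ F] conjI F allI impI)
    fix F' assume F': "finite F' \<and> F \<subseteq> F'"
    define b where "b k = (if k \<in> F then a k else 0)" for k
    have b: "of_real (q (cyl_embed (t, x))) = trig_sum_of b F' x" for x
      unfolding a trig_sum_of_def b_def using F' by (intro sum.mono_neutral_cong_left) auto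
    \<comment> \<open>The coefficients of the polynomial, extended by zero to the larger set, are
      beaten by the Fourier coefficients. This is what makes the estimate hold for every larger
      frequency set.\<close>
    have "(\<integral>x. (cmod (of_real (f x) - trig_sum_of (coef f) F' x))\<^sup>2 \<partial>torus)
        \<le> (\<integral>x. (cmod (of_real (f x) - trig_sum_of b F' x))\<^sup>2 \<partial>torus)"
      using F' by (subst (1 2) integral_sq_diff_trig_sum(2)[OF assms(1,2)]) (auto intro: sum_nonneg)
    also have "\<dots> = (\<integral>x. (f x - q (cyl_embed (t, x)))\<^sup>2 \<partial>torus)"
      by (simp flip: b of_real_diff)
    also have "\<dots> \<le> \<epsilon>"
      using t \<open>\<epsilon> > 0\<close> unfolding I_def
      by (subst integral_eq_nn_integral) (auto intro: enn2real_leI)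
    finally show "(\<integral>x. (cmod (of_real (f x) - trig_sum_of (coef f) F' x))\<^sup>2 \<partial>torus) \<le> \<epsilon>" .
  qed
qed

section \<open>Sums over cubes of frequencies and Parseval's identity\<close>

definition freq_box :: "nat \<Rightarrow> (int^'d::finite) set" where
  "freq_box N = {k. \<forall>i. k $ i \<in> {- int N..int N}}"

lemma finite_freq_box [simp]: "finite (freq_box N)"
  unfolding freq_box_def by (intro card_ge_0_finite) (simp only: card_int_box, simp)

lemma freq_box_mono: "M \<le> N \<Longrightarrow> freq_box M \<subseteq> (freq_box N :: (int^'d::finite) set)"
proof (intro subsetI)
  fix k :: "int^'d" assume "M \<le> N" "k \<in> freq_box M"
  then have "- int N \<le> k $ i \<and> k $ i \<le> int N" for i
    by (auto simp: freq_box_def dest: spec[of _ i])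
  then show "k \<in> freq_box N" by (simp add: freq_box_def)
qed

lemma mem_freq_box: "\<exists>N. k \<in> freq_box N"
proof -
  have "\<bar>k $ i\<bar> \<le> (\<Sum>j\<in>UNIV. \<bar>k $ j\<bar>)" for i by (rule member_le_sum) auto
  then have "k \<in> freq_box (nat (\<Sum>j\<in>UNIV. \<bar>k $ j\<bar>))"
    by (auto simp: freq_box_def abs_le_iff le_nat_iff minus_le_iff sum_nonneg)
  then show ?thesis ..
qed

lemma finite_subset_freq_box: "finite F \<Longrightarrow> \<exists>N. F \<subseteq> freq_box N"
proof (induction F rule: finite_induct)
  case (insert k F)
  then obtain M N where "k \<in> freq_box M" "F \<subseteq> freq_box N" using mem_freq_box by blast
  then have "insert k F \<subseteq> freq_box (max M N)"
    using freq_box_mono[of M "max M N"] freq_box_mono[of N "max M N"] by auto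
  then show ?case ..
qed simp

text \<open>Monotone convergence along the exhausting cubes; it links the unordered lattice sums of
  the estimates with the finite partial sums of Fourier series.\<close>

lemma nn_integral_lattice_SUP:
  "(\<integral>\<^sup>+k. f k \<partial>count_space UNIV) = (SUP N. \<Sum>k\<in>freq_box N. f (k :: int^'d::finite))"
proof -
  have "(\<integral>\<^sup>+k. f k \<partial>count_space UNIV) = (\<integral>\<^sup>+k. (SUP N. f k * indicator (freq_box N) k) \<partial>count_space UNIV)"
  proof (rule nn_integral_cong)
    fix k :: "int^'d"
    obtain N where "k \<in> freq_box N" using mem_freq_box by blast
    then show "f k = (SUP N. f k * indicator (freq_box N) k)"
      by (intro antisym SUP_upper2[of N] SUP_least) (auto simp: indicator_def)
  qed
  also have "\<dots> = (SUP N. \<integral>\<^sup>+k. f k * indicator (freq_box N) k \<partial>count_space UNIV)"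
    using freq_box_mono
    by (intro nn_integral_monotone_convergence_SUP)
      (auto simp: incseq_def le_fun_def indicator_def)
  also have "\<dots> = (SUP N. \<Sum>k\<in>freq_box N. f k)"
  proof (rule SUP_cong[OF refl])
    fix N
    show "(\<integral>\<^sup>+k. f k * indicator (freq_box N) k \<partial>count_space UNIV) = (\<Sum>k\<in>freq_box N. f k)"
      by (subst nn_integral_count_space'[of "freq_box N"]) (auto intro!: sum.cong)
  qed
  finally show ?thesis .
qed

lemma fourier_sums_converge:
  fixes f :: "real^'d::finite \<Rightarrow> real"
  assumes "f \<in> borel_measurable borel" "integrable torus (\<lambda>x. (f x)\<^sup>2)"
  shows "(\<lambda>N. \<integral>x. (cmod (of_real (f x) - trig_sum_of (coef f) (freq_box N) x))\<^sup>2 \<partial>torus) \<longlonglongrightarrow> 0"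
proof (rule tendstoI)
  fix e :: real assume "e > 0"
  then obtain F where F: "finite F" "\<And>F'. finite F' \<Longrightarrow> F \<subseteq> F' \<Longrightarrow>
      (\<integral>x. (cmod (of_real (f x) - trig_sum_of (coef f) F' x))\<^sup>2 \<partial>torus) \<le> e / 2"
    using trig_dense_torus[OF assms, of "e / 2"] by auto
  obtain N0 where "F \<subseteq> freq_box N0" using finite_subset_freq_box[OF F(1)] by blast
  then have "(\<integral>x. (cmod (of_real (f x) - trig_sum_of (coef f) (freq_box N) x))\<^sup>2 \<partial>torus) < e" if "N \<ge> N0" for N
    using F(2)[of "freq_box N"] freq_box_mono[OF that] \<open>e > 0\<close> by force
  then show "\<forall>\<^sub>F N in sequentially. dist (\<integral>x. (cmod (of_real (f x) - trig_sum_of (coef f) (freq_box N) x))\<^sup>2 \<partial>torus) 0 < e"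
    unfolding eventually_sequentially by (intro exI[of _ N0]) auto
qed

text \<open>For the Fourier partial sums the squared error is exactly the integral of f^2 minus the
  partial sum of squared coefficients, and this error tends to 0.\<close>

theorem parseval:
  fixes f :: "real^'d::finite \<Rightarrow> real"
  assumes "f \<in> borel_measurable borel" "integrable torus (\<lambda>x. (f x)\<^sup>2)"
  shows "(\<integral>\<^sup>+k. ennreal ((cmod (coef f k))\<^sup>2) \<partial>count_space UNIV) = (\<integral>\<^sup>+x. ennreal ((f x)\<^sup>2) \<partial>torus)"
proof -
  let ?S = "\<lambda>N. \<Sum>k\<in>freq_box N. (cmod (coef f k))\<^sup>2"
  have "?S \<longlonglongrightarrow> (\<integral>x. (f x)\<^sup>2 \<partial>torus) - 0"
  proof (rule Lim_transform_eventually)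
    show "(\<lambda>N. (\<integral>x. (f x)\<^sup>2 \<partial>torus) - (\<integral>x. (cmod (of_real (f x) - trig_sum_of (coef f) (freq_box N) x))\<^sup>2 \<partial>torus)) \<longlonglongrightarrow> (\<integral>x. (f x)\<^sup>2 \<partial>torus) - 0"
      by (intro tendsto_diff tendsto_const fourier_sums_converge assms)
  qed (simp add: integral_sq_diff_trig_sum(2)[OF assms])
  then have "(\<lambda>N. ennreal (?S N)) \<longlonglongrightarrow> ennreal (\<integral>x. (f x)\<^sup>2 \<partial>torus)" by (simp add: tendsto_ennrealI)
  moreover have "incseq (\<lambda>N. ennreal (?S N))"
    by (intro incseq_SucI ennreal_leI sum_mono2 freq_box_mono) auto
  ultimately have "(SUP N. ennreal (?S N)) = ennreal (\<integral>x. (f x)\<^sup>2 \<partial>torus)"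
    using LIMSEQ_SUP LIMSEQ_unique by blast
  also have "\<dots> = (\<integral>\<^sup>+x. ennreal ((f x)\<^sup>2) \<partial>torus)"
    by (rule nn_integral_eq_integral[symmetric]) (use assms in auto)
  finally show ?thesis by (simp add: nn_integral_lattice_SUP)
qed

section \<open>Decay of Fourier coefficients on phase space\<close>

type_synonym 'd phase = "(real^'d) \<times> (real^'d)"

abbreviation phase_measure :: "('d::finite phase) measure" where
  "phase_measure \<equiv> torus \<Otimes>\<^sub>M lborel"

lemma integral_slab:
  fixes f :: "real \<Rightarrow> 'b::{banach, second_countable_topology}"
  assumes [measurable]: "f \<in> borel_measurable borel"
  shows "(\<integral>t. f t \<partial>slab T) = (\<integral>t. indicator {0..T} t *\<^sub>R f t \<partial>lborel)"
proof -
  have "slab T = density lborel (\<lambda>t. ennreal (indicator {0..T} t))"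
    by (simp add: slab_def ennreal_indicator)
  then show ?thesis by (simp add: integral_density)
qed

lemma sets_pair_borel:
  assumes "sets M = sets (borel :: 'a::second_countable_topology measure)"
    and "sets N = sets (borel :: 'b::second_countable_topology measure)"
  shows "sets (M \<Otimes>\<^sub>M N) = sets borel"
  by (subst sets_pair_measure_cong[OF assms]) (rule arg_cong[OF borel_prod])

lemma sigma_finite_phase: "sigma_finite_measure (phase_measure :: ('d::finite phase) measure)"
  by (rule sigma_finite_pair_measure) unfold_locales

text \<open>Average the fundamental theorem of calculus over the space and use translation invariance.\<close>

lemma integral_directional_derivative:
  fixes f f' :: "'a::euclidean_space \<Rightarrow> 'b::euclidean_space"
  assumes M: "sigma_finite_measure M" and sets: "sets M = sets borel"
    and int: "integrable M f" "integrable M (\<lambda>z. f (z + b))" "\<And>h. integrable M (\<lambda>z. f' (z + h *\<^sub>R b))"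
    and inv: "(\<integral>z. f (z + b) \<partial>M) = (\<integral>z. f z \<partial>M)" "\<And>h. (\<integral>z. f' (z + h *\<^sub>R b) \<partial>M) = (\<integral>z. f' z \<partial>M)"
      "\<And>h. (\<integral>z. norm (f' (z + h *\<^sub>R b)) \<partial>M) = (\<integral>z. norm (f' z) \<partial>M)"
    and cont: "continuous_on UNIV f'"
    and deriv: "\<And>z h. ((\<lambda>h. f (z + h *\<^sub>R b)) has_vector_derivative f' (z + h *\<^sub>R b)) (at h)"
  shows "(\<integral>z. f' z \<partial>M) = 0"
proof -
  interpret M: sigma_finite_measure M by fact
  interpret pair_sigma_finite "slab 1" M by unfold_locales
  have meas: "(\<lambda>(h, z). f' (z + h *\<^sub>R b)) \<in> borel_measurable (slab 1 \<Otimes>\<^sub>M M)"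
  proof -
    have "continuous_on UNIV (\<lambda>p::real \<times> 'a. f' (snd p + fst p *\<^sub>R b))"
      by (rule continuous_on_compose2[OF cont]) (auto intro!: continuous_intros)
    then have "(\<lambda>p::real \<times> 'a. f' (snd p + fst p *\<^sub>R b)) \<in> borel_measurable borel"
      by (rule borel_measurable_continuous_onI)
    then show ?thesis
      unfolding measurable_cong_sets[OF sets_pair_borel[OF sets_slab sets] refl] by (simp add: case_prod_beta')
  qed
  have int2: "integrable (slab 1 \<Otimes>\<^sub>M M) (\<lambda>(h, z). f' (z + h *\<^sub>R b))"
    by (rule Fubini_integrable[OF meas]) (simp_all add: inv int)
  have "(\<integral>h. (\<integral>z. f' (z + h *\<^sub>R b) \<partial>M) \<partial>slab 1) = (\<integral>z. (\<integral>h. f' (z + h *\<^sub>R b) \<partial>slab 1) \<partial>M)"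
    using Fubini_integral[OF int2] by simp
  moreover have "(\<integral>h. (\<integral>z. f' (z + h *\<^sub>R b) \<partial>M) \<partial>slab 1) = (\<integral>z. f' z \<partial>M)"
    by (simp add: inv measure_def emeasure_slab)
  moreover have "(\<integral>z. (\<integral>h. f' (z + h *\<^sub>R b) \<partial>slab 1) \<partial>M) = (\<integral>z. f (z + b) - f z \<partial>M)"
  proof (rule Bochner_Integration.integral_cong[OF refl])
    fix z
    have c: "continuous_on UNIV (\<lambda>h. f' (z + h *\<^sub>R b))"
      by (rule continuous_on_compose2[OF cont]) (auto intro!: continuous_intros)
    then have "(\<lambda>h. f' (z + h *\<^sub>R b)) \<in> borel_measurable borel" by (rule borel_measurable_continuous_onI)
    then have "(\<integral>h. f' (z + h *\<^sub>R b) \<partial>slab 1) = (\<integral>h. indicator {0..1} h *\<^sub>R f' (z + h *\<^sub>R b) \<partial>lborel)"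
      by (rule integral_slab)
    also have "\<dots> = f (z + 1 *\<^sub>R b) - f (z + 0 *\<^sub>R b)"
      by (rule integral_FTC_atLeastAtMost)
        (auto intro: has_vector_derivative_at_within[OF deriv] continuous_on_subset[OF c])
    finally show "(\<integral>h. f' (z + h *\<^sub>R b) \<partial>slab 1) = f (z + b) - f z" by simp
  qed
  moreover have "(\<integral>z. f (z + b) - f z \<partial>M) = 0"
    by (simp add: Bochner_Integration.integral_diff int inv)
  ultimately show ?thesis by simp
qed

lemma integral_directional_derivative_phase:
  fixes f f' :: "'d::finite phase \<Rightarrow> 'b::euclidean_space"
  assumes per: "xperiodic f" "xperiodic f'"
    and int: "integrable phase_measure f" "integrable phase_measure f'"
    and cont: "continuous_on UNIV f'"
    and deriv: "\<And>z h. ((\<lambda>h. f (z + h *\<^sub>R b)) has_vector_derivative f' (z + h *\<^sub>R b)) (at h)"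
  shows "(\<integral>z. f' z \<partial>phase_measure) = 0"
proof (rule integral_directional_derivative[OF sigma_finite_phase sets_torus_lborel])
  have pern: "xperiodic (\<lambda>z. norm (f' z))" using per(2) by (simp add: xperiodic_def periodic_def)
  show "(\<integral>z. norm (f' (z + h *\<^sub>R b)) \<partial>phase_measure) = (\<integral>z. norm (f' z) \<partial>phase_measure)" for h
    by (rule integrable_phase_shift(2)[OF pern integrable_norm[OF int(2)]])
qed (fact | rule integrable_phase_shift per int)+

lemma integral_directional_derivative_torus:
  fixes f f' :: "real^'d::finite \<Rightarrow> 'b::euclidean_space"
  assumes per: "periodic f" "periodic f'"
    and bound: "\<And>x. norm (f x) \<le> B" "\<And>x. norm (f' x) \<le> B"
    and cont: "continuous_on UNIV f" "continuous_on UNIV f'"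
    and deriv: "\<And>z h. ((\<lambda>h. f (z + h *\<^sub>R b)) has_vector_derivative f' (z + h *\<^sub>R b)) (at h)"
  shows "(\<integral>x. f' x \<partial>torus) = 0"
proof (rule integral_directional_derivative[OF sigma_finite_torus sets_torus])
  have [measurable]: "f \<in> borel_measurable borel" "f' \<in> borel_measurable borel"
    using cont by (auto intro: borel_measurable_continuous_onI)
  show "integrable torus f" "integrable torus (\<lambda>z. f (z + b))" "integrable torus (\<lambda>z. f' (z + h *\<^sub>R b))" for h
    by (rule torus.integrable_const_bound[where B = B]; use bound in simp)+
  have "periodic (\<lambda>z. norm (f' z))" using per(2) by (simp add: periodic_def)
  then show "(\<integral>z. norm (f' (z + h *\<^sub>R b)) \<partial>torus) = (\<integral>z. norm (f' z) \<partial>torus)" for h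
    by (rule integral_torus_shift) simp
  show "(\<integral>z. f (z + b) \<partial>torus) = (\<integral>z. f z \<partial>torus)" "(\<integral>z. f' (z + h *\<^sub>R b) \<partial>torus) = (\<integral>z. f' z \<partial>torus)" for h
    using per by (auto intro: integral_torus_shift)
qed fact+

text \<open>The conjugate character of phase space. Its spatial frequency will always be a lattice
  point, which makes it periodic in x, while the velocity frequency is an arbitrary real
  vector.\<close>

definition wave :: "'d::finite phase \<Rightarrow> 'd phase \<Rightarrow> complex" where
  "wave \<omega> z = cis (- (\<omega> \<bullet> z))"

lemma norm_wave [simp]: "cmod (wave \<omega> z) = 1"
  by (simp add: wave_def)

lemma wave_continuous: "continuous_on S (wave \<omega>)"
  unfolding wave_def cis_conv_exp by (intro continuous_intros)

lemma wave_measurable [measurable]: "wave \<omega> \<in> borel_measurable borel"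
  by (intro borel_measurable_continuous_onI wave_continuous)

lemma wave_freq: "wave (freq l, \<xi>) (x, v) = cnj (mode l x) * cis (- (\<xi> \<bullet> v))"
  by (simp add: wave_def mode_def cis_cnj cis_mult)

lemma periodic_cnj_mode: "periodic (\<lambda>x. cnj (mode l x))"
  using periodic_mode[of l] by (simp add: periodic_def)

lemma xperiodic_wave: "xperiodic (wave (freq l, \<xi>))"
  using periodic_cnj_mode[of l] by (simp add: xperiodic_def wave_freq periodic_def)

lemma integrable_wave_mult:
  fixes F :: "'d::finite phase \<Rightarrow> real"
  assumes "integrable phase_measure F"
  shows "integrable phase_measure (\<lambda>z. wave \<omega> z * of_real (F z))"
proof (rule Bochner_Integration.integrable_bound[OF assms])
  have [measurable]: "F \<in> borel_measurable borel" using borel_measurable_integrable[OF assms] by simp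
  show "(\<lambda>z. wave \<omega> z * of_real (F z)) \<in> borel_measurable phase_measure" by measurable
qed (simp add: norm_mult)

text \<open>Integration by parts: the directional derivative of \<open>wave\<close> times
  \<open>F\<close> has integral 0, and the product rule splits it into the two sides. No boundary
  term appears, thanks to periodicity in x and integrability in v.\<close>

lemma wave_coef_derivative:
  fixes F F' :: "'d::finite phase \<Rightarrow> real"
  assumes \<omega>: "\<omega> = (freq l, \<xi>)" and per: "xperiodic F" "xperiodic F'"
    and int: "integrable phase_measure F" "integrable phase_measure F'"
    and cont: "continuous_on UNIV F" "continuous_on UNIV F'"
    and deriv: "\<And>z h. ((\<lambda>h. F (z + h *\<^sub>R b)) has_vector_derivative F' (z + h *\<^sub>R b)) (at h)"
  shows "(\<integral>z. wave \<omega> z * of_real (F' z) \<partial>phase_measure) = \<i> * of_real (\<omega> \<bullet> b) * (\<integral>z. wave \<omega> z * of_real (F z) \<partial>phase_measure)"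
proof -
  define f where "f z = wave \<omega> z * of_real (F z)" for z
  define f' where "f' z = wave \<omega> z * of_real (F' z) - \<i> * of_real (\<omega> \<bullet> b) * (wave \<omega> z * of_real (F z))" for z
  have "(\<integral>z. f' z \<partial>phase_measure) = 0"
  proof (rule integral_directional_derivative_phase[where f = f and b = b])
    show "xperiodic f" "xperiodic f'"
      using per xperiodic_wave[of l \<xi>] unfolding f_def f'_def \<omega> by (auto simp: xperiodic_def periodic_def)
    show "integrable phase_measure f" "integrable phase_measure f'"
      unfolding f_def f'_def
      by (intro Bochner_Integration.integrable_diff integrable_mult_right integrable_wave_mult int)+
    show "continuous_on UNIV f'"
      unfolding f'_def by (intro continuous_intros wave_continuous cont)
    fix z h
    have w: "((\<lambda>h. wave \<omega> (z + h *\<^sub>R b)) has_vector_derivative (- \<i> * of_real (\<omega> \<bullet> b) * wave \<omega> (z + h *\<^sub>R b))) (at h)"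
    proof -
      have lin: "((\<lambda>h. - (\<i> * of_real (\<omega> \<bullet> z)) - of_real h * (\<i> * of_real (\<omega> \<bullet> b))) has_vector_derivative (- \<i> * of_real (\<omega> \<bullet> b))) (at h)"
        unfolding scaleR_conv_of_real[symmetric] by (auto intro!: derivative_eq_intros)
      have "((\<lambda>h. exp (- (\<i> * of_real (\<omega> \<bullet> z)) - of_real h * (\<i> * of_real (\<omega> \<bullet> b)))) has_vector_derivative
          (- \<i> * of_real (\<omega> \<bullet> b)) * exp (- (\<i> * of_real (\<omega> \<bullet> z)) - of_real h * (\<i> * of_real (\<omega> \<bullet> b)))) (at h)"
        using field_vector_diff_chain_at[OF lin DERIV_exp] by (simp only: o_def)
      moreover have "wave \<omega> (z + h *\<^sub>R b) = exp (- (\<i> * of_real (\<omega> \<bullet> z)) - of_real h * (\<i> * of_real (\<omega> \<bullet> b)))" for h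
        by (simp add: wave_def cis_conv_exp inner_add_right algebra_simps)
      ultimately show ?thesis by simp
    qed
    have d: "((\<lambda>h. of_real (F (z + h *\<^sub>R b))) has_vector_derivative complex_of_real (F' (z + h *\<^sub>R b))) (at h)"
      using has_vector_derivative_of_real[OF deriv[of z h, unfolded has_real_derivative_iff_has_vector_derivative[symmetric]]] .
    show "((\<lambda>h. f (z + h *\<^sub>R b)) has_vector_derivative f' (z + h *\<^sub>R b)) (at h)"
      using has_vector_derivative_mult[OF w d] unfolding f_def f'_def by (simp add: algebra_simps)
  qed
  then show ?thesis unfolding f'_def
    by (subst (asm) Bochner_Integration.integral_diff)
      (auto intro!: integrable_mult_right integrable_wave_mult int)
qed

text \<open>\<open>F\<close> is a chain of successive derivatives along one fixed direction
  \<open>b\<close>; each link contributes one factor \<omega> \<bullet> b, and the last one is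
  estimated in L1.\<close>

lemma wave_coef_decay:
  fixes F :: "nat \<Rightarrow> 'd::finite phase \<Rightarrow> real"
  assumes \<omega>: "\<omega> = (freq l, \<xi>)"
    and per: "\<And>j. j \<le> p \<Longrightarrow> xperiodic (F j)"
    and int: "\<And>j. j \<le> p \<Longrightarrow> integrable phase_measure (F j)"
    and cont: "\<And>j. j \<le> p \<Longrightarrow> continuous_on UNIV (F j)"
    and deriv: "\<And>j z h. j < p \<Longrightarrow> ((\<lambda>h. F j (z + h *\<^sub>R b)) has_vector_derivative F (Suc j) (z + h *\<^sub>R b)) (at h)"
  shows "\<bar>\<omega> \<bullet> b\<bar> ^ p * cmod (\<integral>z. wave \<omega> z * of_real (F 0 z) \<partial>phase_measure) \<le> (\<integral>z. \<bar>F p z\<bar> \<partial>phase_measure)"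
proof -
  have "j \<le> p \<Longrightarrow> (\<integral>z. wave \<omega> z * of_real (F j z) \<partial>phase_measure) = (\<i> * of_real (\<omega> \<bullet> b)) ^ j * (\<integral>z. wave \<omega> z * of_real (F 0 z) \<partial>phase_measure)" for j
  proof (induction j)
    case (Suc j)
    then show ?case
      using wave_coef_derivative[OF \<omega> per[of j] per[of "Suc j"] int[of j] int[of "Suc j"] cont[of j] cont[of "Suc j"] deriv[of j]]
      by (simp add: mult_ac)
  qed simp
  from this[of p] have "\<bar>\<omega> \<bullet> b\<bar> ^ p * cmod (\<integral>z. wave \<omega> z * of_real (F 0 z) \<partial>phase_measure)
      = cmod (\<integral>z. wave \<omega> z * of_real (F p z) \<partial>phase_measure)"
    by (simp add: norm_mult norm_power)
  also have "\<dots> \<le> (\<integral>z. cmod (wave \<omega> z * of_real (F p z)) \<partial>phase_measure)" by (rule integral_norm_bound)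
  finally show ?thesis by (simp add: norm_mult)
qed

section \<open>The velocity weight and Cauchy--Schwarz on phase space\<close>

lemma ennreal_power2_le_cancel: "(a::ennreal)\<^sup>2 \<le> b\<^sup>2 \<Longrightarrow> a \<le> b"
  by (cases a; cases b) (auto simp: ennreal_power top_power_ennreal top_unique intro: power2_le_imp_le ennreal_leI)

definition weight_const :: "'d::finite itself \<Rightarrow> real \<Rightarrow> real" where
  "weight_const _ \<sigma> = enn2real (\<integral>\<^sup>+v. ennreal ((1 + (norm (v::real^'d))\<^sup>2) powr (-\<sigma>)) \<partial>lborel)"

lemma weight_const:
  assumes "\<sigma> > CARD('d::finite) / 2"
  shows "(\<integral>\<^sup>+v. ennreal ((1 + (norm (v::real^'d))\<^sup>2) powr (-\<sigma>)) \<partial>lborel) = ennreal (weight_const TYPE('d) \<sigma>)"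
    and "0 \<le> weight_const TYPE('d) \<sigma>"
  using weight_integral_finite[OF assms] by (auto simp: weight_const_def)

definition weighted_sq :: "real \<Rightarrow> ('d::finite phase \<Rightarrow> 'b::real_normed_vector) \<Rightarrow> ennreal" where
  "weighted_sq \<sigma> F = (\<integral>\<^sup>+x. (\<integral>\<^sup>+v. ennreal ((1 + (norm v)\<^sup>2) powr \<sigma> * (norm (F (x, v)))\<^sup>2) \<partial>lborel) \<partial>torus)"

text \<open>The weight is split as \<rho>^(-\<sigma>/2) times \<rho>^(\<sigma>/2). In the first
  factor x is integrated before v: translating by c v leaves the torus integral of w^2 unchanged, so
  the bound does not depend on c. With w = 1 it gives L1 bounds; with w a Fourier remainder of the
  gradient it gives convergence.\<close>

lemma weighted_Cauchy_Schwarz: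
  fixes w :: "real^'d::finite \<Rightarrow> real" and F :: "'d phase \<Rightarrow> 'b::{real_normed_vector, second_countable_topology}"
  assumes [measurable]: "w \<in> borel_measurable borel" "F \<in> borel_measurable borel"
    and per: "periodic w" and \<sigma>: "\<sigma> > CARD('d) / 2"
  shows "(\<integral>\<^sup>+z. ennreal (\<bar>w (fst z - c *\<^sub>R snd z)\<bar> * norm (F z)) \<partial>phase_measure)\<^sup>2
    \<le> ennreal (weight_const TYPE('d) \<sigma>) * (\<integral>\<^sup>+x. ennreal ((w x)\<^sup>2) \<partial>torus) * weighted_sq \<sigma> F"
proof -
  define \<rho> :: "real^'d \<Rightarrow> real" where "\<rho> v = 1 + (norm v)\<^sup>2" for v
  have \<rho>: "\<rho> v > 0" for v by (simp add: \<rho>_def add_pos_nonneg)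
  have [measurable]: "\<rho> \<in> borel_measurable borel" unfolding \<rho>_def by measurable
  have wm [measurable]: "(\<lambda>z::'d phase. w (fst z - c *\<^sub>R snd z)) \<in> borel_measurable borel"
    by (rule measurable_compose[OF _ assms(1)]) measurable
  have sm [measurable]: "(\<lambda>z::'d phase. \<rho> (snd z)) \<in> borel_measurable borel"
    by (rule measurable_compose[OF borel_measurable_snd]) measurable
  let ?f = "\<lambda>z::'d phase. ennreal (\<rho> (snd z) powr (-\<sigma>/2) * \<bar>w (fst z - c *\<^sub>R snd z)\<bar>)"
  let ?g = "\<lambda>z::'d phase. ennreal (\<rho> (snd z) powr (\<sigma>/2) * norm (F z))"
  have split: "(\<integral>\<^sup>+z. ennreal (\<bar>w (fst z - c *\<^sub>R snd z)\<bar> * norm (F z)) \<partial>phase_measure)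
     = (\<integral>\<^sup>+z. ?f z * ?g z \<partial>phase_measure)"
  proof (rule nn_integral_cong)
    fix z :: "'d phase"
    have "\<rho> (snd z) powr (-\<sigma>/2) * \<rho> (snd z) powr (\<sigma>/2) = 1"
      using \<rho>[of "snd z"] by (simp flip: powr_add)
    then have "\<bar>w (fst z - c *\<^sub>R snd z)\<bar> * norm (F z)
      = (\<rho> (snd z) powr (-\<sigma>/2) * \<bar>w (fst z - c *\<^sub>R snd z)\<bar>) * (\<rho> (snd z) powr (\<sigma>/2) * norm (F z))"
      by (simp add: mult_ac)
    then show "ennreal (\<bar>w (fst z - c *\<^sub>R snd z)\<bar> * norm (F z)) = ?f z * ?g z"
      by (simp only: ennreal_mult[symmetric] mult_nonneg_nonneg powr_ge_zero abs_ge_zero norm_ge_zero)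
  qed
  have CS: "(\<integral>\<^sup>+z. ?f z * ?g z \<partial>phase_measure)\<^sup>2 \<le> (\<integral>\<^sup>+z. (?f z)\<^sup>2 \<partial>phase_measure) * (\<integral>\<^sup>+z. (?g z)\<^sup>2 \<partial>phase_measure)"
    by (rule Cauchy_Schwarz_nn_integral) measurable
  have g: "(\<integral>\<^sup>+z. (?g z)\<^sup>2 \<partial>phase_measure) = weighted_sq \<sigma> F"
  proof -
    have "(?g z)\<^sup>2 = ennreal (\<rho> (snd z) powr \<sigma> * (norm (F z))\<^sup>2)" for z
    proof -
      have "(\<rho> (snd z) powr (\<sigma>/2) * norm (F z))\<^sup>2 = \<rho> (snd z) powr \<sigma> * (norm (F z))\<^sup>2"
        using \<rho>[of "snd z"] by (simp add: power_mult_distrib powr_power)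
      then show ?thesis by (simp add: ennreal_power)
    qed
    moreover have "(\<integral>\<^sup>+z. ennreal (\<rho> (snd z) powr \<sigma> * (norm (F z))\<^sup>2) \<partial>phase_measure) = weighted_sq \<sigma> F"
      by (subst lborel.nn_integral_fst[symmetric]) (auto simp: weighted_sq_def \<rho>_def)
    ultimately show ?thesis by simp
  qed
  have f: "(\<integral>\<^sup>+z. (?f z)\<^sup>2 \<partial>phase_measure) = ennreal (weight_const TYPE('d) \<sigma>) * (\<integral>\<^sup>+x. ennreal ((w x)\<^sup>2) \<partial>torus)"
  proof -
    have "(?f z)\<^sup>2 = ennreal (\<rho> (snd z) powr (-\<sigma>)) * ennreal ((w (fst z - c *\<^sub>R snd z))\<^sup>2)" for z
    proof -
      have "(\<rho> (snd z) powr (-\<sigma>/2) * \<bar>w (fst z - c *\<^sub>R snd z)\<bar>)\<^sup>2 = \<rho> (snd z) powr (-\<sigma>) * (w (fst z - c *\<^sub>R snd z))\<^sup>2"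
        using \<rho>[of "snd z"] by (simp add: power_mult_distrib powr_power)
      then show ?thesis
        by (simp only: ennreal_power ennreal_mult[symmetric] mult_nonneg_nonneg powr_ge_zero abs_ge_zero zero_le_power2)
    qed
    then have "(\<integral>\<^sup>+z. (?f z)\<^sup>2 \<partial>phase_measure) =
        (\<integral>\<^sup>+v. (\<integral>\<^sup>+x. ennreal (\<rho> v powr (-\<sigma>)) * ennreal ((w (x - c *\<^sub>R v))\<^sup>2) \<partial>torus) \<partial>lborel)"
      by (subst torus_lborel.nn_integral_snd[symmetric]) auto
    also have "\<dots> = (\<integral>\<^sup>+v. ennreal (\<rho> v powr (-\<sigma>)) * (\<integral>\<^sup>+x. ennreal ((w x)\<^sup>2) \<partial>torus) \<partial>lborel)"
    proof (rule nn_integral_cong)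
      fix v :: "real^'d"
      have p2: "periodic (\<lambda>x. ennreal ((w x)\<^sup>2))" using per by (simp add: periodic_def)
      show "(\<integral>\<^sup>+x. ennreal (\<rho> v powr (-\<sigma>)) * ennreal ((w (x - c *\<^sub>R v))\<^sup>2) \<partial>torus)
        = ennreal (\<rho> v powr (-\<sigma>)) * (\<integral>\<^sup>+x. ennreal ((w x)\<^sup>2) \<partial>torus)"
        using nn_integral_torus_shift[OF _ p2, of "- c *\<^sub>R v"] by (subst nn_integral_cmult) auto
    qed
    also have "\<dots> = ennreal (weight_const TYPE('d) \<sigma>) * (\<integral>\<^sup>+x. ennreal ((w x)\<^sup>2) \<partial>torus)"
      using weight_const(1)[OF \<sigma>] by (subst nn_integral_multc) (auto simp: \<rho>_def)
    finally show ?thesis .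
  qed
  show ?thesis using CS unfolding split g f .
qed

text \<open>The case w = 1, where the torus has mass 1.\<close>

lemma weighted_L1:
  fixes F :: "'d::finite phase \<Rightarrow> 'b::{banach, second_countable_topology}"
  assumes [measurable]: "F \<in> borel_measurable borel" and \<sigma>: "\<sigma> > CARD('d) / 2"
    and le: "weighted_sq \<sigma> F \<le> ennreal (\<gamma>\<^sup>2)" and "\<gamma> \<ge> 0"
  shows "integrable phase_measure F"
    and "(\<integral>\<^sup>+z. ennreal (norm (F z)) \<partial>phase_measure) \<le> ennreal (sqrt (weight_const TYPE('d) \<sigma>) * \<gamma>)"
    and "(\<integral>z. norm (F z) \<partial>phase_measure) \<le> sqrt (weight_const TYPE('d) \<sigma>) * \<gamma>"
proof -
  have "(\<integral>\<^sup>+z. ennreal (norm (F z)) \<partial>phase_measure)\<^sup>2 \<le> ennreal (weight_const TYPE('d) \<sigma>) * weighted_sq \<sigma> F"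
    using weighted_Cauchy_Schwarz[of "\<lambda>_. 1" F \<sigma> 0] \<sigma> by (simp add: periodic_def)
  also have "\<dots> \<le> ennreal (weight_const TYPE('d) \<sigma>) * ennreal (\<gamma>\<^sup>2)"
    by (intro mult_left_mono le) auto
  also have "\<dots> = (ennreal (sqrt (weight_const TYPE('d) \<sigma>) * \<gamma>))\<^sup>2"
    using weight_const(2)[OF \<sigma>] \<open>\<gamma> \<ge> 0\<close> by (simp add: ennreal_power power_mult_distrib ennreal_mult')
  finally show b: "(\<integral>\<^sup>+z. ennreal (norm (F z)) \<partial>phase_measure) \<le> ennreal (sqrt (weight_const TYPE('d) \<sigma>) * \<gamma>)"
    by (rule ennreal_power2_le_cancel)
  then show i: "integrable phase_measure F"
    by (intro integrableI_bounded) (auto intro: le_less_trans)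
  show "(\<integral>z. norm (F z) \<partial>phase_measure) \<le> sqrt (weight_const TYPE('d) \<sigma>) * \<gamma>"
    using b \<open>\<gamma> \<ge> 0\<close> weight_const(2)[OF \<sigma>]
    by (subst integral_eq_nn_integral) (auto intro: enn2real_leI)
qed

section \<open>Calculus of smooth functions\<close>

lemma has_derivative_cong_open:
  assumes "open S" and "\<And>x. x \<in> S \<Longrightarrow> f x = g x" and "x \<in> S"
  shows "(f has_derivative D) (at x) \<longleftrightarrow> (g has_derivative D) (at x)"
  using has_derivative_transform_within_open[of f D x UNIV S g] has_derivative_transform_within_open[of g D x UNIV S f]
    assms by auto

text \<open>Openness matters: derivatives at a point of \<open>S\<close> see a whole neighbourhood,
  on which the two functions agree.\<close>

lemma Ck_on_cong:
  assumes "open S" and "\<And>x. x \<in> S \<Longrightarrow> f x = g x"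
  shows "Ck_on k f S \<longleftrightarrow> Ck_on k g S"
  using assms(2)
proof (induction k arbitrary: f g)
  case 0
  then show ?case by (auto cong: continuous_on_cong)
next
  case (Suc k)
  have *: "(f has_derivative D) (at x) \<longleftrightarrow> (g has_derivative D) (at x)" if "x \<in> S" for x D
    by (rule has_derivative_cong_open[OF assms(1) Suc.prems that])
  then have d: "f differentiable (at x) \<longleftrightarrow> g differentiable (at x)" if "x \<in> S" for x
    using that by (auto simp: differentiable_def)
  have "frechet_derivative f (at x) = frechet_derivative g (at x)" if "x \<in> S" for x
    using *[OF that] by (simp add: frechet_derivative_def)
  then have "Ck_on k (\<lambda>x. frechet_derivative f (at x) b) S \<longleftrightarrow> Ck_on k (\<lambda>x. frechet_derivative g (at x) b) S" for b
    by (intro Suc.IH) simp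
  then show ?case using d by auto
qed

text \<open>An introduction rule for any known derivative, so that the calculus rules below can be
  applied without computing \<open>frechet_derivative\<close>.\<close>

lemma Ck_on_SucI:
  assumes S: "open S" and d: "\<And>x. x \<in> S \<Longrightarrow> (f has_derivative f' x) (at x)"
    and k: "\<And>b. Ck_on k (\<lambda>x. f' x b) S"
  shows "Ck_on (Suc k) f S"
proof -
  have "frechet_derivative f (at x) = f' x" if "x \<in> S" for x
    using frechet_derivative_at[OF d[OF that]] by simp
  then have "Ck_on k (\<lambda>x. frechet_derivative f (at x) b) S" for b
    using k[of b] by (subst Ck_on_cong[OF S, of _ "\<lambda>x. f' x b"]) auto
  moreover have "f differentiable (at x)" if "x \<in> S" for x
    using d[OF that] by (auto simp: differentiable_def)
  ultimately show ?thesis by simp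
qed

lemma Ck_on_SucD:
  assumes "Ck_on (Suc k) f S"
  shows "x \<in> S \<Longrightarrow> (f has_derivative frechet_derivative f (at x)) (at x)"
    and "Ck_on k (\<lambda>x. frechet_derivative f (at x) b) S"
  using assms by (auto simp: frechet_derivative_works)

lemma Ck_on_Suc_imp: "Ck_on (Suc k) f S \<Longrightarrow> Ck_on k f S"
proof (induction k arbitrary: f)
  case 0
  then show ?case
    by (auto intro!: continuous_at_imp_continuous_on differentiable_imp_continuous_within)
qed auto

lemma Ck_on_subset: "Ck_on k f S \<Longrightarrow> S' \<subseteq> S \<Longrightarrow> Ck_on k f S'"
  by (induction k arbitrary: f) (auto intro: continuous_on_subset)

lemma Ck_on_const: "open S \<Longrightarrow> Ck_on k (\<lambda>x. c) S"
proof (induction k arbitrary: c)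
  case (Suc k)
  show ?case by (rule Ck_on_SucI[where f' = "\<lambda>x b. 0"]) (use Suc in auto)
qed simp

lemma Ck_on_add:
  assumes "open S" "Ck_on k f S" "Ck_on k g S" shows "Ck_on k (\<lambda>x. f x + g x) S"
  using assms(2,3)
proof (induction k arbitrary: f g)
  case (Suc k)
  show ?case
    by (rule Ck_on_SucI[OF assms(1) has_derivative_add[OF Ck_on_SucD(1)[OF Suc.prems(1)] Ck_on_SucD(1)[OF Suc.prems(2)]]])
      (auto intro: Suc.IH Ck_on_SucD(2)[OF Suc.prems(1)] Ck_on_SucD(2)[OF Suc.prems(2)])
qed (auto intro: continuous_intros)

text \<open>The product rule leaves one factor undifferentiated; \<open>Ck_on_Suc_imp\<close> lowers
  its order to match the induction hypothesis.\<close>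

lemma Ck_on_mult:
  fixes f g :: "'a::real_normed_vector \<Rightarrow> real"
  assumes "open S" "Ck_on k f S" "Ck_on k g S" shows "Ck_on k (\<lambda>x. f x * g x) S"
  using assms(2,3)
proof (induction k arbitrary: f g)
  case (Suc k)
  show ?case
    by (rule Ck_on_SucI[OF assms(1) has_derivative_mult[OF Ck_on_SucD(1)[OF Suc.prems(1)] Ck_on_SucD(1)[OF Suc.prems(2)]]])
      (auto intro!: Ck_on_add[OF assms(1)] Suc.IH Ck_on_SucD(2)[OF Suc.prems(1)] Ck_on_SucD(2)[OF Suc.prems(2)]
        Ck_on_Suc_imp[OF Suc.prems(1)] Ck_on_Suc_imp[OF Suc.prems(2)] simp del: Ck_on.simps)
qed (auto intro: continuous_intros)

lemma Ck_on_sum: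
  assumes "open S" "finite I" "\<And>i. i \<in> I \<Longrightarrow> Ck_on k (f i) S"
  shows "Ck_on k (\<lambda>x. \<Sum>i\<in>I. f i x) S"
  using assms(2,3) by (induction I) (auto intro: Ck_on_const Ck_on_add assms(1))

lemma Ck_on_linear:
  assumes "open S" "bounded_linear f" shows "Ck_on k f S"
proof (cases k)
  case 0
  then show ?thesis using assms(2) by (simp add: linear_continuous_on)
next
  case (Suc k)
  show ?thesis unfolding Suc
    by (rule Ck_on_SucI[OF assms(1) bounded_linear_imp_has_derivative[OF assms(2)]]) (rule Ck_on_const[OF assms(1)])
qed

text \<open>Proved simultaneously, since each of the two functions is, up to a constant factor, the
  derivative of the other.\<close>

lemma Ck_on_cos_sin:
  fixes f :: "'a::real_normed_vector \<Rightarrow> real"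
  assumes "open S" "bounded_linear f"
  shows "Ck_on k (\<lambda>x. cos (f x)) S \<and> Ck_on k (\<lambda>x. sin (f x)) S"
proof (induction k)
  case 0
  have "continuous_on S f" by (rule linear_continuous_on[OF assms(2)])
  then show ?case by (simp add: continuous_on_cos continuous_on_sin)
next
  case (Suc k)
  note d = bounded_linear_imp_has_derivative[OF assms(2)]
  have "Ck_on k (\<lambda>x. (- f b) * sin (f x)) S" "Ck_on k (\<lambda>x. f b * cos (f x)) S" for b
    using Suc by (intro Ck_on_mult Ck_on_const assms(1); simp)+
  note c = this
  have "Ck_on (Suc k) (\<lambda>x. cos (f x)) S"
    by (rule Ck_on_SucI[OF assms(1) _ c(1)]) (auto intro!: derivative_eq_intros d)
  moreover have "Ck_on (Suc k) (\<lambda>x. sin (f x)) S"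
    by (rule Ck_on_SucI[OF assms(1) _ c(2)]) (auto intro!: derivative_eq_intros d)
  ultimately show ?case ..
qed

lemma Ck_on_polynomial_embed:
  assumes "real_polynomial_function q"
  shows "Ck_on k (\<lambda>z. q (cyl_embed z)) UNIV"
  using assms
proof induction
  case (linear f)
  have "bounded_linear (\<lambda>z::real \<times> (real^'a). snd z $ j)" for j
    by (rule bounded_linear_compose[OF bounded_linear_vec_nth bounded_linear_snd])
  note cs = Ck_on_cos_sin[OF open_UNIV this, of k]
  have t: "Ck_on k (\<lambda>z::real \<times> (real^'a). f (1, 0, 0) * fst z) UNIV"
    by (intro Ck_on_mult Ck_on_const Ck_on_linear bounded_linear_fst open_UNIV)
  have "f (cyl_embed z) = f (1, 0, 0) * fst z + (\<Sum>j\<in>UNIV. cos (snd z $ j) * f (0, axis j 1, 0))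
      + (\<Sum>j\<in>UNIV. sin (snd z $ j) * f (0, 0, axis j 1))" for z
    using linear_cyl_embed[OF linear, of "fst z" "snd z"] by (simp add: mult.commute)
  then show ?case
    using cs t by (simp add: Ck_on_add Ck_on_sum Ck_on_mult Ck_on_const)
qed (auto intro: Ck_on_const Ck_on_add Ck_on_mult)

lemma smooth_on_diff:
  fixes f g :: "'a::real_normed_vector \<Rightarrow> real"
  assumes "open S" "smooth_on f S" "smooth_on g S"
  shows "smooth_on (\<lambda>x. f x - g x) S"
proof -
  have "Ck_on k (\<lambda>x. f x + (-1) * g x) S" for k
    using assms by (intro Ck_on_add Ck_on_mult Ck_on_const) (auto simp: smooth_on_def)
  then show ?thesis by (simp add: smooth_on_def)
qed

section \<open>Directional derivatives, parameter slices and multi-indices\<close>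

lemma has_vector_derivative_along:
  assumes "(f has_derivative D) (at (z + h *\<^sub>R b))"
  shows "((\<lambda>h. f (z + h *\<^sub>R b)) has_vector_derivative D b) (at h)"
proof -
  have "((\<lambda>h. z + h *\<^sub>R b) has_vector_derivative b) (at h)"
    by (auto intro!: derivative_eq_intros)
  then have "((\<lambda>h. z + h *\<^sub>R b) has_derivative (\<lambda>h. h *\<^sub>R b)) (at h)"
    by (simp add: has_vector_derivative_def)
  from diff_chain_at[OF this assms]
  have "((\<lambda>h. f (z + h *\<^sub>R b)) has_derivative (\<lambda>h. D (h *\<^sub>R b))) (at h)" by (simp add: o_def)
  moreover have "D (h *\<^sub>R b) = h *\<^sub>R D b" for h
    using has_derivative_bounded_linear[OF assms] by (simp add: linear_simps(5))
  ultimately show ?thesis by (simp add: has_vector_derivative_def)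
qed

lemma partial_eq_frechet:
  assumes "f differentiable (at x)"
  shows "partial b f x = frechet_derivative f (at x) b"
proof -
  have "((\<lambda>h. f (x + h *\<^sub>R b)) has_vector_derivative frechet_derivative f (at x) b) (at 0)"
    using assms by (intro has_vector_derivative_along) (simp add: frechet_derivative_works)
  then show ?thesis unfolding partial_def by (rule vector_derivative_at)
qed

lemma smooth_on_partial:
  assumes "open S" "smooth_on f S"
  shows "smooth_on (partial b f) S"
  unfolding smooth_on_def
proof
  fix k
  have k: "Ck_on (Suc k) f S" using assms(2) by (simp add: smooth_on_def del: Ck_on.simps)
  then have "partial b f x = frechet_derivative f (at x) b" if "x \<in> S" for x
    using that by (intro partial_eq_frechet) simp
  then show "Ck_on k (partial b f) S"
    using k by (subst Ck_on_cong[OF assms(1)]) auto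
qed

lemma smooth_on_partial_iterate:
  assumes "open S" "smooth_on f S"
  shows "smooth_on ((partial b ^^ j) f) S"
  by (induction j) (use assms smooth_on_partial in auto)

lemma smooth_on_imp_continuous_on: "smooth_on f S \<Longrightarrow> continuous_on S f"
  unfolding smooth_on_def by (metis Ck_on.simps(1))

lemma smooth_on_partial_derivative:
  assumes "smooth_on f S" "z + h *\<^sub>R b \<in> S"
  shows "((\<lambda>h. f (z + h *\<^sub>R b)) has_vector_derivative partial b f (z + h *\<^sub>R b)) (at h)"
proof -
  have "Ck_on (Suc 0) f S" using assms(1) by (simp only: smooth_on_def)
  then have d: "f differentiable (at (z + h *\<^sub>R b))" using assms(2) by simp
  then show ?thesis
    using has_vector_derivative_along[of f "frechet_derivative f (at (z + h *\<^sub>R b))" z h b]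
    by (simp add: partial_eq_frechet frechet_derivative_works)
qed

lemma xperiodic_partial: "xperiodic f \<Longrightarrow> xperiodic (partial b f)"
  unfolding xperiodic_def periodic_def
proof (intro allI)
  fix v x i
  assume per: "\<forall>v x i. f (x + axis i (2 * pi), v) = f (x, v)"
  have "f ((x + axis i (2 * pi), v) + h *\<^sub>R b) = f ((x, v) + h *\<^sub>R b)" for h
    using per[rule_format, of "x + h *\<^sub>R fst b" i "v + h *\<^sub>R snd b"] by (cases b) (simp add: add_ac)
  then show "partial b f (x + axis i (2 * pi), v) = partial b f (x, v)" by (simp add: partial_def)
qed

lemma xperiodic_partial_iterate: "xperiodic f \<Longrightarrow> xperiodic ((partial b ^^ j) f)"
  by (induction j) (auto intro: xperiodic_partial)

text \<open>Freezing a parameter amounts to differentiating the joint function in directions that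
  vanish in that slot. The identity is immediate because \<open>partial\<close> looks at the
  function along a line only.\<close>

lemma partial_iterate_slice:
  "(partial b ^^ j) (\<lambda>z. F (c, z)) = (\<lambda>z. (partial (0, b) ^^ j) F (c, z))"
  by (induction j) (auto simp: partial_def)

lemma partial_iterate_slice2:
  "(partial b ^^ j) (\<lambda>z. F (t, s, z)) = (\<lambda>z. (partial (0, 0, b) ^^ j) F (t, s, z))"
  by (induction j) (auto simp: partial_def)

lemma coords: "distinct (coords :: 'd::finite list)" "set (coords :: 'd list) = UNIV"
proof -
  have "\<exists>xs::'d list. distinct xs \<and> set xs = UNIV" using finite_distinct_list[of "UNIV :: 'd set"] by auto
  from someI_ex[OF this] show "distinct (coords :: 'd list)" "set (coords :: 'd list) = UNIV"
    by (auto simp: coords_def)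
qed

lemma foldr_funpow_single:
  assumes "distinct xs"
  shows "foldr (\<lambda>j. g j ^^ (if j = i then p else 0)) xs = (if i \<in> set xs then g i ^^ p else id)"
  using assms by (induction xs) (auto simp: fun_eq_iff)

text \<open>A multi-index concentrated in one coordinate gives an iterated derivative in that
  direction, whichever enumeration \<open>coords\<close> happens to be.\<close>

lemma multi_partial_single:
  "multi_partial (\<lambda>j. if j = i then p else 0) (\<lambda>_. 0) f = (partial (axis i 1, 0) ^^ p) f"
  "multi_partial (\<lambda>_. 0) (\<lambda>j. if j = i then p else 0) f = (partial (0, axis i 1) ^^ p) f"
proof -
  have z: "foldr (\<lambda>j. g j ^^ 0) xs = id" for g :: "'a \<Rightarrow> 'c \<Rightarrow> 'c" and xs
    by (induction xs) (auto simp: fun_eq_iff)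
  show "multi_partial (\<lambda>j. if j = i then p else 0) (\<lambda>_. 0) f = (partial (axis i 1, 0) ^^ p) f"
    "multi_partial (\<lambda>_. 0) (\<lambda>j. if j = i then p else 0) f = (partial (0, axis i 1) ^^ p) f"
    unfolding multi_partial_def z foldr_funpow_single[OF coords(1)] coords(2) by simp_all
qed

lemma ennreal_sqrt_power2: "(ennreal_sqrt a)\<^sup>2 = a"
  by (cases a) (auto simp: ennreal_sqrt_def ennreal_power top_power_ennreal)

lemma ennreal_sqrt_le_iff: "ennreal_sqrt a \<le> b \<longleftrightarrow> a \<le> b\<^sup>2"
  using ennreal_power2_le_cancel[of "ennreal_sqrt a" b] power_mono[of "ennreal_sqrt a" b 2]
  by (auto simp: ennreal_sqrt_power2)

text \<open>The 2 d coordinate directions of phase space. Repeated derivatives along each of them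
  already control every coordinate of the joint frequency, so derivatives in different directions
  never have to be interchanged.\<close>

definition pure_dirs :: "('d::finite phase) set" where
  "pure_dirs = range (\<lambda>i. (axis i 1, 0)) \<union> range (\<lambda>i. (0, axis i 1))"

lemma weighted_sq_pure_le_Hps:
  assumes "b \<in> pure_dirs" "j \<le> p"
  shows "weighted_sq \<sigma> ((partial b ^^ j) f) \<le> (Hps_norm p \<sigma> f)\<^sup>2"
proof -
  let ?A = "{(\<alpha> :: 'a \<Rightarrow> nat, \<beta> :: 'a \<Rightarrow> nat). (\<Sum>i\<in>UNIV. \<alpha> i) + (\<Sum>i\<in>UNIV. \<beta> i) \<le> p}"
  let ?term = "\<lambda>(\<alpha>, \<beta>). weighted_sq \<sigma> (multi_partial \<alpha> \<beta> f)"
  \<comment> \<open>Finiteness of the index set is essential: a sum over an infinite set is 0 by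
    convention and would not dominate its terms.\<close>
  have "?A \<subseteq> (UNIV \<rightarrow> {..p}) \<times> (UNIV \<rightarrow> {..p})"
  proof safe
    fix \<alpha> \<beta> :: "'a \<Rightarrow> nat" and x
    assume "(\<Sum>i\<in>UNIV. \<alpha> i) + (\<Sum>i\<in>UNIV. \<beta> i) \<le> p"
    moreover have "\<alpha> x \<le> (\<Sum>i\<in>UNIV. \<alpha> i)" "\<beta> x \<le> (\<Sum>i\<in>UNIV. \<beta> i)"
      by (auto intro: member_le_sum)
    ultimately show "\<alpha> x \<le> p" "\<beta> x \<le> p" by linarith+
  qed
  moreover have "finite ((UNIV \<rightarrow> {..p}) :: ('a \<Rightarrow> nat) set)"
    using finite_PiE[of UNIV "\<lambda>_::'a. {..p}"] by (simp add: PiE_UNIV_domain)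
  ultimately have fin: "finite ?A" using finite_subset by blast
  have eq: "(Hps_norm p \<sigma> f)\<^sup>2 = sum ?term ?A"
    by (simp add: Hps_norm_def ennreal_sqrt_power2 weighted_sq_def case_prod_beta)
  obtain \<alpha> \<beta> where ab: "(\<alpha>, \<beta>) \<in> ?A" "multi_partial \<alpha> \<beta> f = (partial b ^^ j) f"
  proof -
    from assms(1) consider i where "b = (axis i 1, 0)" | i where "b = (0, axis i 1)"
      by (auto simp: pure_dirs_def)
    then show thesis
    proof cases
      case 1
      then show ?thesis using assms(2)
        by (intro that[of "\<lambda>k. if k = i then j else 0" "\<lambda>_. 0"]) (auto simp: multi_partial_single)
    next
      case 2
      then show ?thesis using assms(2)
        by (intro that[of "\<lambda>_. 0" "\<lambda>k. if k = i then j else 0"]) (auto simp: multi_partial_single)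
    qed
  qed
  show ?thesis
    unfolding eq using member_le_sum[OF ab(1), of ?term] fin ab(2) by auto
qed

section \<open>Fourier coefficients of the averaged gradient\<close>

text \<open>All that the coefficient estimate uses of the field at fixed times: continuity,
  periodicity, and the chains of derivatives in coordinate directions with weighted norms at most
  \<gamma>. Neighbourhoods of the time interval do not appear any more.\<close>

definition regular_slice :: "nat \<Rightarrow> real \<Rightarrow> real \<Rightarrow> ('d::finite phase \<Rightarrow> real^'d) \<Rightarrow> bool" where
  "regular_slice p \<sigma> \<gamma> f \<longleftrightarrow> xperiodic f \<and> continuous_on UNIV f \<and>
    (\<forall>b\<in>pure_dirs. \<forall>j\<le>p. continuous_on UNIV ((partial b ^^ j) f)
        \<and> weighted_sq \<sigma> ((partial b ^^ j) f) \<le> ennreal (\<gamma>\<^sup>2)) \<and>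
    (\<forall>b\<in>pure_dirs. \<forall>j<p. \<forall>z h. ((\<lambda>h. (partial b ^^ j) f (z + h *\<^sub>R b)) has_vector_derivative
        (partial b ^^ Suc j) f (z + h *\<^sub>R b)) (at h))"

lemma regular_slice_continuous: "regular_slice p \<sigma> \<gamma> f \<Longrightarrow> continuous_on UNIV f"
  by (simp add: regular_slice_def)

lemma regular_slice_weighted:
  assumes "regular_slice p \<sigma> \<gamma> f" shows "weighted_sq \<sigma> f \<le> ennreal (\<gamma>\<^sup>2)"
proof -
  have "(axis undefined 1, 0) \<in> pure_dirs" by (auto simp: pure_dirs_def)
  then have "weighted_sq \<sigma> ((partial (axis undefined 1, 0) ^^ 0) f) \<le> ennreal (\<gamma>\<^sup>2)"
    using assms unfolding regular_slice_def by blast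
  then show ?thesis by simp
qed

lemma regular_slice_field:
  fixes G :: "real \<Rightarrow> real \<Rightarrow> real^'d::finite \<Rightarrow> real^'d \<Rightarrow> real^'d"
  assumes G: "smooth_field T G" and \<gamma>: "sup_Hps_norm T p \<sigma> G \<le> ennreal \<gamma>" "\<gamma> \<ge> 0"
    and ts: "t \<in> {0..T}" "s \<in> {0..T}"
  shows "regular_slice p \<sigma> \<gamma> (\<lambda>(x, v). G t s x v)"
proof -
  define F where "F = (\<lambda>(t, s, x, v). G t s x v)"
  obtain S where S: "open S" "{0..T} \<times> {0..T} \<times> UNIV \<times> UNIV \<subseteq> S" "smooth_on F S"
    using G unfolding smooth_field_def F_def by blast
  let ?f = "\<lambda>z. F (t, s, z)"
  have f: "(\<lambda>(x, v). G t s x v) = ?f" by (auto simp: F_def)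
  have inS: "(t, s, z) \<in> S" for z using S(2) ts by (cases z) auto
  have sm: "smooth_on ((partial b ^^ j) F) S" for b j
    by (rule smooth_on_partial_iterate[OF S(1,3)])
  have "weighted_sq \<sigma> ((partial b ^^ j) ?f) \<le> ennreal (\<gamma>\<^sup>2)" if "b \<in> pure_dirs" "j \<le> p" for b j
  proof -
    have "Hps_norm p \<sigma> ?f \<le> sup_Hps_norm T p \<sigma> G"
      unfolding sup_Hps_norm_def f[symmetric] using ts by (auto intro!: SUP_upper2[of "(t, s)"])
    with \<gamma> have "(Hps_norm p \<sigma> ?f)\<^sup>2 \<le> (ennreal \<gamma>)\<^sup>2" by (intro power_mono) auto
    then show ?thesis
      using weighted_sq_pure_le_Hps[OF that, of \<sigma> ?f] \<gamma>(2) by (simp add: ennreal_power)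
  qed
  moreover have c: "continuous_on UNIV ((partial b ^^ j) ?f)" for b j
    unfolding partial_iterate_slice2
    by (rule continuous_on_compose2[OF smooth_on_imp_continuous_on[OF sm]]) (auto intro!: continuous_intros inS)
  moreover have "((\<lambda>h. (partial b ^^ j) ?f (z + h *\<^sub>R b)) has_vector_derivative
        (partial b ^^ Suc j) ?f (z + h *\<^sub>R b)) (at h)" for b j z h
  proof -
    have "(t, s, z) + h *\<^sub>R (0, 0, b) \<in> S" using inS by simp
    from smooth_on_partial_derivative[OF sm[of j "(0, 0, b)"] this] show ?thesis
      unfolding partial_iterate_slice2 by simp
  qed
  moreover have "xperiodic ?f"
    using G ts unfolding smooth_field_def by (auto simp: xperiodic_def F_def)
  ultimately show ?thesis
    unfolding regular_slice_def f using c[of 0 0] by simp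
qed

text \<open>Integrating by parts p times along each coordinate direction bounds the coefficient by B
  over the p-th power of that frequency coordinate; without integration by parts it is at most B.
  The best of these bounds is the one for the largest coordinate.\<close>

lemma slice_wave_coef_bound:
  fixes f :: "'d::finite phase \<Rightarrow> real^'d"
  assumes f: "regular_slice p \<sigma> \<gamma> f" and \<sigma>: "\<sigma> > CARD('d) / 2" and "\<gamma> \<ge> 0"
  shows "(1 + l1 (freq l) + l1 \<xi>) ^ p * cmod (\<integral>z. wave (freq l, \<xi>) z * of_real (\<kappa> \<bullet> f z) \<partial>phase_measure)
    \<le> (1 + 2 * real CARD('d)) ^ p * sqrt (weight_const TYPE('d) \<sigma>) * \<gamma> * norm \<kappa>"
proof -
  define E where "E = cmod (\<integral>z. wave (freq l, \<xi>) z * of_real (\<kappa> \<bullet> f z) \<partial>phase_measure)"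
  define B where "B = sqrt (weight_const TYPE('d) \<sigma>) * \<gamma> * norm \<kappa>"
  let ?\<omega> = "(freq l, \<xi>)"
  have L1: "(\<integral>z. \<bar>\<kappa> \<bullet> g z\<bar> \<partial>phase_measure) \<le> B" "integrable phase_measure (\<lambda>z. \<kappa> \<bullet> g z)"
    if "continuous_on UNIV g" "weighted_sq \<sigma> g \<le> ennreal (\<gamma>\<^sup>2)" for g :: "'d phase \<Rightarrow> real^'d"
  proof -
    have [measurable]: "g \<in> borel_measurable borel" using that(1) by (rule borel_measurable_continuous_onI)
    note w = weighted_L1[OF this \<sigma> that(2) \<open>\<gamma> \<ge> 0\<close>]
    show i: "integrable phase_measure (\<lambda>z. \<kappa> \<bullet> g z)" using w(1) by (intro integrable_inner_right)
    have "(\<integral>z. \<bar>\<kappa> \<bullet> g z\<bar> \<partial>phase_measure) \<le> (\<integral>z. norm \<kappa> * norm (g z) \<partial>phase_measure)"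
      using w(1) i by (intro integral_mono) (auto simp: Cauchy_Schwarz_ineq2)
    also have "\<dots> = norm \<kappa> * (\<integral>z. norm (g z) \<partial>phase_measure)" by simp
    also have "\<dots> \<le> norm \<kappa> * (sqrt (weight_const TYPE('d) \<sigma>) * \<gamma>)" by (intro mult_left_mono w(3)) auto
    finally show "(\<integral>z. \<bar>\<kappa> \<bullet> g z\<bar> \<partial>phase_measure) \<le> B" by (simp add: B_def mult_ac)
  qed
  have dir: "\<bar>?\<omega> \<bullet> b\<bar> ^ p * E \<le> B" if b: "b \<in> pure_dirs" for b
  proof -
    let ?F = "\<lambda>j z. \<kappa> \<bullet> (partial b ^^ j) f z"
    have reg: "continuous_on UNIV ((partial b ^^ j) f)" "weighted_sq \<sigma> ((partial b ^^ j) f) \<le> ennreal (\<gamma>\<^sup>2)" if "j \<le> p" for j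
      using f b that unfolding regular_slice_def by blast+
    have "\<bar>?\<omega> \<bullet> b\<bar> ^ p * cmod (\<integral>z. wave ?\<omega> z * of_real (?F 0 z) \<partial>phase_measure) \<le> (\<integral>z. \<bar>?F p z\<bar> \<partial>phase_measure)"
    proof (rule wave_coef_decay[OF refl])
      have "xperiodic f" using f by (simp add: regular_slice_def)
      then have "xperiodic ((partial b ^^ j) f)" for j by (rule xperiodic_partial_iterate)
      then show "xperiodic (?F j)" for j by (simp add: xperiodic_def periodic_def)
      show "integrable phase_measure (?F j)" if "j \<le> p" for j using L1(2) reg[OF that] by blast
      show "continuous_on UNIV (?F j)" if "j \<le> p" for j using reg[OF that] by (intro continuous_intros)
      fix j z h assume "j < p"
      then have "((\<lambda>h. (partial b ^^ j) f (z + h *\<^sub>R b)) has_vector_derivative (partial b ^^ Suc j) f (z + h *\<^sub>R b)) (at h)"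
        using f b unfolding regular_slice_def by blast
      then show "((\<lambda>h. ?F j (z + h *\<^sub>R b)) has_vector_derivative ?F (Suc j) (z + h *\<^sub>R b)) (at h)"
        by (rule bounded_linear.has_vector_derivative[OF bounded_linear_inner_right])
    qed
    also have "\<dots> \<le> B" using L1(1) reg[of p] by blast
    finally show ?thesis by (simp add: E_def)
  qed
  have one: "E \<le> B"
  proof -
    have "E \<le> (\<integral>z. cmod (wave ?\<omega> z * of_real (\<kappa> \<bullet> f z)) \<partial>phase_measure)"
      unfolding E_def by (rule integral_norm_bound)
    also have "\<dots> = (\<integral>z. \<bar>\<kappa> \<bullet> f z\<bar> \<partial>phase_measure)" by (simp add: norm_mult)
    also have "\<dots> \<le> B" using f by (intro L1 regular_slice_weighted regular_slice_continuous)
    finally show ?thesis .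
  qed
  \<comment> \<open>The maximum m of 1 and all frequency coordinates is attained, so one of the
    bounds above reads m^p E \<le> B. The 1 and the 2 d coordinates are each at most m, which is the
    origin of the constant 1 + 2 d.\<close>
  define V where "V = insert 1 ((\<lambda>b. \<bar>?\<omega> \<bullet> b\<bar>) ` pure_dirs)"
  have V: "finite V" "V \<noteq> {}" by (auto simp: V_def pure_dirs_def)
  define m where "m = Max V"
  have mb: "\<bar>?\<omega> \<bullet> b\<bar> \<le> m" if "b \<in> pure_dirs" for b
    using V that by (auto simp: m_def V_def)
  have m1: "1 \<le> m" using V by (auto simp: m_def V_def)
  have mE: "m ^ p * E \<le> B"
  proof -
    have "m \<in> V" unfolding m_def by (rule Max_in[OF V])
    then consider "m = 1" | b where "b \<in> pure_dirs" "m = \<bar>?\<omega> \<bullet> b\<bar>" unfolding V_def by blast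
    then show ?thesis using one dir by cases simp_all
  qed
  have "\<bar>freq l $ i\<bar> \<le> m" "\<bar>\<xi> $ i\<bar> \<le> m" for i
    using mb[of "(axis i 1, 0)"] mb[of "(0, axis i 1)"] by (auto simp: pure_dirs_def inner_axis)
  then have "l1 (freq l) \<le> (\<Sum>i\<in>(UNIV::'d set). m)" "l1 \<xi> \<le> (\<Sum>i\<in>(UNIV::'d set). m)"
    unfolding l1_def by (intro sum_mono; simp)+
  then have "1 + l1 (freq l) + l1 \<xi> \<le> (1 + 2 * real CARD('d)) * m"
    using m1 by (simp add: algebra_simps)
  then have "(1 + l1 (freq l) + l1 \<xi>) ^ p \<le> ((1 + 2 * real CARD('d)) * m) ^ p"
    by (intro power_mono) (auto simp: add_nonneg_nonneg)
  then have "(1 + l1 (freq l) + l1 \<xi>) ^ p * E \<le> ((1 + 2 * real CARD('d)) * m) ^ p * E"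
    by (intro mult_right_mono) (auto simp: E_def)
  also have "\<dots> = (1 + 2 * real CARD('d)) ^ p * (m ^ p * E)" by (simp add: power_mult_distrib)
  also have "\<dots> \<le> (1 + 2 * real CARD('d)) ^ p * B" by (intro mult_left_mono mE) auto
  finally show ?thesis by (simp add: E_def B_def mult_ac)
qed

definition C1_periodic :: "(real^'d::finite \<Rightarrow> real) \<Rightarrow> bool" where
  "C1_periodic h \<longleftrightarrow> periodic h \<and> continuous_on UNIV h \<and> continuous_on UNIV (grad h) \<and>
    (\<forall>i z r. ((\<lambda>r. h (z + r *\<^sub>R axis i 1)) has_vector_derivative grad h (z + r *\<^sub>R axis i 1) $ i) (at r))"

lemma periodic_grad: "periodic h \<Longrightarrow> periodic (grad h)"
proof -
  assume per: "periodic h"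
  have "partial b h (x + axis i (2 * pi)) = partial b h x" for b x i
  proof -
    have "h (x + axis i (2 * pi) + r *\<^sub>R b) = h (x + r *\<^sub>R b)" for r
      using per[unfolded periodic_def, rule_format, of "x + r *\<^sub>R b" i] by (simp add: add_ac)
    then show ?thesis by (simp add: partial_def)
  qed
  then show ?thesis by (simp add: periodic_def grad_def)
qed

lemma periodic_bounded:
  fixes f :: "real^'d::finite \<Rightarrow> 'b::real_normed_vector"
  assumes "periodic f" "continuous_on UNIV f"
  shows "\<exists>B. \<forall>x. norm (f x) \<le> B"
proof -
  have "compact (f ` cbox 0 (\<chi> i. 2 * pi))"
    by (intro compact_continuous_image compact_cbox continuous_on_subset[OF assms(2)]) auto
  then obtain B where B: "\<And>x. x \<in> cbox 0 (\<chi> i. 2 * pi) \<Longrightarrow> norm (f x) \<le> B"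
    using compact_imp_bounded bounded_iff by (metis image_eqI)
  have "norm (f x) \<le> B" for x
    using B[of "wrap x"] wrap_in_cell[of x] periodic_wrap[OF assms(1), of x]
    by (auto simp: cell_def mem_box_cart less_imp_le)
  then show ?thesis by blast
qed

lemma coef_grad:
  fixes h :: "real^'d::finite \<Rightarrow> real"
  assumes "C1_periodic h"
  shows "coef (\<lambda>x. grad h x $ i) k = \<i> * of_real (freq k $ i) * coef h k"
proof -
  have per: "periodic h" "periodic (grad h)" and cont: "continuous_on UNIV h" "continuous_on UNIV (grad h)"
    and deriv: "\<And>z r. ((\<lambda>r. h (z + r *\<^sub>R axis i 1)) has_vector_derivative grad h (z + r *\<^sub>R axis i 1) $ i) (at r)"
    using assms periodic_grad by (auto simp: C1_periodic_def)
  have ci: "continuous_on UNIV (\<lambda>x. grad h x $ i)" by (intro continuous_intros cont)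
  define f where "f x = of_real (h x) * cnj (mode k x)" for x
  define f' where "f' x = of_real (grad h x $ i) * cnj (mode k x) - \<i> * of_real (freq k $ i) * f x" for x
  have pf: "periodic f" "periodic f'"
    using per periodic_cnj_mode[of k] unfolding f_def f'_def periodic_def by auto
  have cf: "continuous_on UNIV f" "continuous_on UNIV f'"
    unfolding f_def f'_def by (intro continuous_intros continuous_mode cont ci continuous_on_cnj)+
  obtain B1 B2 where "\<And>x. norm (f x) \<le> B1" "\<And>x. norm (f' x) \<le> B2"
    using periodic_bounded pf cf by metis
  then have B: "norm (f x) \<le> max B1 B2" "norm (f' x) \<le> max B1 B2" for x by (simp_all add: le_max_iff_disj)
  have "(\<integral>x. f' x \<partial>torus) = 0"
  proof (rule integral_directional_derivative_torus[OF pf B cf, where b = "axis i 1"])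
    fix z r
    have w: "((\<lambda>r. cnj (mode k (z + r *\<^sub>R axis i 1))) has_vector_derivative (- \<i> * of_real (freq k $ i) * cnj (mode k (z + r *\<^sub>R axis i 1)))) (at r)"
    proof -
      have eq: "cnj (mode k (z + r *\<^sub>R axis i 1)) = exp (- (\<i> * of_real (freq k \<bullet> z)) - of_real r * (\<i> * of_real (freq k $ i)))" for r
        unfolding mode_def cis_cnj by (simp add: cis_conv_exp inner_add_right inner_axis algebra_simps)
      have lin: "((\<lambda>r. - (\<i> * of_real (freq k \<bullet> z)) - of_real r * (\<i> * of_real (freq k $ i))) has_vector_derivative (- \<i> * of_real (freq k $ i))) (at r)"
        unfolding scaleR_conv_of_real[symmetric] by (auto intro!: derivative_eq_intros)
      show ?thesis unfolding eq using field_vector_diff_chain_at[OF lin DERIV_exp] by (simp only: o_def)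
    qed
    have d: "((\<lambda>r. of_real (h (z + r *\<^sub>R axis i 1))) has_vector_derivative complex_of_real (grad h (z + r *\<^sub>R axis i 1) $ i)) (at r)"
      using has_vector_derivative_of_real[OF deriv[of z r, unfolded has_real_derivative_iff_has_vector_derivative[symmetric]]] .
    show "((\<lambda>r. f (z + r *\<^sub>R axis i 1)) has_vector_derivative f' (z + r *\<^sub>R axis i 1)) (at r)"
      using has_vector_derivative_mult[OF d w] unfolding f_def f'_def by (simp add: algebra_simps)
  qed
  moreover have [measurable]: "h \<in> borel_measurable borel" "(\<lambda>x. grad h x $ i) \<in> borel_measurable borel"
    using cont ci by (auto intro: borel_measurable_continuous_onI)
  have [measurable]: "f \<in> borel_measurable borel" using cf(1) by (rule borel_measurable_continuous_onI)
  have "integrable torus f"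
    using B(1) by (intro torus.integrable_const_bound[where B = "max B1 B2"]) auto
  moreover have "integrable torus (\<lambda>x. of_real (grad h x $ i) * cnj (mode k x))"
  proof -
    obtain B3 where "\<And>x. norm (grad h x) \<le> B3" using periodic_bounded[OF per(2) cont(2)] by blast
    then have "\<bar>grad h x $ i\<bar> \<le> B3" for x using component_le_norm_cart order_trans by blast
    then show ?thesis
      by (intro torus.integrable_const_bound[where B = B3]) (auto simp: norm_mult)
  qed
  ultimately show ?thesis
    unfolding f'_def by (simp add: Bochner_Integration.integral_diff coef_def f_def[symmetric])
qed

text \<open>The shift by c v turns spatial mode k into a velocity oscillation of frequency c k,
  while the conjugate mode n moves the spatial frequency of the field to n - k. The gradient
  contributes the vector \<i> k, contracted with the field.\<close>

lemma shifted_trig_sum: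
  fixes f :: "'d::finite phase \<Rightarrow> real^'d"
  assumes h: "C1_periodic h" and F: "finite F"
  shows "cnj (mode n (fst z)) * (\<Sum>i\<in>UNIV. trig_sum_of (coef (\<lambda>x. grad h x $ i)) F (fst z - c *\<^sub>R snd z) * of_real (f z $ i))
    = (\<Sum>k\<in>F. (\<i> * coef h k) * (wave (freq (n - k), c *\<^sub>R freq k) z * of_real (freq k \<bullet> f z)))"
proof -
  obtain x v where z: "z = (x, v)" by (cases z)
  have m: "cnj (mode n x) * mode k (x - c *\<^sub>R v) = wave (freq (n - k), c *\<^sub>R freq k) (x, v)" for k
  proof -
    have "mode k (x - c *\<^sub>R v) = mode k x * cis (- ((c *\<^sub>R freq k) \<bullet> v))"
      by (simp add: mode_def inner_diff_right cis_mult)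
    then show ?thesis by (simp add: wave_freq mode_diff mult_ac)
  qed
  have "cnj (mode n x) * (\<Sum>i\<in>UNIV. trig_sum_of (coef (\<lambda>x. grad h x $ i)) F (x - c *\<^sub>R v) * of_real (f z $ i))
      = (\<Sum>i\<in>UNIV. \<Sum>k\<in>F. (\<i> * coef h k) * ((cnj (mode n x) * mode k (x - c *\<^sub>R v)) * (of_real (freq k $ i) * of_real (f z $ i))))"
    unfolding trig_sum_of_def coef_grad[OF h] by (simp add: sum_distrib_left sum_distrib_right mult_ac)
  also have "\<dots> = (\<Sum>k\<in>F. \<Sum>i\<in>UNIV. (\<i> * coef h k) * ((cnj (mode n x) * mode k (x - c *\<^sub>R v)) * (of_real (freq k $ i) * of_real (f z $ i))))"
    by (rule sum.swap)
  also have "\<dots> = (\<Sum>k\<in>F. (\<i> * coef h k) * (wave (freq (n - k), c *\<^sub>R freq k) z * of_real (freq k \<bullet> f z)))"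
    unfolding m z by (simp add: inner_vec_def sum_distrib_left)
  finally show ?thesis by (simp add: z)
qed

text \<open>Replacing the gradient by its Fourier partial sums makes the coefficient an explicit finite sum
  over frequencies; the error tends to zero by the weighted Cauchy--Schwarz inequality.\<close>

lemma coefficient_bound:
  fixes f :: "'d::finite phase \<Rightarrow> real^'d"
  assumes h: "C1_periodic h" and f: "regular_slice p \<sigma> \<gamma> f" and \<sigma>: "\<sigma> > CARD('d) / 2"
    and \<gamma>: "\<gamma> \<ge> 0" and c: "c \<ge> 0"
  defines "A \<equiv> (1 + 2 * real CARD('d)) ^ p * sqrt (weight_const TYPE('d) \<sigma>) * \<gamma>"
  shows "ennreal (cmod (\<integral>z. cnj (mode n (fst z)) * of_real (grad h (fst z - c *\<^sub>R snd z) \<bullet> f z) \<partial>phase_measure))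
    \<le> (\<integral>\<^sup>+k. ennreal (A * (l1 (freq k) / (1 + l1 (freq (n - k)) + c * l1 (freq k)) ^ p) * cmod (coef h k)) \<partial>count_space UNIV)"
    (is "ennreal (cmod ?c) \<le> (\<integral>\<^sup>+k. ennreal (?b k) \<partial>_)")
proof -
  have A: "A \<ge> 0" using \<gamma> weight_const(2)[OF \<sigma>] by (simp add: A_def)
  have cont: "continuous_on UNIV (grad h)" "continuous_on UNIV f" and per: "periodic (grad h)"
    using h f periodic_grad by (auto simp: C1_periodic_def regular_slice_def)
  have [measurable]: "grad h \<in> borel_measurable borel" "f \<in> borel_measurable borel"
    using cont by (auto intro: borel_measurable_continuous_onI)
  note fw = regular_slice_weighted[OF f]
  note fint = weighted_L1(1)[OF \<open>f \<in> _\<close> \<sigma> fw \<gamma>]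
  obtain B where B: "\<And>x. norm (grad h x) \<le> B" using periodic_bounded[OF per cont(1)] by blast
  have B0: "B \<ge> 0" using B[of 0] norm_ge_zero order_trans by blast
  define D where "D i N = trig_sum_of (coef (\<lambda>x. grad h x $ i)) (freq_box N)" for i N
  have [measurable]: "D i N \<in> borel_measurable borel" for i N by (simp add: D_def)
  define r where "r i N x = cmod (of_real (grad h x $ i) - D i N x)" for i N x
  have [measurable]: "r i N \<in> borel_measurable borel" for i N unfolding r_def by measurable
  define cN where "cN N = (\<integral>z. cnj (mode n (fst z)) * (\<Sum>i\<in>UNIV. D i N (fst z - c *\<^sub>R snd z) * of_real (f z $ i)) \<partial>phase_measure)" for N
  define E where "E k = (\<integral>z. wave (freq (n - k), c *\<^sub>R freq k) z * of_real (freq k \<bullet> f z) \<partial>phase_measure)" for k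
  have Eint: "integrable phase_measure (\<lambda>z. wave (freq (n - k), c *\<^sub>R freq k) z * of_real (freq k \<bullet> f z))" for k
    by (intro integrable_wave_mult integrable_inner_right fint)
  have Nint: "integrable phase_measure (\<lambda>z. cnj (mode n (fst z)) * (\<Sum>i\<in>UNIV. D i N (fst z - c *\<^sub>R snd z) * of_real (f z $ i)))" for N
    unfolding D_def shifted_trig_sum[OF h finite_freq_box]
    by (intro Bochner_Integration.integrable_sum integrable_mult_right Eint)
  have cN: "cN N = (\<Sum>k\<in>freq_box N. \<i> * coef h k * E k)" for N
    unfolding cN_def E_def D_def shifted_trig_sum[OF h finite_freq_box]
    by (subst Bochner_Integration.integral_sum) (intro integrable_mult_right Eint, simp)
  \<comment> \<open>The decay estimate with spatial frequency n - k, velocity frequency c k and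
    vector \<kappa> = k: the last one supplies the numerator |k|, the first two the
    denominator.\<close>
  have Eb: "cmod (E k) \<le> A * (l1 (freq k) / (1 + l1 (freq (n - k)) + c * l1 (freq k)) ^ p)" for k
  proof -
    let ?q = "1 + l1 (freq (n - k)) + c * l1 (freq k)"
    have q: "?q > 0" using c by (simp add: add_pos_nonneg)
    have "?q ^ p * cmod (E k) \<le> A * norm (freq k)"
      using slice_wave_coef_bound[OF f \<sigma> \<gamma>, of "n - k" "c *\<^sub>R freq k" "freq k"] c
      by (simp add: E_def A_def l1_scaleR)
    also have "\<dots> \<le> A * l1 (freq k)" using A norm_le_l1 by (intro mult_left_mono)
    finally show ?thesis using q by (simp add: field_simps)
  qed
  have cN_le: "ennreal (cmod (cN N)) \<le> (\<integral>\<^sup>+k. ennreal (?b k) \<partial>count_space UNIV)" for N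
  proof -
    have "cmod (cN N) \<le> (\<Sum>k\<in>freq_box N. cmod (E k) * cmod (coef h k))"
      unfolding cN by (rule order_trans[OF norm_sum]) (simp add: norm_mult mult_ac)
    also have "\<dots> \<le> (\<Sum>k\<in>freq_box N. ?b k)" by (intro sum_mono mult_right_mono Eb) auto
    finally have "ennreal (cmod (cN N)) \<le> ennreal (\<Sum>k\<in>freq_box N. ?b k)" by (rule ennreal_leI)
    also have "\<dots> = (\<Sum>k\<in>freq_box N. ennreal (?b k))"
      using A c by (intro sum_ennreal[symmetric]) (auto intro!: mult_nonneg_nonneg divide_nonneg_nonneg)
    also have "\<dots> \<le> (\<integral>\<^sup>+k. ennreal (?b k) \<partial>count_space UNIV)"
      unfolding nn_integral_lattice_SUP by (rule SUP_upper) simp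
    finally show ?thesis .
  qed
  define R where "R i N = (\<integral>x. (r i N x)\<^sup>2 \<partial>torus)" for i N
  have sq: "integrable torus (\<lambda>x. (grad h x $ i)\<^sup>2)" for i
  proof (rule torus.integrable_const_bound[where B = "B\<^sup>2"])
    have "\<bar>grad h x $ i\<bar> \<le> B" for x using component_le_norm_cart[of "grad h x" i] B[of x] by linarith
    then have "(grad h x $ i)\<^sup>2 \<le> B\<^sup>2" for x using B0 by (simp add: power2_le_iff_abs_le)
    then show "AE x in torus. norm ((grad h x $ i)\<^sup>2) \<le> B\<^sup>2" by simp
  qed simp
  have gm: "(\<lambda>x. grad h x $ i) \<in> borel_measurable borel" for i by measurable
  have R0: "R i \<longlonglongrightarrow> 0" for i
    using fourier_sums_converge[OF gm sq] by (simp add: R_def[abs_def] r_def D_def)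
  have rint: "integrable torus (\<lambda>x. (r i N x)\<^sup>2)" for i N
    unfolding r_def D_def by (rule integral_sq_diff_trig_sum(1)[OF gm sq]) simp
  have rper: "periodic (r i N)" for i N
    using per unfolding periodic_def r_def D_def trig_sum_of_def
    by (simp add: periodic_mode[unfolded periodic_def, rule_format])
  define X where "X i N = (\<integral>\<^sup>+z. ennreal (\<bar>r i N (fst z - c *\<^sub>R snd z)\<bar> * norm (f z)) \<partial>phase_measure)" for i N
  \<comment> \<open>Weighted Cauchy--Schwarz with the i-th Fourier remainder of the gradient as
    \<open>w\<close>. The bound holds for the shifted remainder, although Fourier sums converge only
    in mean square and not uniformly.\<close>
  have X: "X i N \<le> ennreal (sqrt (weight_const TYPE('d) \<sigma> * R i N) * \<gamma>)" for i N
  proof (rule ennreal_power2_le_cancel)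
    have "(X i N)\<^sup>2 \<le> ennreal (weight_const TYPE('d) \<sigma>) * (\<integral>\<^sup>+x. ennreal ((r i N x)\<^sup>2) \<partial>torus) * weighted_sq \<sigma> f"
      unfolding X_def by (rule weighted_Cauchy_Schwarz[OF _ _ rper \<sigma>]) auto
    also have "(\<integral>\<^sup>+x. ennreal ((r i N x)\<^sup>2) \<partial>torus) = ennreal (R i N)"
      unfolding R_def by (rule nn_integral_eq_integral[OF rint]) simp
    also have "ennreal (weight_const TYPE('d) \<sigma>) * ennreal (R i N) * weighted_sq \<sigma> f
        \<le> ennreal (weight_const TYPE('d) \<sigma>) * ennreal (R i N) * ennreal (\<gamma>\<^sup>2)"
      by (intro mult_left_mono fw) auto
    also have "\<dots> = (ennreal (sqrt (weight_const TYPE('d) \<sigma> * R i N) * \<gamma>))\<^sup>2"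
    proof -
      have "R i N \<ge> 0" by (simp add: R_def)
      then show ?thesis using weight_const(2)[OF \<sigma>] \<gamma>
        by (simp add: ennreal_power power_mult_distrib ennreal_mult[symmetric])
    qed
    finally show "(X i N)\<^sup>2 \<le> (ennreal (sqrt (weight_const TYPE('d) \<sigma> * R i N) * \<gamma>))\<^sup>2" .
  qed
  have cint: "integrable phase_measure (\<lambda>z. cnj (mode n (fst z)) * of_real (grad h (fst z - c *\<^sub>R snd z) \<bullet> f z))"
  proof (rule Bochner_Integration.integrable_bound)
    show "integrable phase_measure (\<lambda>z. B * norm (f z))" using fint by simp
    have "(\<lambda>z::'d phase. grad h (fst z - c *\<^sub>R snd z)) \<in> borel_measurable borel"
      by (rule measurable_compose[of _ _ borel]) auto
    moreover have "(\<lambda>z::'d phase. mode n (fst z)) \<in> borel_measurable borel"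
      by (rule measurable_compose[OF borel_measurable_fst]) simp
    ultimately show "(\<lambda>z. cnj (mode n (fst z)) * of_real (grad h (fst z - c *\<^sub>R snd z) \<bullet> f z)) \<in> borel_measurable phase_measure"
      by simp
    show "AE z in phase_measure. norm (cnj (mode n (fst z)) * of_real (grad h (fst z - c *\<^sub>R snd z) \<bullet> f z)) \<le> norm (B * norm (f z))"
    proof (rule AE_I2)
      fix z :: "'d phase"
      have "\<bar>grad h (fst z - c *\<^sub>R snd z) \<bullet> f z\<bar> \<le> norm (grad h (fst z - c *\<^sub>R snd z)) * norm (f z)"
        by (rule Cauchy_Schwarz_ineq2)
      also have "\<dots> \<le> B * norm (f z)" by (intro mult_right_mono B) auto
      finally show "norm (cnj (mode n (fst z)) * of_real (grad h (fst z - c *\<^sub>R snd z) \<bullet> f z)) \<le> norm (B * norm (f z))"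
        using B0 by (simp add: norm_mult)
    qed
  qed
  have diff: "cmod (?c - cN N) \<le> (\<Sum>i\<in>UNIV. sqrt (weight_const TYPE('d) \<sigma> * R i N) * \<gamma>)" for N
  proof -
    let ?g = "\<lambda>z. cnj (mode n (fst z)) * of_real (grad h (fst z - c *\<^sub>R snd z) \<bullet> f z)
        - cnj (mode n (fst z)) * (\<Sum>i\<in>UNIV. D i N (fst z - c *\<^sub>R snd z) * of_real (f z $ i))"
    have "?c - cN N = (\<integral>z. ?g z \<partial>phase_measure)"
      unfolding cN_def by (rule Bochner_Integration.integral_diff[OF cint Nint, symmetric])
    then have "ennreal (cmod (?c - cN N)) \<le> (\<integral>\<^sup>+z. ennreal (norm (?g z)) \<partial>phase_measure)"
      using integral_norm_bound_ennreal[OF Bochner_Integration.integrable_diff[OF cint Nint]] by simp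
    also have "\<dots> \<le> (\<integral>\<^sup>+z. (\<Sum>i\<in>UNIV. ennreal (\<bar>r i N (fst z - c *\<^sub>R snd z)\<bar> * norm (f z))) \<partial>phase_measure)"
    proof (rule nn_integral_mono)
      fix z :: "'d phase"
      have "?g z = cnj (mode n (fst z)) * (\<Sum>i\<in>UNIV. (of_real (grad h (fst z - c *\<^sub>R snd z) $ i) - D i N (fst z - c *\<^sub>R snd z)) * of_real (f z $ i))"
        by (simp add: inner_vec_def left_diff_distrib sum_subtractf right_diff_distrib)
      then have "norm (?g z) = cmod (\<Sum>i\<in>UNIV. (of_real (grad h (fst z - c *\<^sub>R snd z) $ i) - D i N (fst z - c *\<^sub>R snd z)) * of_real (f z $ i))"
        by (simp add: norm_mult)
      also have "\<dots> \<le> (\<Sum>i\<in>UNIV. \<bar>r i N (fst z - c *\<^sub>R snd z)\<bar> * norm (f z))"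
        by (rule order_trans[OF norm_sum])
          (auto simp: norm_mult r_def intro!: sum_mono mult_left_mono component_le_norm_cart)
      finally show "ennreal (norm (?g z)) \<le> (\<Sum>i\<in>UNIV. ennreal (\<bar>r i N (fst z - c *\<^sub>R snd z)\<bar> * norm (f z)))"
        by (subst sum_ennreal) (auto intro: ennreal_leI)
    qed
    also have "\<dots> = (\<Sum>i\<in>UNIV. X i N)"
    proof -
      have "(\<lambda>z::'d phase. r i N (fst z - c *\<^sub>R snd z)) \<in> borel_measurable borel" for i
        by (rule measurable_compose[of _ _ borel]) auto
      then show ?thesis unfolding X_def by (subst nn_integral_sum) auto
    qed
    also have "\<dots> \<le> (\<Sum>i\<in>UNIV. ennreal (sqrt (weight_const TYPE('d) \<sigma> * R i N) * \<gamma>))" by (intro sum_mono X)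
    also have "\<dots> = ennreal (\<Sum>i\<in>UNIV. sqrt (weight_const TYPE('d) \<sigma> * R i N) * \<gamma>)"
      using \<gamma> weight_const(2)[OF \<sigma>] by (intro sum_ennreal) (auto simp: R_def)
    finally show ?thesis
      using \<gamma> weight_const(2)[OF \<sigma>] by (subst (asm) ennreal_le_iff) (auto simp: R_def intro!: sum_nonneg)
  qed
  have "(\<lambda>N. \<Sum>i\<in>UNIV. sqrt (weight_const TYPE('d) \<sigma> * R i N) * \<gamma>) \<longlonglongrightarrow> (\<Sum>i\<in>(UNIV::'d set). sqrt (weight_const TYPE('d) \<sigma> * 0) * \<gamma>)"
    by (intro tendsto_intros R0)
  then have "(\<lambda>N. \<Sum>i\<in>UNIV. sqrt (weight_const TYPE('d) \<sigma> * R i N) * \<gamma>) \<longlonglongrightarrow> 0" by simp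
  then have "(\<lambda>N. ?c - cN N) \<longlonglongrightarrow> 0"
    by (rule Lim_null_comparison[rotated]) (simp add: diff)
  then have "(\<lambda>N. ?c - (?c - cN N)) \<longlonglongrightarrow> ?c - 0" by (intro tendsto_intros)
  then have "(\<lambda>N. ennreal (cmod (cN N))) \<longlonglongrightarrow> ennreal (cmod ?c)"
    by (intro tendsto_ennrealI tendsto_norm) simp
  then show ?thesis by (rule LIMSEQ_le_const2) (use cN_le in auto)
qed

section \<open>Schur's test\<close>

definition kernel :: "nat \<Rightarrow> int^'d::finite \<Rightarrow> int^'d \<Rightarrow> real \<Rightarrow> real" where
  "kernel p n k \<tau> = l1 (freq k) / (1 + l1 (freq (n - k)) + \<tau> * l1 (freq k)) ^ p"

lemma kernel_nonneg: "\<tau> \<ge> 0 \<Longrightarrow> 0 \<le> kernel p n k \<tau>"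
  by (simp add: kernel_def)

text \<open>The point where both operators merge: a displacement of at least \<tau> has a kernel no
  larger than that of free transport at \<tau>.\<close>

lemma kernel_antimono:
  assumes "0 \<le> \<tau>" "\<tau> \<le> \<tau>'"
  shows "kernel p n k \<tau>' \<le> kernel p n k \<tau>"
proof -
  have "0 < 1 + l1 (freq (n - k)) + \<tau> * l1 (freq k)"
    using assms by (simp add: add_pos_nonneg)
  moreover have "\<tau> * l1 (freq k) \<le> \<tau>' * l1 (freq k)" using assms by (intro mult_right_mono) auto
  ultimately show ?thesis
    unfolding kernel_def by (intro divide_left_mono power_mono mult_pos_pos zero_less_power) auto
qed

lemma kernel_measurable [measurable]: "kernel p n k \<in> borel_measurable borel"
  unfolding kernel_def by measurable

text \<open>The numerator |k| is the derivative of the base of the power, so the integral is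
  explicit and its bound is free of |k|; for k = 0 the kernel vanishes. The loss of one power is the
  reason for p - 1.\<close>

lemma kernel_time_integral:
  assumes "p \<ge> 2"
  shows "(\<integral>\<^sup>+\<tau>. ennreal (kernel p n k \<tau>) * indicator {0..} \<tau> \<partial>lborel)
    \<le> ennreal ((1 + l1 (freq (n - k))) powr (- real (p - 1)))"
proof (cases "l1 (freq k) = 0")
  case True
  then show ?thesis by (simp add: kernel_def)
next
  case False
  define a where "a = l1 (freq k)"
  define b where "b = 1 + l1 (freq (n - k))"
  define q where "q = p - 1"
  have ab: "a > 0" "b \<ge> 1" "q \<ge> 1" and p: "p = Suc q"
    using False l1_nonneg[of "freq k"] l1_nonneg[of "freq (n - k)"] assms unfolding a_def b_def q_def
    by (auto simp del: l1_nonneg)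
  \<comment> \<open>A primitive vanishing at infinity; the factor 1/q in its value at 0 is later
    estimated by 1, as q = p - 1 \<ge> 1.\<close>
  define F where "F \<tau> = - (1 / (real q * (b + \<tau> * a) ^ q))" for \<tau>
  have "(\<integral>\<^sup>+\<tau>. ennreal (kernel p n k \<tau>) * indicator {0..} \<tau> \<partial>lborel) = ennreal (0 - F 0)"
  proof (rule nn_integral_FTC_atLeast)
    fix \<tau> :: real assume "0 \<le> \<tau>"
    then have pos: "b + \<tau> * a > 0" using ab by (simp add: add_pos_nonneg)
    have "(F has_real_derivative (real q * (b + \<tau> * a) ^ (q - 1) * a * real q) / (real q * (b + \<tau> * a) ^ q)\<^sup>2) (at \<tau>)"
      unfolding F_def using pos ab
      by (auto intro!: derivative_eq_intros simp: power2_eq_square field_simps)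
    moreover have "(real q * (b + \<tau> * a) ^ (q - 1) * a * real q) / (real q * (b + \<tau> * a) ^ q)\<^sup>2 = kernel p n k \<tau>"
    proof -
      have "(b + \<tau> * a) ^ (q - 1) * (b + \<tau> * a) ^ p = ((b + \<tau> * a) ^ q)\<^sup>2"
      proof -
        obtain q' where "q = Suc q'" using ab(3) by (cases q) auto
        then show ?thesis by (simp add: p power2_eq_square mult_ac)
      qed
      then show ?thesis using pos ab
        by (simp add: kernel_def a_def[symmetric] b_def[symmetric] divide_simps power_mult_distrib power2_eq_square[of "real q"])
    qed
    ultimately show "(F has_real_derivative kernel p n k \<tau>) (at \<tau>)" by simp
    show "0 \<le> kernel p n k \<tau>" using \<open>0 \<le> \<tau>\<close> by (rule kernel_nonneg)
  next
    have "filterlim (\<lambda>\<tau>. b + \<tau> * a) at_top at_top"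
      using ab by (intro filterlim_tendsto_add_at_top[OF tendsto_const] filterlim_at_top_mult_tendsto_pos[OF tendsto_const _ filterlim_ident]) auto
    then have "filterlim (\<lambda>\<tau>. real q * (b + \<tau> * a) ^ q) at_top at_top"
      using ab by (intro filterlim_tendsto_pos_mult_at_top[OF tendsto_const] filterlim_pow_at_top) auto
    then have "((\<lambda>\<tau>. 1 / (real q * (b + \<tau> * a) ^ q)) \<longlongrightarrow> 0) at_top"
      by (intro tendsto_divide_0[OF tendsto_const] filterlim_at_top_imp_at_infinity)
    then show "(F \<longlongrightarrow> 0) at_top" unfolding F_def using tendsto_minus by fastforce
  qed simp
  also have "0 - F 0 \<le> 1 / b ^ q"
    using ab by (simp add: F_def frac_le)
  also have "1 / b ^ q = b powr (- real q)"
    using ab by (simp add: powr_minus powr_realpow divide_inverse)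
  finally show ?thesis by (simp add: b_def q_def ennreal_leI)
qed

definition lattice_const :: "'d::finite itself \<Rightarrow> nat \<Rightarrow> ennreal" where
  "lattice_const _ p = (\<integral>\<^sup>+m. ennreal ((1 + l1 (freq (m :: int^'d))) powr (- real (p - 1))) \<partial>count_space UNIV)"

lemma lattice_const_finite:
  assumes "p > 1 + CARD('d::finite)" shows "lattice_const TYPE('d) p < \<infinity>"
  unfolding lattice_const_def using assms by (intro lattice_sum_finite) simp

text \<open>After integration in time the bound depends on n - k only. Reflection and translation of
  the lattice therefore give the same value for the sum over k and the sum over n.\<close>

lemma kernel_sums:
  fixes n k :: "int^'d::finite"
  assumes "p \<ge> 2"
  shows "(\<integral>\<^sup>+k. (\<integral>\<^sup>+\<tau>. ennreal (kernel p n k \<tau>) * indicator {0..} \<tau> \<partial>lborel) \<partial>count_space UNIV) \<le> lattice_const TYPE('d) p"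
    and "(\<integral>\<^sup>+n. (\<integral>\<^sup>+\<tau>. ennreal (kernel p n k \<tau>) * indicator {0..} \<tau> \<partial>lborel) \<partial>count_space UNIV) \<le> lattice_const TYPE('d) p"
proof -
  have "(\<integral>\<^sup>+k. (\<integral>\<^sup>+\<tau>. ennreal (kernel p n k \<tau>) * indicator {0..} \<tau> \<partial>lborel) \<partial>count_space UNIV)
     \<le> (\<integral>\<^sup>+k. ennreal ((1 + l1 (freq (n - k))) powr (- real (p - 1))) \<partial>count_space UNIV)"
    by (intro nn_integral_mono kernel_time_integral assms)
  also have "\<dots> = lattice_const TYPE('d) p"
    unfolding lattice_const_def
    by (rule nn_integral_bij_count_space) (rule bij_betw_byWitness[where f' = "\<lambda>m. n - m"]; auto)
  finally show "(\<integral>\<^sup>+k. (\<integral>\<^sup>+\<tau>. ennreal (kernel p n k \<tau>) * indicator {0..} \<tau> \<partial>lborel) \<partial>count_space UNIV) \<le> lattice_const TYPE('d) p" .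
  have "(\<integral>\<^sup>+n. (\<integral>\<^sup>+\<tau>. ennreal (kernel p n k \<tau>) * indicator {0..} \<tau> \<partial>lborel) \<partial>count_space UNIV)
     \<le> (\<integral>\<^sup>+n. ennreal ((1 + l1 (freq (n - k))) powr (- real (p - 1))) \<partial>count_space UNIV)"
    by (intro nn_integral_mono kernel_time_integral assms)
  also have "\<dots> = lattice_const TYPE('d) p"
    unfolding lattice_const_def
    by (rule nn_integral_bij_count_space) (rule bij_betw_byWitness[where f' = "\<lambda>m. m + k"]; auto)
  finally show "(\<integral>\<^sup>+n. (\<integral>\<^sup>+\<tau>. ennreal (kernel p n k \<tau>) * indicator {0..} \<tau> \<partial>lborel) \<partial>count_space UNIV) \<le> lattice_const TYPE('d) p" .
qed

text \<open>The kernel is split into two square roots. Cauchy--Schwarz in (s, k) leaves the integral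
  of the kernel over (s, k), a first factor \<open>lattice_const\<close>; exchanging the order and
  integrating the kernel over (t, n) yields the second one.\<close>

lemma schur_test:
  fixes a :: "real \<Rightarrow> int^'d::finite \<Rightarrow> real"
  assumes p: "p \<ge> 2" and [measurable]: "\<And>k. (\<lambda>s. a s k) \<in> borel_measurable borel"
    and a0: "\<And>s k. 0 \<le> a s k"
  shows "(\<integral>\<^sup>+t\<in>{0..T}. (\<integral>\<^sup>+n. (\<integral>\<^sup>+s\<in>{0..t}. (\<integral>\<^sup>+k. ennreal (kernel p n k (t - s) * a s k) \<partial>count_space UNIV) \<partial>lborel)\<^sup>2 \<partial>count_space UNIV) \<partial>lborel)
    \<le> (lattice_const TYPE('d) p)\<^sup>2 * (\<integral>\<^sup>+s\<in>{0..T}. (\<integral>\<^sup>+k. ennreal ((a s k)\<^sup>2) \<partial>count_space UNIV) \<partial>lborel)"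
proof -
  let ?C = "count_space (UNIV :: (int^'d) set)"
  let ?L = "lattice_const TYPE('d) p"
  have sw: "(\<integral>\<^sup>+k. (\<integral>\<^sup>+x. f k x \<partial>lborel) \<partial>?C) = (\<integral>\<^sup>+x. (\<integral>\<^sup>+k. f k x \<partial>?C) \<partial>lborel)"
    if "\<And>k. f k \<in> borel_measurable lborel" for f :: "int^'d \<Rightarrow> real \<Rightarrow> ennreal"
    by (rule nn_integral_count_space_nn_integral[symmetric]) (use that in auto)
  interpret C: sigma_finite_measure ?C
    by (rule sigma_finite_measure_count_space_countable) auto
  interpret P: pair_sigma_finite "lborel :: real measure" ?C by unfold_locales
  have joint: "(\<lambda>z. f (snd z) (fst z)) \<in> borel_measurable (lborel \<Otimes>\<^sub>M ?C)"
    if "\<And>k. f k \<in> borel_measurable borel" for f :: "int^'d \<Rightarrow> real \<Rightarrow> ennreal"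
    by (rule measurable_compose_countable[where f = "\<lambda>k z. f k (fst z)" and g = snd])
      (use that in auto)
  \<comment> \<open>The kernel with the cutoffs 0 \<le> s \<le> t built in as indicators, so that
    all integrals run over the full line and can be exchanged freely.\<close>
  define W where "W n k t s = ennreal (kernel p n k (t - s)) * (indicator {0..} (t - s) * indicator {0..} s)" for n k :: "int^'d" and t s :: real
  have W[measurable]: "W n k t \<in> borel_measurable borel" "(\<lambda>t. W n k t s) \<in> borel_measurable borel" for n k t s
    unfolding W_def by measurable
  have CS: "(\<integral>\<^sup>+s\<in>{0..t}. (\<integral>\<^sup>+k. ennreal (kernel p n k (t - s) * a s k) \<partial>?C) \<partial>lborel)\<^sup>2
      \<le> ?L * (\<integral>\<^sup>+s. (\<integral>\<^sup>+k. W n k t s * ennreal ((a s k)\<^sup>2) \<partial>?C) \<partial>lborel)" for n t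
  proof -
    let ?f = "\<lambda>k s. ennreal (sqrt (kernel p n k (t - s))) * indicator {0..t} s"
    let ?g = "\<lambda>k s. ennreal (sqrt (kernel p n k (t - s)) * a s k) * indicator {0..t} s"
    have pw: "ennreal (kernel p n k (t - s) * a s k) * indicator {0..t} s = ?f k s * ?g k s"
      "(?f k s)\<^sup>2 = W n k t s" "(?g k s)\<^sup>2 = W n k t s * ennreal ((a s k)\<^sup>2)" for k s
      using a0[of s k] kernel_nonneg[of "t - s" p n k]
      by (auto simp: indicator_def W_def ennreal_power power_mult_distrib ennreal_mult[symmetric] mult.assoc[symmetric])
    have "(\<integral>\<^sup>+s\<in>{0..t}. (\<integral>\<^sup>+k. ennreal (kernel p n k (t - s) * a s k) \<partial>?C) \<partial>lborel)
        = (\<integral>\<^sup>+s. (\<integral>\<^sup>+k. ?f k s * ?g k s \<partial>?C) \<partial>lborel)"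
      by (intro nn_integral_cong) (simp add: nn_integral_multc[symmetric] pw(1))
    also have "\<dots> = (\<integral>\<^sup>+z. ?f (snd z) (fst z) * ?g (snd z) (fst z) \<partial>(lborel \<Otimes>\<^sub>M ?C))"
      using joint[of "\<lambda>k s. ?f k s * ?g k s"] by (subst C.nn_integral_fst[symmetric]) auto
    finally have e: "(\<integral>\<^sup>+s\<in>{0..t}. (\<integral>\<^sup>+k. ennreal (kernel p n k (t - s) * a s k) \<partial>?C) \<partial>lborel)
        = (\<integral>\<^sup>+z. ?f (snd z) (fst z) * ?g (snd z) (fst z) \<partial>(lborel \<Otimes>\<^sub>M ?C))" .
    have cs: "(\<integral>\<^sup>+z. ?f (snd z) (fst z) * ?g (snd z) (fst z) \<partial>(lborel \<Otimes>\<^sub>M ?C))\<^sup>2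
      \<le> (\<integral>\<^sup>+z. (?f (snd z) (fst z))\<^sup>2 \<partial>(lborel \<Otimes>\<^sub>M ?C)) * (\<integral>\<^sup>+z. (?g (snd z) (fst z))\<^sup>2 \<partial>(lborel \<Otimes>\<^sub>M ?C))"
      by (intro Cauchy_Schwarz_nn_integral joint[of ?f] joint[of ?g]) measurable
    have g: "(\<integral>\<^sup>+z. (?g (snd z) (fst z))\<^sup>2 \<partial>(lborel \<Otimes>\<^sub>M ?C)) = (\<integral>\<^sup>+s. (\<integral>\<^sup>+k. W n k t s * ennreal ((a s k)\<^sup>2) \<partial>?C) \<partial>lborel)"
      unfolding pw using joint[of "\<lambda>k s. W n k t s * ennreal ((a s k)\<^sup>2)"] by (subst C.nn_integral_fst[symmetric]) auto
    have "(\<integral>\<^sup>+z. (?f (snd z) (fst z))\<^sup>2 \<partial>(lborel \<Otimes>\<^sub>M ?C)) = (\<integral>\<^sup>+s. (\<integral>\<^sup>+k. W n k t s \<partial>?C) \<partial>lborel)"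
      unfolding pw using joint[of "\<lambda>k s. W n k t s"] by (subst C.nn_integral_fst[symmetric]) auto
    also have "\<dots> = (\<integral>\<^sup>+k. (\<integral>\<^sup>+s. W n k t s \<partial>lborel) \<partial>?C)" by (rule sw[symmetric]) simp
    also have "\<dots> \<le> (\<integral>\<^sup>+k. (\<integral>\<^sup>+\<tau>. ennreal (kernel p n k \<tau>) * indicator {0..} \<tau> \<partial>lborel) \<partial>?C)"
    proof (rule nn_integral_mono)
      fix k
      have "(\<integral>\<^sup>+s. W n k t s \<partial>lborel) = (\<integral>\<^sup>+\<tau>. W n k t (t - \<tau>) \<partial>lborel)"
        by (subst nn_integral_real_affine[where c = "-1" and t = t]) auto
      also have "\<dots> \<le> (\<integral>\<^sup>+\<tau>. ennreal (kernel p n k \<tau>) * indicator {0..} \<tau> \<partial>lborel)"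
        by (intro nn_integral_mono) (auto simp: W_def indicator_def)
      finally show "(\<integral>\<^sup>+s. W n k t s \<partial>lborel) \<le> (\<integral>\<^sup>+\<tau>. ennreal (kernel p n k \<tau>) * indicator {0..} \<tau> \<partial>lborel)" .
    qed
    also have "\<dots> \<le> ?L" by (rule kernel_sums(1)[OF p])
    finally have f: "(\<integral>\<^sup>+z. (?f (snd z) (fst z))\<^sup>2 \<partial>(lborel \<Otimes>\<^sub>M ?C)) \<le> ?L" .
    show ?thesis unfolding e using cs f unfolding g by (meson mult_right_mono order_trans zero_le)
  qed
  have cm: "(\<lambda>s. \<integral>\<^sup>+k. f k s \<partial>?C) \<in> borel_measurable borel"
    if "\<And>k. f k \<in> borel_measurable borel" for f :: "int^'d \<Rightarrow> real \<Rightarrow> ennreal"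
    using C.borel_measurable_nn_integral_fst[OF joint[OF that]] by simp
  \<comment> \<open>The complete nonnegative integrand in (t, s) for given n and k. What follows
    moves the integrations over t and n to the innermost places, one exchange at a time.\<close>
  define J where "J n k z = ?L * (W n k (fst z) (snd z) * ennreal ((a (snd z) k)\<^sup>2) * indicator {0..T} (fst z))"
    for n k :: "int^'d" and z :: "real \<times> real"
  have J [measurable]: "J n k \<in> borel_measurable (lborel \<Otimes>\<^sub>M lborel)" for n k
    unfolding J_def W_def by measurable
  have Jt: "(\<lambda>t. \<integral>\<^sup>+s. J n k (t, s) \<partial>lborel) \<in> borel_measurable borel" for n k
    using lborel.borel_measurable_nn_integral_fst[OF J] by simp
  have Js: "(\<lambda>s. \<integral>\<^sup>+t. J n k (t, s) \<partial>lborel) \<in> borel_measurable borel" for n k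
    using lborel.borel_measurable_nn_integral_fst[OF measurable_pair_swap[OF J]] by simp
  have J1: "(\<lambda>s. J n k (t, s)) \<in> borel_measurable borel" for n k t
    unfolding J_def W_def by measurable
  have "(\<integral>\<^sup>+t\<in>{0..T}. (\<integral>\<^sup>+n. (\<integral>\<^sup>+s\<in>{0..t}. (\<integral>\<^sup>+k. ennreal (kernel p n k (t - s) * a s k) \<partial>?C) \<partial>lborel)\<^sup>2 \<partial>?C) \<partial>lborel)
      \<le> (\<integral>\<^sup>+t. (\<integral>\<^sup>+n. ?L * (\<integral>\<^sup>+s. (\<integral>\<^sup>+k. W n k t s * ennreal ((a s k)\<^sup>2) \<partial>?C) \<partial>lborel) \<partial>?C) * indicator {0..T} t \<partial>lborel)"
    by (intro nn_integral_mono mult_right_mono CS) auto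
  also have "\<dots> = (\<integral>\<^sup>+t. (\<integral>\<^sup>+n. (\<integral>\<^sup>+s. (\<integral>\<^sup>+k. J n k (t, s) \<partial>?C) \<partial>lborel) \<partial>?C) \<partial>lborel)"
  proof (rule nn_integral_cong)
    fix t :: real
    have m: "(\<lambda>s. \<integral>\<^sup>+k. W n k t s * ennreal ((a s k)\<^sup>2) \<partial>?C) \<in> borel_measurable lborel" for n
      using cm[of "\<lambda>k s. W n k t s * ennreal ((a s k)\<^sup>2)"] by simp
    have "(\<integral>\<^sup>+s. (\<integral>\<^sup>+k. J n k (t, s) \<partial>?C) \<partial>lborel) = ?L * (\<integral>\<^sup>+s. (\<integral>\<^sup>+k. W n k t s * ennreal ((a s k)\<^sup>2) \<partial>?C) \<partial>lborel) * indicator {0..T} t" for n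
      using m[of n] by (simp add: J_def nn_integral_cmult nn_integral_multc mult_ac)
    then show "(\<integral>\<^sup>+n. ?L * (\<integral>\<^sup>+s. (\<integral>\<^sup>+k. W n k t s * ennreal ((a s k)\<^sup>2) \<partial>?C) \<partial>lborel) \<partial>?C) * indicator {0..T} t
      = (\<integral>\<^sup>+n. (\<integral>\<^sup>+s. (\<integral>\<^sup>+k. J n k (t, s) \<partial>?C) \<partial>lborel) \<partial>?C)"
      by (simp add: nn_integral_multc)
  qed
  also have "\<dots> = (\<integral>\<^sup>+t. (\<integral>\<^sup>+n. (\<integral>\<^sup>+k. (\<integral>\<^sup>+s. J n k (t, s) \<partial>lborel) \<partial>?C) \<partial>?C) \<partial>lborel)"
    by (intro nn_integral_cong sw[symmetric]) (use J1 in simp)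
  also have "\<dots> = (\<integral>\<^sup>+n. (\<integral>\<^sup>+t. (\<integral>\<^sup>+k. (\<integral>\<^sup>+s. J n k (t, s) \<partial>lborel) \<partial>?C) \<partial>lborel) \<partial>?C)"
    by (rule sw[symmetric]) (use cm[OF Jt] in simp)
  also have "\<dots> = (\<integral>\<^sup>+n. (\<integral>\<^sup>+k. (\<integral>\<^sup>+t. (\<integral>\<^sup>+s. J n k (t, s) \<partial>lborel) \<partial>lborel) \<partial>?C) \<partial>?C)"
    by (rule nn_integral_cong, rule sw[symmetric]) (use Jt in simp)
  also have "\<dots> = (\<integral>\<^sup>+n. (\<integral>\<^sup>+k. (\<integral>\<^sup>+s. (\<integral>\<^sup>+t. J n k (t, s) \<partial>lborel) \<partial>lborel) \<partial>?C) \<partial>?C)"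
  proof -
    have "(\<integral>\<^sup>+t. (\<integral>\<^sup>+s. J n k (t, s) \<partial>lborel) \<partial>lborel) = (\<integral>\<^sup>+s. (\<integral>\<^sup>+t. J n k (t, s) \<partial>lborel) \<partial>lborel)" for n k
      using lborel_pair.Fubini'[of "\<lambda>t s. J n k (t, s)"] J by simp
    then show ?thesis by (simp only:)
  qed
  also have "\<dots> = (\<integral>\<^sup>+k. (\<integral>\<^sup>+n. (\<integral>\<^sup>+s. (\<integral>\<^sup>+t. J n k (t, s) \<partial>lborel) \<partial>lborel) \<partial>?C) \<partial>?C)"
    by (rule nn_integral_count_space_nn_integral[symmetric]) auto
  also have "\<dots> = (\<integral>\<^sup>+k. (\<integral>\<^sup>+s. (\<integral>\<^sup>+n. (\<integral>\<^sup>+t. J n k (t, s) \<partial>lborel) \<partial>?C) \<partial>lborel) \<partial>?C)"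
    by (rule nn_integral_cong, rule sw) (use Js in simp)
  also have "\<dots> = (\<integral>\<^sup>+s. (\<integral>\<^sup>+k. (\<integral>\<^sup>+n. (\<integral>\<^sup>+t. J n k (t, s) \<partial>lborel) \<partial>?C) \<partial>?C) \<partial>lborel)"
    by (rule sw) (use cm[OF Js] in simp)
  also have "\<dots> = (\<integral>\<^sup>+s. (\<integral>\<^sup>+k. ?L * (\<integral>\<^sup>+n. (\<integral>\<^sup>+t. W n k t s * ennreal ((a s k)\<^sup>2) * indicator {0..T} t \<partial>lborel) \<partial>?C) \<partial>?C) \<partial>lborel)"
    by (intro nn_integral_cong) (simp add: J_def nn_integral_cmult)
  \<comment> \<open>With t = s + \<tau>, the cutoffs \<tau> \<ge> 0, s \<ge> 0 and s + \<tau> \<le>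
    T force s into [0, T], while the kernel is integrated over all \<tau> \<ge> 0.\<close>
  also have "\<dots> \<le> (\<integral>\<^sup>+s. (\<integral>\<^sup>+k. ?L * (?L * (ennreal ((a s k)\<^sup>2) * indicator {0..T} s)) \<partial>?C) \<partial>lborel)"
  proof (intro nn_integral_mono mult_left_mono)
    fix s :: real and k :: "int^'d"
    have "(\<integral>\<^sup>+n. (\<integral>\<^sup>+t. W n k t s * ennreal ((a s k)\<^sup>2) * indicator {0..T} t \<partial>lborel) \<partial>?C)
        \<le> (\<integral>\<^sup>+n. (\<integral>\<^sup>+\<tau>. ennreal (kernel p n k \<tau>) * indicator {0..} \<tau> \<partial>lborel) * (ennreal ((a s k)\<^sup>2) * indicator {0..T} s) \<partial>?C)"
    proof (rule nn_integral_mono)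
      fix n :: "int^'d"
      have "(\<integral>\<^sup>+t. W n k t s * ennreal ((a s k)\<^sup>2) * indicator {0..T} t \<partial>lborel)
         = (\<integral>\<^sup>+\<tau>. W n k (s + \<tau>) s * ennreal ((a s k)\<^sup>2) * indicator {0..T} (s + \<tau>) \<partial>lborel)"
        by (subst nn_integral_real_affine[where c = 1 and t = s]) auto
      also have "\<dots> \<le> (\<integral>\<^sup>+\<tau>. ennreal (kernel p n k \<tau>) * indicator {0..} \<tau> * (ennreal ((a s k)\<^sup>2) * indicator {0..T} s) \<partial>lborel)"
        by (intro nn_integral_mono) (auto simp: W_def indicator_def)
      also have "\<dots> = (\<integral>\<^sup>+\<tau>. ennreal (kernel p n k \<tau>) * indicator {0..} \<tau> \<partial>lborel) * (ennreal ((a s k)\<^sup>2) * indicator {0..T} s)"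
        by (rule nn_integral_multc) measurable
      finally show "(\<integral>\<^sup>+t. W n k t s * ennreal ((a s k)\<^sup>2) * indicator {0..T} t \<partial>lborel)
        \<le> (\<integral>\<^sup>+\<tau>. ennreal (kernel p n k \<tau>) * indicator {0..} \<tau> \<partial>lborel) * (ennreal ((a s k)\<^sup>2) * indicator {0..T} s)" .
    qed
    also have "\<dots> = (\<integral>\<^sup>+n. (\<integral>\<^sup>+\<tau>. ennreal (kernel p n k \<tau>) * indicator {0..} \<tau> \<partial>lborel) \<partial>?C) * (ennreal ((a s k)\<^sup>2) * indicator {0..T} s)"
      by (rule nn_integral_multc) simp
    also have "\<dots> \<le> ?L * (ennreal ((a s k)\<^sup>2) * indicator {0..T} s)"
      by (intro mult_right_mono kernel_sums(2)[OF p]) auto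
    finally show "(\<integral>\<^sup>+n. (\<integral>\<^sup>+t. W n k t s * ennreal ((a s k)\<^sup>2) * indicator {0..T} t \<partial>lborel) \<partial>?C)
      \<le> ?L * (ennreal ((a s k)\<^sup>2) * indicator {0..T} s)" .
  qed auto
  also have "\<dots> = ?L * (?L * (\<integral>\<^sup>+s\<in>{0..T}. (\<integral>\<^sup>+k. ennreal ((a s k)\<^sup>2) \<partial>?C) \<partial>lborel))"
  proof -
    have m: "(\<lambda>s. \<integral>\<^sup>+k. ennreal ((a s k)\<^sup>2) \<partial>?C) \<in> borel_measurable borel"
      by (rule cm) measurable
    then show ?thesis by (simp add: nn_integral_cmult nn_integral_multc)
  qed
  finally show ?thesis by (simp add: power2_eq_square mult.assoc)
qed

section \<open>The averaging operator\<close>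

lemma borel_comp_continuous:
  fixes g :: "'a::topological_space \<Rightarrow> 'b::topological_space"
  assumes "f \<in> borel_measurable borel" "continuous_on UNIV g"
  shows "(\<lambda>x. f (g x)) \<in> borel_measurable borel"
  by (rule measurable_compose[OF borel_measurable_continuous_onI[OF assms(2)] assms(1)])

lemma borel_measurable_pair:
  fixes f :: "'a::second_countable_topology \<times> 'b::second_countable_topology \<Rightarrow> 'c::topological_space"
  assumes "f \<in> borel_measurable borel" "sets M = sets borel" "sets N = sets borel"
  shows "f \<in> borel_measurable (M \<Otimes>\<^sub>M N)"
  using assms(1) unfolding measurable_cong_sets[OF sets_pair_borel[OF assms(2,3)] refl] .

lemma borel_measurable_integral_section:
  fixes f :: "'a::second_countable_topology \<times> 'b::second_countable_topology \<Rightarrow> 'c::{banach, second_countable_topology}"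
  assumes "f \<in> borel_measurable borel" "sigma_finite_measure M" "sets M = sets borel"
  shows "(\<lambda>x. \<integral>y. f (x, y) \<partial>M) \<in> borel_measurable borel"
proof -
  interpret sigma_finite_measure M by fact
  show ?thesis
    using borel_measurable_pair[OF assms(1) refl assms(3)]
    by (intro borel_measurable_lebesgue_integral) (simp add: case_prod_beta')
qed

lemma borel_measurable_nn_integral_section:
  fixes f :: "'a::second_countable_topology \<times> 'b::second_countable_topology \<Rightarrow> ennreal"
  assumes "f \<in> borel_measurable borel" "sigma_finite_measure M" "sets M = sets borel"
  shows "(\<lambda>x. \<integral>\<^sup>+y. f (x, y) \<partial>M) \<in> borel_measurable borel"
proof -
  interpret sigma_finite_measure M by fact
  show ?thesis
    using borel_measurable_pair[OF assms(1) refl assms(3)]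
    by (intro borel_measurable_nn_integral_fst)
qed

text \<open>The phase-space inequality for functions independent of x, the torus having mass
  1.\<close>

lemma fiber_Cauchy_Schwarz:
  fixes F :: "real^'d::finite \<Rightarrow> 'b::{real_normed_vector, second_countable_topology}"
  assumes [measurable]: "F \<in> borel_measurable borel" and \<sigma>: "\<sigma> > CARD('d) / 2"
  shows "(\<integral>\<^sup>+v. ennreal (norm (F v)) \<partial>lborel)\<^sup>2
    \<le> ennreal (weight_const TYPE('d) \<sigma>) * (\<integral>\<^sup>+v. ennreal ((1 + (norm v)\<^sup>2) powr \<sigma> * (norm (F v))\<^sup>2) \<partial>lborel)"
proof -
  have pm: "periodic (\<lambda>x::real^'d. 1::real)" by (simp add: periodic_def)
  have m: "(\<lambda>z::'d phase. F (snd z)) \<in> borel_measurable borel"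
    by (rule measurable_compose[OF borel_measurable_snd assms(1)])
  have "(\<integral>\<^sup>+z. ennreal (\<bar>1\<bar> * norm (F (snd z))) \<partial>phase_measure) = (\<integral>\<^sup>+v. ennreal (norm (F v)) \<partial>lborel)"
    using m by (subst lborel.nn_integral_fst[symmetric]) auto
  moreover have "weighted_sq \<sigma> (\<lambda>z. F (snd z)) = (\<integral>\<^sup>+v. ennreal ((1 + (norm v)\<^sup>2) powr \<sigma> * (norm (F v))\<^sup>2) \<partial>lborel)"
    by (simp add: weighted_sq_def)
  ultimately show ?thesis
    using weighted_Cauchy_Schwarz[OF _ m pm \<sigma>] by simp
qed

definition averaging ::
  "(real \<Rightarrow> real) \<Rightarrow> (real \<Rightarrow> real \<Rightarrow> real^'d::finite \<Rightarrow> real^'d \<Rightarrow> real^'d) \<Rightarrow> (real \<Rightarrow> real^'d \<Rightarrow> real)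
     \<Rightarrow> real \<Rightarrow> real^'d \<Rightarrow> real" where
  "averaging \<phi> G H t x = (LBINT s:{0..t}. (LBINT v. grad (H s) (x - \<phi> (t - s) *\<^sub>R v) \<bullet> G t s x v))"

lemma K_free_averaging: "K_free = averaging (\<lambda>\<tau>. \<tau>)"
  by (intro ext) (simp add: K_free_def averaging_def)

lemma K_fric_averaging: "K_fric = averaging (\<lambda>\<tau>. exp \<tau> - 1)"
proof (intro ext)
  fix G :: "real \<Rightarrow> real \<Rightarrow> real^'a \<Rightarrow> real^'a \<Rightarrow> real^'a" and H t x
  have "x + (1 - exp (t - s)) *\<^sub>R v = x - (exp (t - s) - 1) *\<^sub>R v" for s and v :: "real^'a"
    by (simp add: scaleR_diff_left)
  then show "K_fric G H t x = averaging (\<lambda>\<tau>. exp \<tau> - 1) G H t x"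
    by (simp add: K_fric_def averaging_def)
qed

definition space_time_sq :: "real \<Rightarrow> (real \<Rightarrow> real^'d::finite \<Rightarrow> real) \<Rightarrow> ennreal" where
  "space_time_sq T H = (\<integral>\<^sup>+t\<in>{0..T}. (\<integral>\<^sup>+x. ennreal ((H t x)\<^sup>2) \<partial>torus) \<partial>lborel)"

lemma L2_norm_eq: "L2_norm T H = ennreal_sqrt (space_time_sq T H)"
  by (simp add: L2_norm_def space_time_sq_def)

lemma space_time_sq_cong:
  "(\<And>t x. t \<in> {0..T} \<Longrightarrow> H t x = H' t x) \<Longrightarrow> space_time_sq T H = space_time_sq T H'"
  unfolding space_time_sq_def by (intro nn_integral_cong) (auto simp: indicator_def)

text \<open>Smoothness gives continuity in (t, x) on the closed time slab only; extension by zero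
  turns this into Borel measurability on the whole space.\<close>

definition grad_ext :: "real \<Rightarrow> (real \<Rightarrow> real^'d::finite \<Rightarrow> real) \<Rightarrow> real \<times> (real^'d) \<Rightarrow> real^'d" where
  "grad_ext T H p = indicator ({0..T} \<times> UNIV) p *\<^sub>R grad (H (fst p)) (snd p)"

definition fun_ext :: "real \<Rightarrow> (real \<Rightarrow> real^'d::finite \<Rightarrow> real) \<Rightarrow> real \<times> (real^'d) \<Rightarrow> real" where
  "fun_ext T H p = indicator ({0..T} \<times> UNIV) p *\<^sub>R H (fst p) (snd p)"

lemma smooth_function_facts:
  fixes H :: "real \<Rightarrow> real^'d::finite \<Rightarrow> real"
  assumes "smooth_function T H"
  shows "continuous_on ({0..T} \<times> UNIV) (\<lambda>p. H (fst p) (snd p))"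
    and "continuous_on ({0..T} \<times> UNIV) (\<lambda>p. grad (H (fst p)) (snd p))"
    and "s \<in> {0..T} \<Longrightarrow> C1_periodic (H s)"
    and "s \<in> {0..T} \<Longrightarrow> H s differentiable (at x)"
proof -
  define F where "F = (\<lambda>(t, x). H t x)"
  obtain S where S: "open S" "{0..T} \<times> UNIV \<subseteq> S" "smooth_on F S" and per: "\<And>t. t \<in> {0..T} \<Longrightarrow> periodic (H t)"
    using assms unfolding smooth_function_def F_def by blast
  have sl: "H s = (\<lambda>x. F (s, x))" for s by (auto simp: F_def)
  have gradF: "grad (H s) x $ i = partial (0, axis i 1) F (s, x)" for s x i
    using partial_iterate_slice[where b = "axis i 1" and j = 1 and F = F and c = s] by (simp add: grad_def sl)
  have pc: "continuous_on S (partial b F)" for b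
    by (intro smooth_on_imp_continuous_on smooth_on_partial S)
  show 1: "continuous_on ({0..T} \<times> UNIV) (\<lambda>p. H (fst p) (snd p))"
    using continuous_on_subset[OF smooth_on_imp_continuous_on[OF S(3)] S(2)]
    by (simp add: F_def case_prod_beta')
  show 2: "continuous_on ({0..T} \<times> UNIV) (\<lambda>p. grad (H (fst p)) (snd p))"
  proof -
    have "continuous_on ({0..T} \<times> UNIV) (\<lambda>p. \<chi> i. partial (0, axis i 1) F p)"
      by (intro continuous_intros continuous_on_subset[OF pc S(2)])
    moreover have "(\<chi> i. partial (0, axis i 1) F p) = grad (H (fst p)) (snd p)" for p
      by (simp add: vec_eq_iff gradF)
    ultimately show ?thesis by simp
  qed
  assume s: "s \<in> {0..T}"
  have inj: "continuous_on UNIV (\<lambda>x::real^'d. (s, x))" by (intro continuous_intros)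
  have sub: "range (\<lambda>x::real^'d. (s, x)) \<subseteq> {0..T} \<times> UNIV" using s by auto
  show "C1_periodic (H s)"
    unfolding C1_periodic_def
  proof (intro conjI allI)
    show "continuous_on UNIV (H s)"
      using continuous_on_compose2[OF 1 inj sub] by simp
    show "continuous_on UNIV (grad (H s))"
      using continuous_on_compose2[OF 2 inj sub] by simp
    fix i z r
    have "(s, z) + r *\<^sub>R (0, axis i 1) \<in> S" using S(2) s by auto
    from smooth_on_partial_derivative[OF S(3) this]
    show "((\<lambda>r. H s (z + r *\<^sub>R axis i 1)) has_vector_derivative grad (H s) (z + r *\<^sub>R axis i 1) $ i) (at r)"
      unfolding gradF unfolding sl by simp
  qed (use per s in auto)
  have "Ck_on (Suc 0) F S" using S(3) by (simp only: smooth_on_def)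
  moreover have "(s, x) \<in> S" using S(2) s by auto
  ultimately have "F differentiable (at (s, x))" by simp
  then obtain D where "(F has_derivative D) (at (s, x))" by (auto simp: differentiable_def)
  moreover have "((\<lambda>x. (s, x)) has_derivative (\<lambda>h. (0, h))) (at x)"
    by (auto intro!: derivative_eq_intros)
  ultimately have "((\<lambda>x. F (s, x)) has_derivative (\<lambda>h. D (0, h))) (at x)"
    using diff_chain_at[of "\<lambda>x. (s, x)" _ x F] by (simp add: o_def)
  then show "H s differentiable (at x)" unfolding sl by (auto simp: differentiable_def)
qed

lemma time_slab_borel: "({0..T} \<times> UNIV :: (real \<times> 'a::topological_space) set) \<in> sets borel"
  by (intro borel_closed closed_Times closed_UNIV closed_real_atLeastAtMost)

lemma grad_ext_measurable: "smooth_function T H \<Longrightarrow> grad_ext T H \<in> borel_measurable borel"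
  unfolding grad_ext_def
  by (intro borel_measurable_continuous_on_indicator time_slab_borel smooth_function_facts)

lemma fun_ext_measurable: "smooth_function T H \<Longrightarrow> fun_ext T H \<in> borel_measurable borel"
  unfolding fun_ext_def
  by (intro borel_measurable_continuous_on_indicator time_slab_borel smooth_function_facts)

lemma bounded_on_slab:
  fixes F :: "real \<times> (real^'d::finite) \<Rightarrow> 'b::real_normed_vector"
  assumes "continuous_on ({0..T} \<times> UNIV) F" "\<And>s. s \<in> {0..T} \<Longrightarrow> periodic (\<lambda>x. F (s, x))"
  shows "\<exists>B\<ge>0. \<forall>s\<in>{0..T}. \<forall>x. norm (F (s, x)) \<le> B"
proof -
  have "compact (F ` ({0..T} \<times> cbox 0 (\<chi> i. 2 * pi)))"
    by (intro compact_continuous_image compact_Times compact_Icc compact_cbox continuous_on_subset[OF assms(1)]) auto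
  then obtain B where B: "\<And>p. p \<in> {0..T} \<times> cbox 0 (\<chi> i. 2 * pi) \<Longrightarrow> norm (F p) \<le> B"
    using compact_imp_bounded bounded_iff by (metis image_eqI)
  have "norm (F (s, x)) \<le> B" if s: "s \<in> {0..T}" for s x
    using B[of "(s, wrap x)"] wrap_in_cell[of x] periodic_wrap[OF assms(2)[OF s], of x] s
    by (auto simp: cell_def mem_box_cart less_imp_le)
  then show ?thesis by (intro exI[of _ "max 0 B"]) (auto simp: le_max_iff_disj)
qed

lemma smooth_function_grad_bound:
  assumes "smooth_function T H"
  shows "\<exists>B\<ge>0. \<forall>s\<in>{0..T}. \<forall>x. norm (grad (H s) x) \<le> B"
proof -
  have "periodic (grad (H s))" if "s \<in> {0..T}" for s
    using smooth_function_facts(3)[OF assms that] by (simp add: C1_periodic_def periodic_grad)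
  then show ?thesis using bounded_on_slab[OF smooth_function_facts(2)[OF assms]] by simp
qed

lemma smooth_function_bound:
  assumes "smooth_function T H"
  shows "\<exists>B\<ge>0. \<forall>s\<in>{0..T}. \<forall>x. norm (H s x) \<le> B"
  using bounded_on_slab[OF smooth_function_facts(1)[OF assms]] smooth_function_facts(3)[OF assms]
  by (auto simp: C1_periodic_def)

lemma smooth_function_diff:
  assumes "smooth_function T H1" "smooth_function T H2"
  shows "smooth_function T (\<lambda>t x. H1 t x - H2 t x)"
proof -
  obtain S1 S2 where S1: "open S1" "{0..T} \<times> UNIV \<subseteq> S1" "smooth_on (\<lambda>(t, x). H1 t x) S1"
    and S2: "open S2" "{0..T} \<times> UNIV \<subseteq> S2" "smooth_on (\<lambda>(t, x). H2 t x) S2"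
    using assms unfolding smooth_function_def by blast
  have "smooth_on (\<lambda>z. (case z of (t, x) \<Rightarrow> H1 t x) - (case z of (t, x) \<Rightarrow> H2 t x)) (S1 \<inter> S2)"
    using S1 S2 by (intro smooth_on_diff) (auto simp: smooth_on_def intro: Ck_on_subset)
  then have "smooth_on (\<lambda>(t, x). H1 t x - H2 t x) (S1 \<inter> S2)" by (simp add: case_prod_beta')
  then show ?thesis
    using assms S1 S2 unfolding smooth_function_def
    by (auto simp: periodic_def intro!: exI[of _ "S1 \<inter> S2"])
qed

lemma grad_diff:
  assumes "f differentiable (at x)" "g differentiable (at x)"
  shows "grad (\<lambda>x. f x - g x) x = grad f x - grad g x"
proof -
  have "partial b (\<lambda>x. f x - g x) x = partial b f x - partial b g x" for b
  proof -
    have "((\<lambda>h. f (x + h *\<^sub>R b) - g (x + h *\<^sub>R b)) has_vector_derivative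
        frechet_derivative f (at x) b - frechet_derivative g (at x) b) (at 0)"
      using assms by (intro has_vector_derivative_diff has_vector_derivative_along) (simp_all add: frechet_derivative_works)
    then have "partial b (\<lambda>x. f x - g x) x = frechet_derivative f (at x) b - frechet_derivative g (at x) b"
      unfolding partial_def by (rule vector_derivative_at)
    then show ?thesis using assms by (simp add: partial_eq_frechet)
  qed
  then show ?thesis by (simp add: grad_def vec_eq_iff)
qed

lemma ennreal_norm_integral_le:
  fixes f :: "'a \<Rightarrow> 'b::{banach, second_countable_topology}"
  shows "ennreal (norm (\<integral>x. f x \<partial>M)) \<le> (\<integral>\<^sup>+x. ennreal (norm (f x)) \<partial>M)"
  by (cases "integrable M f") (auto simp: integral_norm_bound_ennreal not_integrable_integral_eq)

text \<open>The real number \<gamma> bounds the norm of the field, so an infinite norm is excluded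
  here and treated separately at the end. Of the displacement, the estimates use nothing beyond
  \<phi> \<tau> \<ge> \<tau>; continuity serves measurability.\<close>

locale averaging_setting =
  fixes T :: real and p :: nat and \<sigma> \<gamma> :: real and \<phi> :: "real \<Rightarrow> real"
    and G :: "real \<Rightarrow> real \<Rightarrow> real^'d::finite \<Rightarrow> real^'d \<Rightarrow> real^'d"
  assumes T: "T > 0" and p: "p > 1 + CARD('d)" and \<sigma>: "\<sigma> > CARD('d) / 2"
    and \<phi>_cont: "continuous_on UNIV \<phi>" and \<phi>_ge: "\<And>\<tau>. \<tau> \<ge> 0 \<Longrightarrow> \<tau> \<le> \<phi> \<tau>"
    and G: "smooth_field T G" and \<gamma>: "sup_Hps_norm T p \<sigma> G \<le> ennreal \<gamma>" "\<gamma> \<ge> 0"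
begin

definition g :: "real \<times> real \<times> 'd phase \<Rightarrow> real^'d" where
  "g q = indicator ({0..T} \<times> {0..T} \<times> UNIV) q *\<^sub>R (case q of (t, s, x, v) \<Rightarrow> G t s x v)"

text \<open>All cutoffs in time are part of the function, which makes it Borel on the whole space.
  \<open>K\<close> below is built from it and agrees with \<open>averaging\<close> for times in
  [0, T].\<close>

definition integrand :: "(real \<Rightarrow> real^'d \<Rightarrow> real) \<Rightarrow> real \<times> real \<times> 'd phase \<Rightarrow> real" where
  "integrand H = (\<lambda>(t, s, x, v). indicator {0..} (t - s) * (grad_ext T H (s, x - \<phi> (t - s) *\<^sub>R v) \<bullet> g (t, s, x, v)))"

definition velocity_avg :: "(real \<Rightarrow> real^'d \<Rightarrow> real) \<Rightarrow> real \<times> real \<times> (real^'d) \<Rightarrow> real" where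
  "velocity_avg H = (\<lambda>(t, s, x). \<integral>v. integrand H (t, s, x, v) \<partial>lborel)"

definition K :: "(real \<Rightarrow> real^'d \<Rightarrow> real) \<Rightarrow> real \<Rightarrow> real^'d \<Rightarrow> real" where
  "K H t x = (\<integral>s. velocity_avg H (t, s, x) \<partial>lborel)"

definition decay_const :: real where
  "decay_const = (1 + 2 * real CARD('d)) ^ p * sqrt (weight_const TYPE('d) \<sigma>) * \<gamma>"

lemma decay_const_nonneg: "decay_const \<ge> 0"
  using \<gamma>(2) weight_const(2)[OF \<sigma>] by (simp add: decay_const_def)

lemma g_measurable: "g \<in> borel_measurable borel"
proof -
  obtain S where S: "{0..T} \<times> {0..T} \<times> UNIV \<times> UNIV \<subseteq> S" "smooth_on (\<lambda>(t, s, x, v). G t s x v) S"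
    using G unfolding smooth_field_def by blast
  have "continuous_on ({0..T} \<times> {0..T} \<times> UNIV) (\<lambda>(t, s, x, v). G t s x v)"
    using continuous_on_subset[OF smooth_on_imp_continuous_on[OF S(2)]] S(1) by auto
  then show ?thesis unfolding g_def
    by (intro borel_measurable_continuous_on_indicator)
      (auto intro!: borel_closed closed_Times)
qed

lemma slice:
  assumes "t \<in> {0..T}" "s \<in> {0..T}"
  shows "regular_slice p \<sigma> \<gamma> (\<lambda>z. g (t, s, z))"
proof -
  have "(\<lambda>z. g (t, s, z)) = (\<lambda>(x, v). G t s x v)" using assms by (auto simp: g_def)
  then show ?thesis using regular_slice_field[OF G \<gamma> assms] by simp
qed

lemma integrand_measurable:
  assumes "smooth_function T H" shows "integrand H \<in> borel_measurable borel"
proof -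
  have "(\<lambda>q::real \<times> real \<times> 'd phase. indicat_real {0..} (fst q - fst (snd q))) \<in> borel_measurable borel"
    by (rule borel_comp_continuous[of "indicat_real {0..}"]) (auto intro!: continuous_intros)
  moreover have "continuous_on UNIV (\<lambda>q::real \<times> real \<times> 'd phase. \<phi> (fst q - fst (snd q)))"
    by (rule continuous_on_compose2[OF \<phi>_cont]) (auto intro!: continuous_intros)
  then have "(\<lambda>q::real \<times> real \<times> 'd phase. grad_ext T H (fst (snd q), fst (snd (snd q)) - \<phi> (fst q - fst (snd q)) *\<^sub>R snd (snd (snd q)))) \<in> borel_measurable borel"
    by (intro borel_comp_continuous[OF grad_ext_measurable[OF assms]] continuous_intros)
  ultimately show ?thesis
    using g_measurable unfolding integrand_def case_prod_beta' by simp
qed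

lemma velocity_avg_measurable:
  assumes "smooth_function T H" shows "velocity_avg H \<in> borel_measurable borel"
proof -
  have "(\<lambda>p::(real \<times> real \<times> (real^'d)) \<times> (real^'d). integrand H (fst (fst p), fst (snd (fst p)), snd (snd (fst p)), snd p)) \<in> borel_measurable borel"
    by (intro borel_comp_continuous[OF integrand_measurable[OF assms]] continuous_intros)
  from borel_measurable_integral_section[OF this lborel.sigma_finite_measure_axioms sets_lborel]
  show ?thesis by (simp add: velocity_avg_def case_prod_beta')
qed

lemma K_measurable:
  assumes "smooth_function T H" shows "(\<lambda>(t, x). K H t x) \<in> borel_measurable borel"
proof -
  have "(\<lambda>p::(real \<times> (real^'d)) \<times> real. velocity_avg H (fst (fst p), snd p, snd (fst p))) \<in> borel_measurable borel"
    by (intro borel_comp_continuous[OF velocity_avg_measurable[OF assms]] continuous_intros)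
  from borel_measurable_integral_section[OF this lborel.sigma_finite_measure_axioms sets_lborel]
  show ?thesis by (simp add: K_def case_prod_beta')
qed

lemma averaging_eq_K:
  assumes "t \<in> {0..T}" shows "averaging \<phi> G H t x = K H t x"
  unfolding averaging_def set_lebesgue_integral_def K_def
proof (rule Bochner_Integration.integral_cong[OF refl])
  fix s
  show "indicat_real {0..t} s *\<^sub>R (LBINT v. grad (H s) (x - \<phi> (t - s) *\<^sub>R v) \<bullet> G t s x v) = velocity_avg H (t, s, x)"
  proof (cases "s \<in> {0..t}")
    case True
    then show ?thesis using assms
      by (auto simp: velocity_avg_def integrand_def grad_ext_def g_def)
  next
    case False
    then have "integrand H (t, s, x, v) = 0" for v
      by (auto simp: integrand_def grad_ext_def indicator_def)
    then show ?thesis using False by (simp add: velocity_avg_def)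
  qed
qed

text \<open>A crude bound through the supremum \<open>B\<close> of the gradient. It only secures
  integrability and does not enter the final constant.\<close>

lemma integrand_bound:
  assumes B: "B \<ge> 0" "\<And>s x. s \<in> {0..T} \<Longrightarrow> norm (grad (H s) x) \<le> B"
  shows "\<bar>integrand H (t, s, z)\<bar> \<le> indicator {0..T} s * (B * norm (g (t, s, z)))"
proof (cases "s \<in> {0..T}")
  case True
  obtain x v where z: "z = (x, v)" by (cases z)
  have "\<bar>grad_ext T H (s, x - \<phi> (t - s) *\<^sub>R v) \<bullet> g (t, s, x, v)\<bar> \<le> norm (grad_ext T H (s, x - \<phi> (t - s) *\<^sub>R v)) * norm (g (t, s, x, v))"
    by (rule Cauchy_Schwarz_ineq2)
  also have "\<dots> \<le> B * norm (g (t, s, x, v))"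
    using True B by (intro mult_right_mono) (auto simp: grad_ext_def)
  finally show ?thesis using True B(1) by (auto simp: integrand_def z abs_mult indicator_def)
next
  case False
  then show ?thesis by (cases z) (auto simp: integrand_def grad_ext_def indicator_def)
qed

lemma integrand_section:
  assumes "smooth_function T H"
  shows "(\<lambda>z. integrand H (t, s, z)) \<in> borel_measurable borel"
    and "(\<lambda>v. integrand H (t, s, x, v)) \<in> borel_measurable borel"
    and "(\<lambda>p::real \<times> (real^'d). velocity_avg H (t, fst p, snd p)) \<in> borel_measurable borel"
    and "(\<lambda>s. velocity_avg H (t, s, x)) \<in> borel_measurable borel"
    and "(\<lambda>x. velocity_avg H (t, s, x)) \<in> borel_measurable borel"
    and "K H t \<in> borel_measurable borel"
proof -
  show "(\<lambda>z. integrand H (t, s, z)) \<in> borel_measurable borel"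
    by (intro borel_comp_continuous[OF integrand_measurable[OF assms]] continuous_intros)
  show "(\<lambda>v. integrand H (t, s, x, v)) \<in> borel_measurable borel"
    by (intro borel_comp_continuous[OF integrand_measurable[OF assms]] continuous_intros)
  show "(\<lambda>p::real \<times> (real^'d). velocity_avg H (t, fst p, snd p)) \<in> borel_measurable borel"
    by (intro borel_comp_continuous[OF velocity_avg_measurable[OF assms]] continuous_intros)
  show "(\<lambda>s. velocity_avg H (t, s, x)) \<in> borel_measurable borel"
    by (intro borel_comp_continuous[OF velocity_avg_measurable[OF assms]] continuous_intros)
  show "(\<lambda>x. velocity_avg H (t, s, x)) \<in> borel_measurable borel"
    by (intro borel_comp_continuous[OF velocity_avg_measurable[OF assms]] continuous_intros)
  have "continuous_on UNIV (\<lambda>x::real^'d. (t, x))" by (intro continuous_intros)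
  from borel_comp_continuous[OF K_measurable[OF assms] this] show "K H t \<in> borel_measurable borel" by simp
qed

lemma g_slice_measurable: "(\<lambda>z. g (t, s, z)) \<in> borel_measurable borel" "(\<lambda>v. g (t, s, x, v)) \<in> borel_measurable borel"
  by (intro borel_comp_continuous[OF g_measurable] continuous_intros)+

lemma integrand_L1:
  assumes H: "smooth_function T H" and B: "B \<ge> 0" "\<And>s x. s \<in> {0..T} \<Longrightarrow> norm (grad (H s) x) \<le> B"
    and t: "t \<in> {0..T}"
  shows "(\<integral>\<^sup>+z. ennreal \<bar>integrand H (t, s, z)\<bar> \<partial>phase_measure)
    \<le> indicator {0..T} s * ennreal (B * (sqrt (weight_const TYPE('d) \<sigma>) * \<gamma>))"
    and "integrable phase_measure (\<lambda>z. integrand H (t, s, z))"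
proof -
  show le: "(\<integral>\<^sup>+z. ennreal \<bar>integrand H (t, s, z)\<bar> \<partial>phase_measure)
    \<le> indicator {0..T} s * ennreal (B * (sqrt (weight_const TYPE('d) \<sigma>) * \<gamma>))"
  proof (cases "s \<in> {0..T}")
    case True
    have "(\<integral>\<^sup>+z. ennreal \<bar>integrand H (t, s, z)\<bar> \<partial>phase_measure) \<le> (\<integral>\<^sup>+z. ennreal (B * norm (g (t, s, z))) \<partial>phase_measure)"
      using integrand_bound[where H = H and t = t and s = s, OF B] True by (intro nn_integral_mono ennreal_leI) auto
    also have "\<dots> = ennreal B * (\<integral>\<^sup>+z. ennreal (norm (g (t, s, z))) \<partial>phase_measure)"
      using g_slice_measurable B(1) by (subst nn_integral_cmult[symmetric]) (auto simp: ennreal_mult)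
    also have "\<dots> \<le> ennreal B * ennreal (sqrt (weight_const TYPE('d) \<sigma>) * \<gamma>)"
      by (intro mult_left_mono weighted_L1(2) g_slice_measurable \<sigma> regular_slice_weighted[OF slice] t True \<gamma>(2)) auto
    finally show ?thesis using True B(1) by (simp add: ennreal_mult')
  next
    case False
    then have "integrand H (t, s, z) = 0" for z
      using integrand_bound[where H = H and t = t and s = s and z = z, OF B] by simp
    then show ?thesis using False by simp
  qed
  have "(\<integral>\<^sup>+z. ennreal \<bar>integrand H (t, s, z)\<bar> \<partial>phase_measure) < \<infinity>"
    by (rule le_less_trans[OF le]) (auto simp: indicator_def)
  then show "integrable phase_measure (\<lambda>z. integrand H (t, s, z))"
    using integrand_section(1)[OF H] by (intro integrableI_bounded) auto
qed

lemma velocity_avg_abs_le: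
  "ennreal \<bar>velocity_avg H (t, s, x)\<bar> \<le> (\<integral>\<^sup>+v. ennreal \<bar>integrand H (t, s, x, v)\<bar> \<partial>lborel)"
  using ennreal_norm_integral_le[of lborel "\<lambda>v. integrand H (t, s, x, v)"] by (simp add: velocity_avg_def)

text \<open>Absolute integrability in (s, x, v) at each fixed t, which justifies the later exchanges
  of the integrals in s and x.\<close>

lemma integrand_total_mass:
  assumes H: "smooth_function T H" and t: "t \<in> {0..T}"
  shows "(\<integral>\<^sup>+s. (\<integral>\<^sup>+z. ennreal \<bar>integrand H (t, s, z)\<bar> \<partial>phase_measure) \<partial>lborel) < \<infinity>"
proof -
  obtain B where B: "B \<ge> 0" "\<And>s x. s \<in> {0..T} \<Longrightarrow> norm (grad (H s) x) \<le> B"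
    using smooth_function_grad_bound[OF H] by blast
  have "(\<integral>\<^sup>+s. (\<integral>\<^sup>+z. ennreal \<bar>integrand H (t, s, z)\<bar> \<partial>phase_measure) \<partial>lborel)
     \<le> (\<integral>\<^sup>+s. ennreal (B * (sqrt (weight_const TYPE('d) \<sigma>) * \<gamma>)) * indicator {0..T} s \<partial>lborel)"
    by (intro nn_integral_mono) (use integrand_L1(1)[OF H B t] in \<open>simp add: mult.commute\<close>)
  also have "\<dots> < \<infinity>" using T by (simp add: nn_integral_cmult ennreal_mult_less_top)
  finally show ?thesis .
qed

lemma velocity_avg_integrable:
  assumes H: "smooth_function T H" and t: "t \<in> {0..T}"
  shows "integrable (lborel \<Otimes>\<^sub>M torus) (\<lambda>(s, x). velocity_avg H (t, s, x))"
proof (rule integrableI_bounded)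
  have m: "(\<lambda>p::real \<times> (real^'d). velocity_avg H (t, fst p, snd p)) \<in> borel_measurable (lborel \<Otimes>\<^sub>M torus)"
    by (intro borel_measurable_pair integrand_section(3)[OF H]) auto
  then show "(\<lambda>(s, x). velocity_avg H (t, s, x)) \<in> borel_measurable (lborel \<Otimes>\<^sub>M torus)"
    by (simp add: case_prod_beta')
  have "(\<integral>\<^sup>+p. ennreal (norm (case p of (s, x) \<Rightarrow> velocity_avg H (t, s, x))) \<partial>(lborel \<Otimes>\<^sub>M torus))
    = (\<integral>\<^sup>+s. (\<integral>\<^sup>+x. ennreal \<bar>velocity_avg H (t, s, x)\<bar> \<partial>torus) \<partial>lborel)"
    using m by (subst torus.nn_integral_fst[symmetric]) (auto simp: case_prod_beta')
  also have "\<dots> \<le> (\<integral>\<^sup>+s. (\<integral>\<^sup>+x. (\<integral>\<^sup>+v. ennreal \<bar>integrand H (t, s, x, v)\<bar> \<partial>lborel) \<partial>torus) \<partial>lborel)"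
    by (intro nn_integral_mono velocity_avg_abs_le)
  also have "\<dots> = (\<integral>\<^sup>+s. (\<integral>\<^sup>+z. ennreal \<bar>integrand H (t, s, z)\<bar> \<partial>phase_measure) \<partial>lborel)"
    using integrand_section(1)[OF H] by (intro nn_integral_cong lborel.nn_integral_fst) auto
  also have "\<dots> < \<infinity>" by (rule integrand_total_mass[OF H t])
  finally show "(\<integral>\<^sup>+p. ennreal (norm (case p of (s, x) \<Rightarrow> velocity_avg H (t, s, x))) \<partial>(lborel \<Otimes>\<^sub>M torus)) < \<infinity>" .
qed

lemma velocity_avg_sq:
  assumes H: "smooth_function T H" and B: "B \<ge> 0" "\<And>s x. s \<in> {0..T} \<Longrightarrow> norm (grad (H s) x) \<le> B"
    and t: "t \<in> {0..T}"
  shows "(\<integral>\<^sup>+x. ennreal ((velocity_avg H (t, s, x))\<^sup>2) \<partial>torus)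
    \<le> indicator {0..T} s * ennreal (B\<^sup>2 * weight_const TYPE('d) \<sigma> * \<gamma>\<^sup>2)"
proof (cases "s \<in> {0..T}")
  case False
  then have "integrand H (t, s, z) = 0" for z
    using integrand_bound[where H = H and t = t and s = s and z = z, OF B] by simp
  then show ?thesis by (simp add: velocity_avg_def)
next
  case s: True
  have gx: "(\<lambda>x. \<integral>\<^sup>+v. ennreal ((1 + (norm v)\<^sup>2) powr \<sigma> * (norm (g (t, s, x, v)))\<^sup>2) \<partial>lborel) \<in> borel_measurable borel"
  proof -
    have "(\<lambda>p::'d phase. ennreal ((1 + (norm (snd p))\<^sup>2) powr \<sigma> * (norm (g (t, s, p)))\<^sup>2)) \<in> borel_measurable borel"
    proof -
      have "(\<lambda>p::'d phase. (1 + (norm (snd p))\<^sup>2) powr \<sigma>) \<in> borel_measurable borel"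
        by (rule measurable_compose[OF borel_measurable_snd]) measurable
      then show ?thesis using g_slice_measurable(1)[of t s] by measurable
    qed
    from borel_measurable_nn_integral_section[OF this lborel.sigma_finite_measure_axioms sets_lborel]
    show ?thesis by simp
  qed
  have "ennreal ((velocity_avg H (t, s, x))\<^sup>2)
     \<le> ennreal (B\<^sup>2 * weight_const TYPE('d) \<sigma>) * (\<integral>\<^sup>+v. ennreal ((1 + (norm v)\<^sup>2) powr \<sigma> * (norm (g (t, s, x, v)))\<^sup>2) \<partial>lborel)" for x
  proof -
    have "ennreal \<bar>velocity_avg H (t, s, x)\<bar> \<le> (\<integral>\<^sup>+v. ennreal B * ennreal (norm (g (t, s, x, v))) \<partial>lborel)"
      using integrand_bound[where H = H and t = t and s = s, OF B] s B(1)
      by (intro order_trans[OF velocity_avg_abs_le] nn_integral_mono) (auto simp: ennreal_mult[symmetric] intro!: ennreal_leI)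
    also have "\<dots> = ennreal B * (\<integral>\<^sup>+v. ennreal (norm (g (t, s, x, v))) \<partial>lborel)"
      using g_slice_measurable(2)[of t s x] by (intro nn_integral_cmult) measurable
    finally have "(ennreal \<bar>velocity_avg H (t, s, x)\<bar>)\<^sup>2 \<le> (ennreal B * (\<integral>\<^sup>+v. ennreal (norm (g (t, s, x, v))) \<partial>lborel))\<^sup>2"
      by (intro power_mono) auto
    also have "\<dots> = ennreal (B\<^sup>2) * (\<integral>\<^sup>+v. ennreal (norm (g (t, s, x, v))) \<partial>lborel)\<^sup>2"
      using B(1) by (simp add: power_mult_distrib ennreal_power)
    also have "\<dots> \<le> ennreal (B\<^sup>2) * (ennreal (weight_const TYPE('d) \<sigma>) * (\<integral>\<^sup>+v. ennreal ((1 + (norm v)\<^sup>2) powr \<sigma> * (norm (g (t, s, x, v)))\<^sup>2) \<partial>lborel))"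
      by (intro mult_left_mono fiber_Cauchy_Schwarz g_slice_measurable \<sigma>) auto
    finally show ?thesis
      using weight_const(2)[OF \<sigma>] by (simp add: ennreal_power ennreal_mult' mult.assoc)
  qed
  then have "(\<integral>\<^sup>+x. ennreal ((velocity_avg H (t, s, x))\<^sup>2) \<partial>torus)
     \<le> (\<integral>\<^sup>+x. ennreal (B\<^sup>2 * weight_const TYPE('d) \<sigma>) * (\<integral>\<^sup>+v. ennreal ((1 + (norm v)\<^sup>2) powr \<sigma> * (norm (g (t, s, x, v)))\<^sup>2) \<partial>lborel) \<partial>torus)"
    by (intro nn_integral_mono)
  also have "\<dots> = ennreal (B\<^sup>2 * weight_const TYPE('d) \<sigma>) * weighted_sq \<sigma> (\<lambda>z. g (t, s, z))"
    using gx by (subst nn_integral_cmult) (auto simp: weighted_sq_def)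
  also have "\<dots> \<le> ennreal (B\<^sup>2 * weight_const TYPE('d) \<sigma>) * ennreal (\<gamma>\<^sup>2)"
    by (intro mult_left_mono regular_slice_weighted[OF slice] t s) auto
  finally show ?thesis using s weight_const(2)[OF \<sigma>] by (simp add: ennreal_mult')
qed

text \<open>Merely qualitative, with a bound depending on \<open>T\<close> and on the gradient of
  \<open>H\<close>: Parseval's identity can be applied to \<open>K H t\<close> only after this is
  known.\<close>

lemma K_square_integrable:
  assumes H: "smooth_function T H" and t: "t \<in> {0..T}"
  shows "integrable torus (\<lambda>x. (K H t x)\<^sup>2)"
proof (rule integrableI_bounded)
  obtain B where B: "B \<ge> 0" "\<And>s x. s \<in> {0..T} \<Longrightarrow> norm (grad (H s) x) \<le> B"
    using smooth_function_grad_bound[OF H] by blast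
  show "(\<lambda>x. (K H t x)\<^sup>2) \<in> borel_measurable torus"
    using integrand_section(6)[OF H] by measurable
  have supp: "velocity_avg H (t, s, x) = 0" if "s \<notin> {0..T}" for s x
  proof -
    have "integrand H (t, s, z) = 0" for z
      using integrand_bound[where H = H and t = t and s = s and z = z, OF B] that by simp
    then show ?thesis by (simp add: velocity_avg_def)
  qed
  have "ennreal ((K H t x)\<^sup>2) \<le> ennreal T * (\<integral>\<^sup>+s. ennreal ((velocity_avg H (t, s, x))\<^sup>2) \<partial>lborel)" for x
  proof -
    have "ennreal \<bar>K H t x\<bar> \<le> (\<integral>\<^sup>+s. ennreal \<bar>velocity_avg H (t, s, x)\<bar> \<partial>lborel)"
      unfolding K_def using ennreal_norm_integral_le[of lborel "\<lambda>s. velocity_avg H (t, s, x)"] by simp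
    also have "\<dots> = (\<integral>\<^sup>+s. indicator {0..T} s * ennreal \<bar>velocity_avg H (t, s, x)\<bar> \<partial>lborel)"
      using supp by (intro nn_integral_cong) (auto simp: indicator_def)
    finally have "(ennreal \<bar>K H t x\<bar>)\<^sup>2 \<le> (\<integral>\<^sup>+s. indicator {0..T} s * ennreal \<bar>velocity_avg H (t, s, x)\<bar> \<partial>lborel)\<^sup>2"
      by (intro power_mono) auto
    also have "\<dots> \<le> (\<integral>\<^sup>+s. (indicator {0..T} s)\<^sup>2 \<partial>lborel) * (\<integral>\<^sup>+s. (ennreal \<bar>velocity_avg H (t, s, x)\<bar>)\<^sup>2 \<partial>lborel)"
      using integrand_section(4)[OF H, of t x] by (intro Cauchy_Schwarz_nn_integral) measurable
    also have "(\<integral>\<^sup>+s. (indicator {0..T} s)\<^sup>2 \<partial>(lborel :: real measure)) = ennreal T"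
    proof -
      have "(indicator {0..T} s :: ennreal)\<^sup>2 = indicator {0..T} s" for s by (simp add: indicator_def)
      then show ?thesis using T by simp
    qed
    finally show ?thesis by (simp add: ennreal_power)
  qed
  then have "(\<integral>\<^sup>+x. ennreal (norm ((K H t x)\<^sup>2)) \<partial>torus)
     \<le> (\<integral>\<^sup>+x. ennreal T * (\<integral>\<^sup>+s. ennreal ((velocity_avg H (t, s, x))\<^sup>2) \<partial>lborel) \<partial>torus)"
    by (intro nn_integral_mono) simp
  also have "\<dots> = ennreal T * (\<integral>\<^sup>+x. (\<integral>\<^sup>+s. ennreal ((velocity_avg H (t, s, x))\<^sup>2) \<partial>lborel) \<partial>torus)"
  proof (rule nn_integral_cmult)
    have "(\<lambda>p::(real^'d) \<times> real. ennreal ((velocity_avg H (t, snd p, fst p))\<^sup>2)) \<in> borel_measurable borel"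
    proof -
      have "(\<lambda>p::(real^'d) \<times> real. velocity_avg H (t, snd p, fst p)) \<in> borel_measurable borel"
        by (intro borel_comp_continuous[OF velocity_avg_measurable[OF H]] continuous_intros)
      then show ?thesis by measurable
    qed
    from borel_measurable_nn_integral_section[OF this lborel.sigma_finite_measure_axioms sets_lborel]
    show "(\<lambda>x. \<integral>\<^sup>+s. ennreal ((velocity_avg H (t, s, x))\<^sup>2) \<partial>lborel) \<in> borel_measurable torus" by simp
  qed
  also have "(\<integral>\<^sup>+x. (\<integral>\<^sup>+s. ennreal ((velocity_avg H (t, s, x))\<^sup>2) \<partial>lborel) \<partial>torus)
      = (\<integral>\<^sup>+s. (\<integral>\<^sup>+x. ennreal ((velocity_avg H (t, s, x))\<^sup>2) \<partial>torus) \<partial>lborel)"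
  proof -
    have "(\<lambda>p::real \<times> (real^'d). velocity_avg H (t, fst p, snd p)) \<in> borel_measurable (lborel \<Otimes>\<^sub>M torus)"
      by (intro borel_measurable_pair integrand_section(3)[OF H]) auto
    then show ?thesis
      using lborel_torus.Fubini'[of "\<lambda>s x. ennreal ((velocity_avg H (t, s, x))\<^sup>2)"]
      by (simp add: case_prod_beta')
  qed
  also have "\<dots> \<le> (\<integral>\<^sup>+s. ennreal (B\<^sup>2 * weight_const TYPE('d) \<sigma> * \<gamma>\<^sup>2) * indicator {0..T} s \<partial>lborel)"
    by (intro nn_integral_mono) (use velocity_avg_sq[OF H B t] in \<open>simp add: mult.commute\<close>)
  finally have "(\<integral>\<^sup>+x. ennreal (norm ((K H t x)\<^sup>2)) \<partial>torus) \<le> ennreal T * (\<integral>\<^sup>+s. ennreal (B\<^sup>2 * weight_const TYPE('d) \<sigma> * \<gamma>\<^sup>2) * indicator {0..T} s \<partial>lborel)"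
    by (simp add: mult_left_mono)
  also have "\<dots> < \<infinity>" using T by (simp add: nn_integral_cmult ennreal_mult_less_top)
  finally show "(\<integral>\<^sup>+x. ennreal (norm ((K H t x)\<^sup>2)) \<partial>torus) < \<infinity>" .
qed

end

section \<open>The bound in terms of the L2 norm alone, for smooth functions\<close>

context averaging_setting
begin

text \<open>Fubini writes the n-th coefficient as a time integral of coefficients of the velocity
  averages; \<open>coefficient_bound\<close> applies at each s with displacement \<phi> (t - s),
  which is then lowered to t - s.\<close>

lemma coef_K_bound:
  assumes H: "smooth_function T H" and t: "t \<in> {0..T}"
  shows "ennreal (cmod (coef (K H t) n))
    \<le> (\<integral>\<^sup>+s\<in>{0..t}. (\<integral>\<^sup>+k. ennreal (kernel p n k (t - s) * (decay_const * cmod (coef (\<lambda>x. fun_ext T H (s, x)) k))) \<partial>count_space UNIV) \<partial>lborel)"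
proof -
  obtain B where B: "B \<ge> 0" "\<And>s x. s \<in> {0..T} \<Longrightarrow> norm (grad (H s) x) \<le> B"
    using smooth_function_grad_bound[OF H] by blast
  define c where "c s = (\<integral>z. cnj (mode n (fst z)) * of_real (integrand H (t, s, z)) \<partial>phase_measure)" for s
  have mm: "(\<lambda>z::'d phase. mode n (fst z)) \<in> borel_measurable borel"
    by (rule measurable_compose[OF borel_measurable_fst]) simp
  have e1: "(\<integral>x. of_real (velocity_avg H (t, s, x)) * cnj (mode n x) \<partial>torus) = c s" for s
  proof -
    have "integrable phase_measure (\<lambda>z. cnj (mode n (fst z)) * of_real (integrand H (t, s, z)))"
      using mm integrand_section(1)[OF H, of t s]
      by (intro Bochner_Integration.integrable_bound[OF integrand_L1(2)[OF H B t, of s]]) (auto simp: norm_mult)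
    from torus_lborel.integral_fst'[OF this]
    show ?thesis by (simp add: c_def velocity_avg_def mult.commute)
  qed
  have int: "integrable (lborel \<Otimes>\<^sub>M torus) (\<lambda>(s, x). of_real (velocity_avg H (t, s, x)) * cnj (mode n x))"
  proof -
    have "(\<lambda>p::real \<times> (real^'d). mode n (snd p)) \<in> borel_measurable borel"
      by (rule measurable_compose[OF borel_measurable_snd]) simp
    then have "(\<lambda>p::real \<times> (real^'d). of_real (velocity_avg H (t, fst p, snd p)) * cnj (mode n (snd p))) \<in> borel_measurable borel"
      using integrand_section(3)[OF H, of t] by measurable
    then have "(\<lambda>p::real \<times> (real^'d). of_real (velocity_avg H (t, fst p, snd p)) * cnj (mode n (snd p))) \<in> borel_measurable (lborel \<Otimes>\<^sub>M torus)"
      by (rule borel_measurable_pair) auto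
    then show ?thesis
      by (intro Bochner_Integration.integrable_bound[OF velocity_avg_integrable[OF H t]]) (auto simp: norm_mult case_prod_beta')
  qed
  have "coef (K H t) n = (\<integral>x. (\<integral>s. of_real (velocity_avg H (t, s, x)) * cnj (mode n x) \<partial>lborel) \<partial>torus)"
    by (simp add: coef_def K_def)
  also have "\<dots> = (\<integral>s. c s \<partial>lborel)"
    using lborel_torus.Fubini_integral[OF int] by (simp add: e1)
  finally have "ennreal (cmod (coef (K H t) n)) \<le> (\<integral>\<^sup>+s. ennreal (cmod (c s)) \<partial>lborel)"
    using ennreal_norm_integral_le[of lborel c] by simp
  also have "\<dots> \<le> (\<integral>\<^sup>+s\<in>{0..t}. (\<integral>\<^sup>+k. ennreal (kernel p n k (t - s) * (decay_const * cmod (coef (\<lambda>x. fun_ext T H (s, x)) k))) \<partial>count_space UNIV) \<partial>lborel)"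
  proof (rule nn_integral_mono)
    fix s
    show "ennreal (cmod (c s)) \<le> (\<integral>\<^sup>+k. ennreal (kernel p n k (t - s) * (decay_const * cmod (coef (\<lambda>x. fun_ext T H (s, x)) k))) \<partial>count_space UNIV) * indicator {0..t} s"
    proof (cases "s \<in> {0..t}")
      case True
      then have s: "s \<in> {0..T}" "t - s \<ge> 0" using t by auto
      have ph: "0 \<le> \<phi> (t - s)" using \<phi>_ge[OF s(2)] s(2) by simp
      have "c s = (\<integral>z. cnj (mode n (fst z)) * of_real (grad (H s) (fst z - \<phi> (t - s) *\<^sub>R snd z) \<bullet> g (t, s, z)) \<partial>phase_measure)"
        using s by (simp add: c_def integrand_def grad_ext_def case_prod_beta')
      then have "ennreal (cmod (c s)) \<le> (\<integral>\<^sup>+k. ennreal (decay_const * (l1 (freq k) / (1 + l1 (freq (n - k)) + \<phi> (t - s) * l1 (freq k)) ^ p) * cmod (coef (H s) k)) \<partial>count_space UNIV)"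
        using coefficient_bound[OF smooth_function_facts(3)[OF H s(1)] slice[OF t s(1)] \<sigma> \<gamma>(2) ph, of n]
        by (simp add: decay_const_def)
      also have "\<dots> \<le> (\<integral>\<^sup>+k. ennreal (kernel p n k (t - s) * (decay_const * cmod (coef (\<lambda>x. fun_ext T H (s, x)) k))) \<partial>count_space UNIV)"
      proof (intro nn_integral_mono ennreal_leI)
        fix k
        have "kernel p n k (\<phi> (t - s)) * (decay_const * cmod (coef (H s) k)) \<le> kernel p n k (t - s) * (decay_const * cmod (coef (H s) k))"
          using decay_const_nonneg by (intro mult_right_mono kernel_antimono s \<phi>_ge) auto
        then show "decay_const * (l1 (freq k) / (1 + l1 (freq (n - k)) + \<phi> (t - s) * l1 (freq k)) ^ p) * cmod (coef (H s) k)
          \<le> kernel p n k (t - s) * (decay_const * cmod (coef (\<lambda>x. fun_ext T H (s, x)) k))"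
          using s by (simp add: fun_ext_def kernel_def mult_ac)
      qed
      finally show ?thesis using True by simp
    next
      case False
      then have "integrand H (t, s, z) = 0" for z
        by (cases z) (auto simp: integrand_def grad_ext_def indicator_def)
      then show ?thesis by (simp add: c_def)
    qed
  qed
  finally show ?thesis .
qed

text \<open>Parseval at each time t for the output, the Schur test in between, and Parseval at each
  time s for the input.\<close>

lemma main_estimate:
  assumes H: "smooth_function T H"
  shows "space_time_sq T (K H) \<le> (lattice_const TYPE('d) p * ennreal decay_const)\<^sup>2 * space_time_sq T H"
proof -
  let ?C = "count_space (UNIV :: (int^'d) set)"
  define a where "a s k = decay_const * cmod (coef (\<lambda>x. fun_ext T H (s, x)) k)" for s k
  have a[measurable]: "(\<lambda>s. a s k) \<in> borel_measurable borel" for k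
  proof -
    have "(\<lambda>p::real \<times> (real^'d). mode k (snd p)) \<in> borel_measurable borel"
      by (rule measurable_compose[OF borel_measurable_snd]) simp
    then have "(\<lambda>p::real \<times> (real^'d). of_real (fun_ext T H p) * cnj (mode k (snd p))) \<in> borel_measurable borel"
      using fun_ext_measurable[OF H] by measurable
    from borel_measurable_integral_section[OF this sigma_finite_torus sets_torus]
    show ?thesis unfolding a_def coef_def by simp
  qed
  have "space_time_sq T (K H) \<le> (\<integral>\<^sup>+t\<in>{0..T}. (\<integral>\<^sup>+n. (\<integral>\<^sup>+s\<in>{0..t}. (\<integral>\<^sup>+k. ennreal (kernel p n k (t - s) * a s k) \<partial>?C) \<partial>lborel)\<^sup>2 \<partial>?C) \<partial>lborel)"
    unfolding space_time_sq_def
  proof (rule nn_integral_mono)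
    fix t
    show "(\<integral>\<^sup>+x. ennreal ((K H t x)\<^sup>2) \<partial>torus) * indicator {0..T} t
      \<le> (\<integral>\<^sup>+n. (\<integral>\<^sup>+s\<in>{0..t}. (\<integral>\<^sup>+k. ennreal (kernel p n k (t - s) * a s k) \<partial>?C) \<partial>lborel)\<^sup>2 \<partial>?C) * indicator {0..T} t"
    proof (cases "t \<in> {0..T}")
      case True
      have "(\<integral>\<^sup>+x. ennreal ((K H t x)\<^sup>2) \<partial>torus) = (\<integral>\<^sup>+n. (ennreal (cmod (coef (K H t) n)))\<^sup>2 \<partial>?C)"
        using parseval[OF integrand_section(6)[OF H] K_square_integrable[OF H True]] by (simp add: ennreal_power)
      also have "\<dots> \<le> (\<integral>\<^sup>+n. (\<integral>\<^sup>+s\<in>{0..t}. (\<integral>\<^sup>+k. ennreal (kernel p n k (t - s) * a s k) \<partial>?C) \<partial>lborel)\<^sup>2 \<partial>?C)"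
        unfolding a_def by (intro nn_integral_mono power_mono coef_K_bound H True) auto
      finally show ?thesis by (rule mult_right_mono) auto
    qed simp
  qed
  also have "\<dots> \<le> (lattice_const TYPE('d) p)\<^sup>2 * (\<integral>\<^sup>+s\<in>{0..T}. (\<integral>\<^sup>+k. ennreal ((a s k)\<^sup>2) \<partial>?C) \<partial>lborel)"
    using p decay_const_nonneg by (intro schur_test a) (auto simp: a_def)
  also have "(\<integral>\<^sup>+s\<in>{0..T}. (\<integral>\<^sup>+k. ennreal ((a s k)\<^sup>2) \<partial>?C) \<partial>lborel) = (\<integral>\<^sup>+s. (ennreal decay_const)\<^sup>2 * ((\<integral>\<^sup>+x. ennreal ((fun_ext T H (s, x))\<^sup>2) \<partial>torus) * indicator {0..T} s) \<partial>lborel)"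
  proof (rule nn_integral_cong)
    fix s
    show "(\<integral>\<^sup>+k. ennreal ((a s k)\<^sup>2) \<partial>?C) * indicator {0..T} s = (ennreal decay_const)\<^sup>2 * ((\<integral>\<^sup>+x. ennreal ((fun_ext T H (s, x))\<^sup>2) \<partial>torus) * indicator {0..T} s)"
    proof (cases "s \<in> {0..T}")
      case True
      obtain B where B: "\<And>x. norm (H s x) \<le> B" using smooth_function_bound[OF H] True by blast
      have "continuous_on UNIV (H s)" using smooth_function_facts(3)[OF H True] by (simp add: C1_periodic_def)
      then have m [measurable]: "H s \<in> borel_measurable borel" by (rule borel_measurable_continuous_onI)
      have sq: "integrable torus (\<lambda>x. (H s x)\<^sup>2)"
        using B by (intro torus.integrable_const_bound[where B = "B\<^sup>2"])
          (auto intro!: AE_I2 simp: power2_le_iff_abs_le[OF order_trans[OF norm_ge_zero B]])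
      have "(\<integral>\<^sup>+k. ennreal ((a s k)\<^sup>2) \<partial>?C) = (\<integral>\<^sup>+k. (ennreal decay_const)\<^sup>2 * ennreal ((cmod (coef (H s) k))\<^sup>2) \<partial>?C)"
        using True decay_const_nonneg
        by (intro nn_integral_cong) (simp add: a_def fun_ext_def power_mult_distrib ennreal_mult ennreal_power)
      also have "\<dots> = (ennreal decay_const)\<^sup>2 * (\<integral>\<^sup>+x. ennreal ((H s x)\<^sup>2) \<partial>torus)"
        by (simp add: nn_integral_cmult parseval[OF m sq])
      finally show ?thesis using True by (simp add: fun_ext_def)
    qed simp
  qed
  also have "\<dots> = (ennreal decay_const)\<^sup>2 * (\<integral>\<^sup>+s. (\<integral>\<^sup>+x. ennreal ((fun_ext T H (s, x))\<^sup>2) \<partial>torus) * indicator {0..T} s \<partial>lborel)"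
  proof (rule nn_integral_cmult)
    have "(\<lambda>z. ennreal ((fun_ext T H z)\<^sup>2)) \<in> borel_measurable borel"
      using fun_ext_measurable[OF H] by measurable
    from borel_measurable_nn_integral_section[OF this sigma_finite_torus sets_torus]
    show "(\<lambda>s. (\<integral>\<^sup>+x. ennreal ((fun_ext T H (s, x))\<^sup>2) \<partial>torus) * indicator {0..T} s) \<in> borel_measurable lborel"
      by simp
  qed
  also have "(\<integral>\<^sup>+s. (\<integral>\<^sup>+x. ennreal ((fun_ext T H (s, x))\<^sup>2) \<partial>torus) * indicator {0..T} s \<partial>lborel) = space_time_sq T H"
    unfolding space_time_sq_def by (intro nn_integral_cong) (auto simp: fun_ext_def indicator_def)
  finally show ?thesis by (simp add: power_mult_distrib mult.assoc)
qed

text \<open>A divergent Bochner integral has the value 0, so additivity of \<open>K\<close> can fail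
  at points where the integral does not converge absolutely. These points form a null set in
  x.\<close>

lemma AE_integrand_finite:
  assumes H: "smooth_function T H" and t: "t \<in> {0..T}"
  shows "AE x in torus. (\<integral>\<^sup>+s. (\<integral>\<^sup>+v. ennreal \<bar>integrand H (t, s, x, v)\<bar> \<partial>lborel) \<partial>lborel) \<noteq> \<infinity>"
proof -
  have "(\<lambda>p::(real \<times> (real^'d)) \<times> (real^'d). \<bar>integrand H (t, fst (fst p), snd (fst p), snd p)\<bar>) \<in> borel_measurable borel"
  proof -
    have "(\<lambda>p::(real \<times> (real^'d)) \<times> (real^'d). integrand H (t, fst (fst p), snd (fst p), snd p)) \<in> borel_measurable borel"
      by (intro borel_comp_continuous[OF integrand_measurable[OF H]] continuous_intros)
    then show ?thesis by measurable
  qed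
  then have "(\<lambda>p::(real \<times> (real^'d)) \<times> (real^'d). ennreal \<bar>integrand H (t, fst (fst p), snd (fst p), snd p)\<bar>) \<in> borel_measurable borel"
    by measurable
  from borel_measurable_nn_integral_section[OF this lborel.sigma_finite_measure_axioms sets_lborel]
  have h: "(\<lambda>p. \<integral>\<^sup>+v. ennreal \<bar>integrand H (t, fst p, snd p, v)\<bar> \<partial>lborel) \<in> borel_measurable borel" by simp
  have "(\<lambda>p::(real^'d) \<times> real. \<integral>\<^sup>+v. ennreal \<bar>integrand H (t, snd p, fst p, v)\<bar> \<partial>lborel) \<in> borel_measurable borel"
  proof -
    have "continuous_on UNIV (\<lambda>p::(real^'d) \<times> real. (snd p, fst p))" by (intro continuous_intros)
    from borel_comp_continuous[OF h this] show ?thesis by simp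
  qed
  from borel_measurable_nn_integral_section[OF this lborel.sigma_finite_measure_axioms sets_lborel]
  have m: "(\<lambda>x. \<integral>\<^sup>+s. (\<integral>\<^sup>+v. ennreal \<bar>integrand H (t, s, x, v)\<bar> \<partial>lborel) \<partial>lborel) \<in> borel_measurable torus" by simp
  have "(\<integral>\<^sup>+x. (\<integral>\<^sup>+s. (\<integral>\<^sup>+v. ennreal \<bar>integrand H (t, s, x, v)\<bar> \<partial>lborel) \<partial>lborel) \<partial>torus)
      = (\<integral>\<^sup>+s. (\<integral>\<^sup>+x. (\<integral>\<^sup>+v. ennreal \<bar>integrand H (t, s, x, v)\<bar> \<partial>lborel) \<partial>torus) \<partial>lborel)"
  proof -
    have "(\<lambda>p. \<integral>\<^sup>+v. ennreal \<bar>integrand H (t, fst p, snd p, v)\<bar> \<partial>lborel) \<in> borel_measurable (lborel \<Otimes>\<^sub>M torus)"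
      using h by (rule borel_measurable_pair) auto
    then show ?thesis
      using lborel_torus.Fubini'[of "\<lambda>s x. \<integral>\<^sup>+v. ennreal \<bar>integrand H (t, s, x, v)\<bar> \<partial>lborel"]
      by (simp add: case_prod_beta')
  qed
  also have "\<dots> = (\<integral>\<^sup>+s. (\<integral>\<^sup>+z. ennreal \<bar>integrand H (t, s, z)\<bar> \<partial>phase_measure) \<partial>lborel)"
    using integrand_section(1)[OF H] by (intro nn_integral_cong lborel.nn_integral_fst) auto
  also have "\<dots> < \<infinity>" by (rule integrand_total_mass[OF H t])
  finally show ?thesis by (intro nn_integral_PInf_AE m) simp
qed

lemma K_diff:
  assumes H1: "smooth_function T H1" and H2: "smooth_function T H2" and t: "t \<in> {0..T}"
  shows "AE x in torus. K (\<lambda>t x. H1 t x - H2 t x) t x = K H1 t x - K H2 t x"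
  using AE_integrand_finite[OF H1 t] AE_integrand_finite[OF H2 t]
proof eventually_elim
  case (elim x)
  let ?H = "\<lambda>t x. H1 t x - H2 t x"
  have lin: "integrand ?H (t, s, x, v) = integrand H1 (t, s, x, v) - integrand H2 (t, s, x, v)" for s v
  proof -
    have "grad_ext T ?H (s, y) = grad_ext T H1 (s, y) - grad_ext T H2 (s, y)" for y
      using smooth_function_facts(4)[OF H1] smooth_function_facts(4)[OF H2]
      by (cases "s \<in> {0..T}") (auto simp: grad_ext_def grad_diff)
    then show ?thesis by (simp add: integrand_def inner_diff_left right_diff_distrib)
  qed
  have int: "integrable lborel (\<lambda>s. velocity_avg H (t, s, x))"
    and AE: "AE s in lborel. integrable lborel (\<lambda>v. integrand H (t, s, x, v))"
    if H: "smooth_function T H" and fin: "(\<integral>\<^sup>+s. (\<integral>\<^sup>+v. ennreal \<bar>integrand H (t, s, x, v)\<bar> \<partial>lborel) \<partial>lborel) \<noteq> \<infinity>" for H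
  proof -
    have "(\<integral>\<^sup>+s. ennreal \<bar>velocity_avg H (t, s, x)\<bar> \<partial>lborel) \<le> (\<integral>\<^sup>+s. (\<integral>\<^sup>+v. ennreal \<bar>integrand H (t, s, x, v)\<bar> \<partial>lborel) \<partial>lborel)"
      by (intro nn_integral_mono velocity_avg_abs_le)
    also have "\<dots> < \<infinity>" using fin by (simp add: less_top)
    finally show "integrable lborel (\<lambda>s. velocity_avg H (t, s, x))"
      using integrand_section(4)[OF H] by (intro integrableI_bounded) auto
    have "(\<lambda>p::real \<times> (real^'d). integrand H (t, fst p, x, snd p)) \<in> borel_measurable borel"
      by (intro borel_comp_continuous[OF integrand_measurable[OF H]] continuous_intros)
    then have "(\<lambda>p::real \<times> (real^'d). ennreal \<bar>integrand H (t, fst p, x, snd p)\<bar>) \<in> borel_measurable borel" by measurable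
    from borel_measurable_nn_integral_section[OF this lborel.sigma_finite_measure_axioms sets_lborel]
    have "(\<lambda>s. \<integral>\<^sup>+v. ennreal \<bar>integrand H (t, s, x, v)\<bar> \<partial>lborel) \<in> borel_measurable lborel" by simp
    from nn_integral_PInf_AE[OF this fin]
    show "AE s in lborel. integrable lborel (\<lambda>v. integrand H (t, s, x, v))"
    proof eventually_elim
      case (elim s)
      then show ?case
        using integrand_section(2)[OF H] by (intro integrableI_bounded) (auto simp: less_top)
    qed
  qed
  \<comment> \<open>Even at a good x, the velocity integrals converge only for almost every s; the
    outer integral ignores the exceptional times.\<close>
  have "AE s in lborel. velocity_avg ?H (t, s, x) = velocity_avg H1 (t, s, x) - velocity_avg H2 (t, s, x)"
    using AE[OF H1 elim(1)] AE[OF H2 elim(2)]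
    by eventually_elim (simp add: velocity_avg_def lin)
  then have "K ?H t x = (\<integral>s. velocity_avg H1 (t, s, x) - velocity_avg H2 (t, s, x) \<partial>lborel)"
    unfolding K_def
    using integrand_section(4)[OF H1, of t x] integrand_section(4)[OF H2, of t x]
      integrand_section(4)[OF smooth_function_diff[OF H1 H2], of t x]
    by (intro integral_cong_AE) auto
  also have "\<dots> = K H1 t x - K H2 t x"
    unfolding K_def by (rule Bochner_Integration.integral_diff[OF int[OF H1 elim(1)] int[OF H2 elim(2)]])
  finally show ?case .
qed

lemma main_estimate_diff:
  assumes H1: "smooth_function T H1" and H2: "smooth_function T H2"
  shows "space_time_sq T (\<lambda>t x. K H1 t x - K H2 t x)
    \<le> (lattice_const TYPE('d) p * ennreal decay_const)\<^sup>2 * space_time_sq T (\<lambda>t x. H1 t x - H2 t x)"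
proof -
  have "space_time_sq T (\<lambda>t x. K H1 t x - K H2 t x) = space_time_sq T (K (\<lambda>t x. H1 t x - H2 t x))"
    unfolding space_time_sq_def
  proof (rule nn_integral_cong)
    fix t
    show "(\<integral>\<^sup>+x. ennreal ((K H1 t x - K H2 t x)\<^sup>2) \<partial>torus) * indicator {0..T} t
      = (\<integral>\<^sup>+x. ennreal ((K (\<lambda>t x. H1 t x - H2 t x) t x)\<^sup>2) \<partial>torus) * indicator {0..T} t"
    proof (cases "t \<in> {0..T}")
      case True
      have "(\<integral>\<^sup>+x. ennreal ((K H1 t x - K H2 t x)\<^sup>2) \<partial>torus) = (\<integral>\<^sup>+x. ennreal ((K (\<lambda>t x. H1 t x - H2 t x) t x)\<^sup>2) \<partial>torus)"
        by (rule nn_integral_cong_AE) (use K_diff[OF H1 H2 True] in \<open>auto elim: eventually_mono\<close>)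
      then show ?thesis by simp
    qed simp
  qed
  then show ?thesis using main_estimate[OF smooth_function_diff[OF H1 H2]] by simp
qed

end

section \<open>Extension to square-integrable functions\<close>

lemma tendsto_0_ennreal_le:
  fixes f :: "nat \<Rightarrow> ennreal"
  assumes "\<And>\<epsilon>::real. \<epsilon> > 0 \<Longrightarrow> \<forall>\<^sub>F n in sequentially. f n \<le> ennreal \<epsilon>"
  shows "f \<longlonglongrightarrow> 0"
proof (rule order_tendstoI)
  fix a :: ennreal assume "0 < a"
  then obtain b where b: "0 < b" "b < a" using dense by blast
  then obtain \<epsilon> where \<epsilon>: "b = ennreal \<epsilon>" "\<epsilon> > 0" by (cases b) auto
  then show "\<forall>\<^sub>F n in sequentially. f n < a"
    using assms[OF \<epsilon>(2)] b by (auto elim!: eventually_mono)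
qed simp

text \<open>The Riesz--Fischer argument. The limit is given by an explicit pointwise formula, not
  just by existence, so that pointwise properties of the sequence such as periodicity pass to
  it.\<close>

lemma L2_Cauchy_limit:
  fixes u :: "nat \<Rightarrow> 'a \<Rightarrow> real"
  assumes fin: "finite_measure M" and u [measurable]: "\<And>n. u n \<in> borel_measurable M"
    and Cauchy: "\<And>\<epsilon>::real. \<epsilon> > 0 \<Longrightarrow> \<exists>N. \<forall>m\<ge>N. \<forall>n\<ge>N. (\<integral>\<^sup>+x. ennreal ((u m x - u n x)\<^sup>2) \<partial>M) \<le> ennreal \<epsilon>"
  shows "\<exists>r. strict_mono r \<and>
    (\<lambda>n. \<integral>\<^sup>+x. ennreal ((u n x - (if convergent (\<lambda>k. u (r k) x) then lim (\<lambda>k. u (r k) x) else 0))\<^sup>2) \<partial>M) \<longlonglongrightarrow> 0"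
proof -
  interpret finite_measure M by fact
  \<comment> \<open>Squared distances of size (1/4)^k become L1 distances of size (1/2)^k by
    Cauchy--Schwarz on the finite measure space, hence summable.\<close>
  have "\<forall>k. \<exists>N. \<forall>m\<ge>N. \<forall>n\<ge>N. (\<integral>\<^sup>+x. ennreal ((u m x - u n x)\<^sup>2) \<partial>M) \<le> ennreal ((1/4) ^ k)"
    using Cauchy by simp
  then obtain N where N: "\<And>k m n. m \<ge> N k \<Longrightarrow> n \<ge> N k \<Longrightarrow> (\<integral>\<^sup>+x. ennreal ((u m x - u n x)\<^sup>2) \<partial>M) \<le> ennreal ((1/4) ^ k)"
    by metis
  \<comment> \<open>The accumulated sum is strictly increasing and dominates every
    \<open>N k\<close>, even if \<open>N\<close> itself is not monotone.\<close>
  define r where "r k = (\<Sum>j\<le>k. Suc (N j))" for k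
  have r_mono: "strict_mono r" unfolding strict_mono_Suc_iff by (simp add: r_def)
  have rN: "N k \<le> r k" for k
    using member_le_sum[of k "{..k}" "\<lambda>j. Suc (N j)"] by (simp add: r_def)
  define d where "d k x = \<bar>u (r (Suc k)) x - u (r k) x\<bar>" for k x
  have [measurable]: "d k \<in> borel_measurable M" for k unfolding d_def by measurable
  define m where "m = measure M (space M)"
  have m: "emeasure M (space M) = ennreal m" "m \<ge> 0" by (simp_all add: m_def emeasure_eq_measure)
  have dk: "(\<integral>\<^sup>+x. ennreal (d k x) \<partial>M) \<le> ennreal (sqrt m * (1/2) ^ k)" for k
  proof (rule ennreal_power2_le_cancel)
    have "r k \<le> r (Suc k)" using r_mono by (simp add: strict_mono_less_eq)
    then have "N k \<le> r (Suc k)" using rN[of k] by linarith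
    have "(\<integral>\<^sup>+x. ennreal (d k x) \<partial>M)\<^sup>2 = (\<integral>\<^sup>+x. ennreal (d k x) * 1 \<partial>M)\<^sup>2" by simp
    also have "\<dots> \<le> (\<integral>\<^sup>+x. (ennreal (d k x))\<^sup>2 \<partial>M) * (\<integral>\<^sup>+x. 1\<^sup>2 \<partial>M)"
      by (rule Cauchy_Schwarz_nn_integral) measurable
    also have "(\<integral>\<^sup>+x. (ennreal (d k x))\<^sup>2 \<partial>M) = (\<integral>\<^sup>+x. ennreal ((u (r (Suc k)) x - u (r k) x)\<^sup>2) \<partial>M)"
      by (simp add: d_def ennreal_power)
    also have "\<dots> * (\<integral>\<^sup>+x. 1\<^sup>2 \<partial>M) \<le> ennreal ((1/4) ^ k) * ennreal m"
      using N[OF \<open>N k \<le> r (Suc k)\<close> rN] m by (auto intro!: mult_right_mono)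
    also have "\<dots> = (ennreal (sqrt m * (1/2) ^ k))\<^sup>2"
      using m(2) by (simp add: ennreal_power power_mult_distrib ennreal_mult[symmetric] mult.commute)
        (simp add: power_mult[symmetric] power_mult_distrib[symmetric] power_divide power2_eq_square[symmetric] mult.commute[of k 2] power_mult)
    finally show "(\<integral>\<^sup>+x. ennreal (d k x) \<partial>M)\<^sup>2 \<le> (ennreal (sqrt m * (1/2) ^ k))\<^sup>2" .
  qed
  have "(\<integral>\<^sup>+x. (\<Sum>k. ennreal (d k x)) \<partial>M) = (\<Sum>k. \<integral>\<^sup>+x. ennreal (d k x) \<partial>M)"
    by (rule nn_integral_suminf) measurable
  also have "\<dots> \<le> (\<Sum>k. ennreal (sqrt m * (1/2) ^ k))" by (intro suminf_le dk) auto
  also have "\<dots> < \<infinity>"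
    using m(2) by (subst suminf_ennreal2) (auto intro!: summable_mult summable_geometric)
  finally have "AE x in M. (\<Sum>k. ennreal (d k x)) \<noteq> \<infinity>"
    by (intro nn_integral_PInf_AE) auto
  then have conv: "AE x in M. convergent (\<lambda>k. u (r k) x)"
  proof eventually_elim
    case (elim x)
    then have "summable (\<lambda>k. d k x)"
      by (intro summable_suminf_not_top) (auto simp: d_def)
    then have "summable (\<lambda>k. u (r (Suc k)) x - u (r k) x)"
      unfolding d_def by (rule summable_rabs_cancel)
    then have "(\<lambda>n. \<Sum>k<n. u (r (Suc k)) x - u (r k) x) \<longlonglongrightarrow> (\<Sum>k. u (r (Suc k)) x - u (r k) x)"
      by (rule summable_LIMSEQ)
    then have "(\<lambda>n. u (r n) x - u (r 0) x) \<longlonglongrightarrow> (\<Sum>k. u (r (Suc k)) x - u (r k) x)"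
      by (simp add: sum_lessThan_telescope[of "\<lambda>k. u (r k) x"])
    then have "(\<lambda>n. (u (r n) x - u (r 0) x) + u (r 0) x) \<longlonglongrightarrow> (\<Sum>k. u (r (Suc k)) x - u (r k) x) + u (r 0) x"
      by (intro tendsto_intros)
    then show ?case by (auto simp: convergent_def)
  qed
  define U where "U x = (if convergent (\<lambda>k. u (r k) x) then lim (\<lambda>k. u (r k) x) else 0)" for x
  have [measurable]: "U \<in> borel_measurable M" unfolding U_def Cauchy_convergent_iff[symmetric] by measurable
  have "(\<lambda>n. \<integral>\<^sup>+x. ennreal ((u n x - U x)\<^sup>2) \<partial>M) \<longlonglongrightarrow> 0"
  proof (rule tendsto_0_ennreal_le)
    fix \<epsilon> :: real assume "\<epsilon> > 0"
    then obtain N' where N': "\<And>m n. m \<ge> N' \<Longrightarrow> n \<ge> N' \<Longrightarrow> (\<integral>\<^sup>+x. ennreal ((u m x - u n x)\<^sup>2) \<partial>M) \<le> ennreal \<epsilon>"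
      using Cauchy by blast
    have "(\<integral>\<^sup>+x. ennreal ((u n x - U x)\<^sup>2) \<partial>M) \<le> ennreal \<epsilon>" if n: "n \<ge> N'" for n
    proof -
      \<comment> \<open>Fatou's lemma along the almost everywhere convergent subsequence transfers
        the Cauchy bound to the limit.\<close>
      have "(\<integral>\<^sup>+x. ennreal ((u n x - U x)\<^sup>2) \<partial>M) = (\<integral>\<^sup>+x. liminf (\<lambda>k. ennreal ((u n x - u (r k) x)\<^sup>2)) \<partial>M)"
      proof (rule nn_integral_cong_AE)
        show "AE x in M. ennreal ((u n x - U x)\<^sup>2) = liminf (\<lambda>k. ennreal ((u n x - u (r k) x)\<^sup>2))"
          using conv
        proof eventually_elim
          case (elim x)
          then have "(\<lambda>k. u (r k) x) \<longlonglongrightarrow> U x" by (simp add: U_def convergent_LIMSEQ_iff)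
          then have "(\<lambda>k. ennreal ((u n x - u (r k) x)\<^sup>2)) \<longlonglongrightarrow> ennreal ((u n x - U x)\<^sup>2)"
            by (intro tendsto_intros tendsto_ennrealI)
          then show ?case by (metis lim_imp_Liminf trivial_limit_sequentially)
        qed
      qed
      also have "\<dots> \<le> liminf (\<lambda>k. \<integral>\<^sup>+x. ennreal ((u n x - u (r k) x)\<^sup>2) \<partial>M)"
        by (rule nn_integral_liminf) measurable
      also have "\<dots> \<le> ennreal \<epsilon>"
      proof -
        have "\<forall>\<^sub>F k in sequentially. (\<integral>\<^sup>+x. ennreal ((u n x - u (r k) x)\<^sup>2) \<partial>M) \<le> ennreal \<epsilon>"
          unfolding eventually_sequentially
          using N' n seq_suble[OF r_mono] by (intro exI[of _ N']) (meson order_trans)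
        then have "limsup (\<lambda>k. \<integral>\<^sup>+x. ennreal ((u n x - u (r k) x)\<^sup>2) \<partial>M) \<le> ennreal \<epsilon>" by (rule Limsup_bounded)
        then show ?thesis using Liminf_le_Limsup[OF trivial_limit_sequentially] order_trans by blast
      qed
      finally show ?thesis .
    qed
    then show "\<forall>\<^sub>F n in sequentially. (\<integral>\<^sup>+x. ennreal ((u n x - U x)\<^sup>2) \<partial>M) \<le> ennreal \<epsilon>"
      unfolding eventually_sequentially by blast
  qed
  then show ?thesis using r_mono unfolding U_def by blast
qed

section \<open>Squared space-time norms and density of smooth functions\<close>

lemma fun_ext_mem: "t \<in> {0..T} \<Longrightarrow> fun_ext T H (t, x) = H t x"
  by (simp add: fun_ext_def)

lemma space_time_sq_fun_ext:
  assumes "fun_ext T H \<in> borel_measurable borel"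
  shows "space_time_sq T H = (\<integral>\<^sup>+z. ennreal ((fun_ext T H z)\<^sup>2) \<partial>cyl T)"
proof -
  have m: "(\<lambda>z. ennreal ((fun_ext T H z)\<^sup>2)) \<in> borel_measurable borel" using assms by measurable
  have "(\<integral>\<^sup>+z. ennreal ((fun_ext T H z)\<^sup>2) \<partial>cyl T) = (\<integral>\<^sup>+t. (\<integral>\<^sup>+x. ennreal ((fun_ext T H (t, x))\<^sup>2) \<partial>torus) \<partial>slab T)"
    using borel_measurable_pair[OF m sets_slab sets_torus] by (subst torus.nn_integral_fst[symmetric]) auto
  also have "\<dots> = (\<integral>\<^sup>+t\<in>{0..T}. (\<integral>\<^sup>+x. ennreal ((fun_ext T H (t, x))\<^sup>2) \<partial>torus) \<partial>lborel)"
    using borel_measurable_nn_integral_section[OF m sigma_finite_torus sets_torus] by (rule nn_integral_slab)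
  also have "\<dots> = space_time_sq T H"
    unfolding space_time_sq_def by (intro nn_integral_cong) (auto simp: fun_ext_def indicator_def)
  finally show ?thesis ..
qed

lemma fun_ext_diff: "fun_ext T (\<lambda>t x. f t x - g t x) z = fun_ext T f z - fun_ext T g z"
  by (simp add: fun_ext_def right_diff_distrib)

lemma space_time_sq_diff:
  assumes [measurable]: "fun_ext T f \<in> borel_measurable borel" "fun_ext T g \<in> borel_measurable borel"
  shows "space_time_sq T (\<lambda>t x. f t x - g t x) = (\<integral>\<^sup>+z. ennreal ((fun_ext T f z - fun_ext T g z)\<^sup>2) \<partial>cyl T)"
proof -
  have "fun_ext T (\<lambda>t x. f t x - g t x) \<in> borel_measurable borel"
    unfolding fun_ext_diff[abs_def] by measurable
  from space_time_sq_fun_ext[OF this] show ?thesis by (simp add: fun_ext_diff)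
qed

lemma space_time_sq_triangle:
  assumes "fun_ext T f \<in> borel_measurable borel" "fun_ext T g \<in> borel_measurable borel" "fun_ext T h \<in> borel_measurable borel"
  shows "space_time_sq T (\<lambda>t x. f t x - h t x)
    \<le> 2 * space_time_sq T (\<lambda>t x. f t x - g t x) + 2 * space_time_sq T (\<lambda>t x. g t x - h t x)"
  using nn_integral_sq_diff_le[of "fun_ext T f" "cyl T" "fun_ext T g" "fun_ext T h"] assms
  by (simp add: space_time_sq_diff)

lemma space_time_sq_commute: "space_time_sq T (\<lambda>t x. f t x - g t x) = space_time_sq T (\<lambda>t x. g t x - f t x)"
  by (simp add: space_time_sq_def power2_commute)

lemma space_time_sq_triangle0:
  assumes "fun_ext T f \<in> borel_measurable borel" "fun_ext T g \<in> borel_measurable borel"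
  shows "space_time_sq T f \<le> 2 * space_time_sq T (\<lambda>t x. f t x - g t x) + 2 * space_time_sq T g"
proof -
  have "fun_ext T (\<lambda>t x. 0) \<in> borel_measurable borel" by (simp add: fun_ext_def[abs_def])
  from space_time_sq_triangle[OF assms this] show ?thesis by simp
qed

lemma restrict_product_iff:
  fixes f :: "real \<Rightarrow> real^'d::finite \<Rightarrow> real"
  assumes "T > 0"
  shows "(\<lambda>(t, x). f t x) \<in> borel_measurable (restrict_space lborel {0..T} \<Otimes>\<^sub>M lborel) \<longleftrightarrow> fun_ext T f \<in> borel_measurable borel"
proof
  let ?R = "restrict_space lborel {0..T} :: real measure"
  assume f: "(\<lambda>(t, x). f t x) \<in> borel_measurable (?R \<Otimes>\<^sub>M lborel)"
  \<comment> \<open>The retraction of the line onto [0, T]: composing with it extends a function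
    from the restricted time space to the whole line measurably, before it is cut off by the
    indicator.\<close>
  define c where "c t = max 0 (min T t)" for t
  have c: "c \<in> measurable borel ?R"
    unfolding c_def using assms by (intro measurable_restrict_space2) auto
  have "(\<lambda>z::real \<times> (real^'d). (c (fst z), snd z)) \<in> measurable (borel \<Otimes>\<^sub>M borel) (?R \<Otimes>\<^sub>M lborel)"
    by (intro measurable_Pair measurable_compose[OF measurable_fst c]) simp
  from measurable_compose[OF this f]
  have m: "(\<lambda>z. f (c (fst z)) (snd z)) \<in> borel_measurable borel" by (simp add: borel_prod)
  have "(\<lambda>z. indicator ({0..T} \<times> UNIV) z *\<^sub>R f (c (fst z)) (snd z)) \<in> borel_measurable borel"
    using m time_slab_borel by measurable
  moreover have "fun_ext T f = (\<lambda>z. indicator ({0..T} \<times> UNIV) z *\<^sub>R f (c (fst z)) (snd z))"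
    by (auto simp: fun_ext_def c_def indicator_def fun_eq_iff)
  ultimately show "fun_ext T f \<in> borel_measurable borel" by simp
next
  let ?R = "restrict_space lborel {0..T} :: real measure"
  assume f: "fun_ext T f \<in> borel_measurable borel"
  have "(\<lambda>z. (fst z, snd z)) \<in> measurable (?R \<Otimes>\<^sub>M (lborel :: (real^'d) measure)) (borel \<Otimes>\<^sub>M borel)"
    by (intro measurable_Pair measurable_compose[OF measurable_fst measurable_restrict_space1[OF measurable_ident_sets]]) auto
  from measurable_compose[OF this] f
  have "(\<lambda>z. fun_ext T f (fst z, snd z)) \<in> borel_measurable (?R \<Otimes>\<^sub>M lborel)" by (simp add: borel_prod)
  then show "(\<lambda>(t, x). f t x) \<in> borel_measurable (?R \<Otimes>\<^sub>M lborel)"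
    by (rule measurable_cong[THEN iffD1, rotated])
      (auto simp: space_pair_measure space_restrict_space fun_ext_def)
qed

lemma L2_norm_tendsto_0_iff:
  "((\<lambda>n. L2_norm T (F n)) \<longlonglongrightarrow> 0) \<longleftrightarrow> ((\<lambda>n. space_time_sq T (F n)) \<longlonglongrightarrow> 0)"
proof
  assume *: "(\<lambda>n. L2_norm T (F n)) \<longlonglongrightarrow> 0"
  show "(\<lambda>n. space_time_sq T (F n)) \<longlonglongrightarrow> 0"
  proof (rule tendsto_0_ennreal_le)
    fix \<epsilon> :: real assume e: "\<epsilon> > 0"
    then have "\<forall>\<^sub>F n in sequentially. L2_norm T (F n) < ennreal (sqrt \<epsilon>)"
      by (intro order_tendstoD(2)[OF *]) simp
    then show "\<forall>\<^sub>F n in sequentially. space_time_sq T (F n) \<le> ennreal \<epsilon>"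
    proof eventually_elim
      case (elim n)
      then have "ennreal_sqrt (space_time_sq T (F n)) \<le> ennreal (sqrt \<epsilon>)" by (simp add: L2_norm_eq less_imp_le)
      then show ?case using e by (simp add: ennreal_sqrt_le_iff ennreal_power)
    qed
  qed
next
  assume *: "(\<lambda>n. space_time_sq T (F n)) \<longlonglongrightarrow> 0"
  show "(\<lambda>n. L2_norm T (F n)) \<longlonglongrightarrow> 0"
  proof (rule tendsto_0_ennreal_le)
    fix \<epsilon> :: real assume e: "\<epsilon> > 0"
    then have "\<forall>\<^sub>F n in sequentially. space_time_sq T (F n) < ennreal (\<epsilon>\<^sup>2)"
      by (intro order_tendstoD(2)[OF *]) simp
    then show "\<forall>\<^sub>F n in sequentially. L2_norm T (F n) \<le> ennreal \<epsilon>"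
      using e by (auto elim!: eventually_mono simp: L2_norm_eq ennreal_sqrt_le_iff ennreal_power less_imp_le)
  qed
qed

lemma L2_norm_finite_iff: "L2_norm T H < \<infinity> \<longleftrightarrow> space_time_sq T H < \<infinity>"
  by (cases "space_time_sq T H") (auto simp: L2_norm_eq ennreal_sqrt_def)

lemma in_L2_iff:
  assumes "T > 0"
  shows "in_L2 T H \<longleftrightarrow> (\<forall>t\<in>{0..T}. periodic (H t)) \<and> fun_ext T H \<in> borel_measurable borel \<and> space_time_sq T H < \<infinity>"
  unfolding in_L2_def restrict_product_iff[OF assms] L2_norm_finite_iff ..

text \<open>The approximants are polynomials composed with \<open>cyl_embed\<close>: smooth on the
  whole space, and periodic because x enters through its cosines and sines.\<close>

lemma smooth_dense:
  fixes H :: "real \<Rightarrow> real^'d::finite \<Rightarrow> real"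
  assumes T: "T > 0" and H: "in_L2 T H"
  shows "\<exists>Hn. (\<forall>n::nat. smooth_function T (Hn n)) \<and> (\<lambda>n. space_time_sq T (\<lambda>t x. Hn n t x - H t x)) \<longlonglongrightarrow> 0"
proof -
  have m [measurable]: "fun_ext T H \<in> borel_measurable borel" and fin: "space_time_sq T H < \<infinity>"
    using H by (simp_all add: in_L2_iff[OF T])
  have "\<exists>h. smooth_function T h \<and> space_time_sq T (\<lambda>t x. h t x - H t x) \<le> ennreal \<epsilon>" if "\<epsilon> > 0" for \<epsilon>
  proof -
    obtain q where q: "real_polynomial_function q"
      "(\<integral>\<^sup>+z. ennreal ((fun_ext T H z - q (cyl_embed z))\<^sup>2) \<partial>cyl T) \<le> ennreal \<epsilon>"
      using trig_dense_cyl[OF m _ \<open>\<epsilon> > 0\<close>] fin by (auto simp: space_time_sq_fun_ext[OF m])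
    define h where "h t x = q (cyl_embed (t, x))" for t and x :: "real^'d"
    have "periodic (h t)" for t
    proof -
      have "cyl_embed (t, x + axis i (2 * pi)) = cyl_embed (t, x)" for x :: "real^'d" and i
        by (simp add: cyl_embed_def vec_eq_iff axis_def)
      then show ?thesis by (simp add: h_def periodic_def)
    qed
    moreover have "smooth_on (\<lambda>(t, x). h t x) UNIV"
      using Ck_on_polynomial_embed[OF q(1)] by (simp add: smooth_on_def h_def case_prod_beta')
    ultimately have h: "smooth_function T h" unfolding smooth_function_def by blast
    have "space_time_sq T (\<lambda>t x. h t x - H t x) = (\<integral>\<^sup>+z. ennreal ((fun_ext T h z - fun_ext T H z)\<^sup>2) \<partial>cyl T)"
      by (intro space_time_sq_diff fun_ext_measurable h m)
    also have "\<dots> = (\<integral>\<^sup>+z. ennreal ((fun_ext T H z - q (cyl_embed z))\<^sup>2) \<partial>cyl T)"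
    proof (rule nn_integral_cong_AE)
      show "AE z in cyl T. ennreal ((fun_ext T h z - fun_ext T H z)\<^sup>2) = ennreal ((fun_ext T H z - q (cyl_embed z))\<^sup>2)"
        using AE_cyl by eventually_elim (auto simp: fun_ext_def h_def power2_commute)
    qed
    finally show ?thesis using h q(2) by auto
  qed
  then have "\<forall>n. \<exists>h. smooth_function T h \<and> space_time_sq T (\<lambda>t x. h t x - H t x) \<le> ennreal (inverse (real (Suc n)))"
    by simp
  then obtain Hn where Hn: "\<And>n. smooth_function T (Hn n)"
    "\<And>n. space_time_sq T (\<lambda>t x. Hn n t x - H t x) \<le> ennreal (inverse (real (Suc n)))" by metis
  have "(\<lambda>n. ennreal (inverse (real (Suc n)))) \<longlonglongrightarrow> ennreal 0"
    by (intro tendsto_ennrealI LIMSEQ_inverse_real_of_nat)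
  then have lim: "(\<lambda>n. ennreal (inverse (real (Suc n)))) \<longlonglongrightarrow> 0" by (simp only: ennreal_0)
  have "(\<lambda>n. space_time_sq T (\<lambda>t x. Hn n t x - H t x)) \<longlonglongrightarrow> 0"
    by (rule tendsto_sandwich[OF _ _ tendsto_const lim]) (auto intro!: always_eventually Hn(2) simp del: of_nat_Suc)
  then show ?thesis using Hn(1) by blast
qed

lemma smooth_function_sq_finite:
  fixes H :: "real \<Rightarrow> real^'d::finite \<Rightarrow> real"
  assumes "smooth_function T H" shows "space_time_sq T H < \<infinity>"
proof -
  obtain B where B: "B \<ge> 0" "\<And>s x. s \<in> {0..T} \<Longrightarrow> norm (H s x) \<le> B"
    using smooth_function_bound[OF assms] by blast
  have "space_time_sq T H \<le> (\<integral>\<^sup>+t\<in>{0..T}. (\<integral>\<^sup>+x. ennreal (B\<^sup>2) \<partial>(torus :: (real^'d) measure)) \<partial>lborel)"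
    unfolding space_time_sq_def
  proof (rule nn_integral_mono)
    fix t
    have "(H t x)\<^sup>2 \<le> B\<^sup>2" if "t \<in> {0..T}" for x
      using B that by (simp add: power2_le_iff_abs_le)
    then show "(\<integral>\<^sup>+x. ennreal ((H t x)\<^sup>2) \<partial>torus) * indicator {0..T} t \<le> (\<integral>\<^sup>+x. ennreal (B\<^sup>2) \<partial>(torus :: (real^'d) measure)) * indicator {0..T} t"
      by (cases "t \<in> {0..T}") (auto intro!: nn_integral_mono ennreal_leI simp del: nn_integral_const)
  qed
  also have "\<dots> < \<infinity>" by (cases "T \<ge> 0") (auto simp: nn_integral_cmult ennreal_mult_less_top)
  finally show ?thesis .
qed

text \<open>Lattice sum times decay constant, with the factor \<gamma> split off; neither
  \<open>T\<close> nor the field enters.\<close>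

definition uniform_const :: "'d::finite itself \<Rightarrow> nat \<Rightarrow> real \<Rightarrow> real" where
  "uniform_const _ p \<sigma> = enn2real (lattice_const TYPE('d) p) * ((1 + 2 * real CARD('d)) ^ p * sqrt (weight_const TYPE('d) \<sigma>))"

section \<open>Continuous extension to square-integrable functions\<close>

context averaging_setting
begin

definition op_const :: real where
  "op_const = uniform_const TYPE('d) p \<sigma> * \<gamma>"

lemma op_const_nonneg: "0 \<le> op_const"
  using weight_const(2)[OF \<sigma>] \<gamma>(2) by (simp add: op_const_def uniform_const_def)

lemma op_const_sq: "(lattice_const TYPE('d) p * ennreal decay_const)\<^sup>2 = ennreal (op_const\<^sup>2)"
proof -
  have "lattice_const TYPE('d) p = ennreal (enn2real (lattice_const TYPE('d) p))"
    using lattice_const_finite[OF p] by simp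
  then have "lattice_const TYPE('d) p * ennreal decay_const = ennreal op_const"
    using decay_const_nonneg by (metis ennreal_mult enn2real_nonneg op_const_def uniform_const_def decay_const_def mult.assoc)
  then show ?thesis using op_const_nonneg by (simp add: ennreal_power)
qed

lemma averaging_fun_ext: "fun_ext T (averaging \<phi> G H) = fun_ext T (K H)"
  by (auto simp: fun_ext_def fun_eq_iff indicator_def averaging_eq_K)

lemma averaging_measurable:
  assumes "smooth_function T H" shows "fun_ext T (averaging \<phi> G H) \<in> borel_measurable borel"
proof -
  have "(\<lambda>z. K H (fst z) (snd z)) \<in> borel_measurable borel"
    using K_measurable[OF assms] by (simp add: case_prod_beta')
  then show ?thesis
    unfolding averaging_fun_ext fun_ext_def using time_slab_borel by measurable
qed

lemma averaging_sq_diff: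
  assumes "smooth_function T H1" "smooth_function T H2"
  shows "space_time_sq T (\<lambda>t x. averaging \<phi> G H1 t x - averaging \<phi> G H2 t x)
    \<le> ennreal (op_const\<^sup>2) * space_time_sq T (\<lambda>t x. H1 t x - H2 t x)"
  using main_estimate_diff[OF assms] unfolding op_const_sq
  by (subst space_time_sq_cong[where H' = "\<lambda>t x. K H1 t x - K H2 t x"]) (auto simp: averaging_eq_K)

lemma averaging_sq:
  assumes "smooth_function T H"
  shows "space_time_sq T (averaging \<phi> G H) \<le> ennreal (op_const\<^sup>2) * space_time_sq T H"
  using main_estimate[OF assms] unfolding op_const_sq
  by (subst space_time_sq_cong[where H' = "K H"]) (auto simp: averaging_eq_K)

text \<open>Shown at every point and not just almost everywhere, since \<open>in_L2\<close> demands
  periodicity pointwise.\<close>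

lemma averaging_periodic:
  assumes H: "smooth_function T H" and t: "t \<in> {0..T}"
  shows "periodic (averaging \<phi> G H t)"
  unfolding periodic_def
proof (intro allI)
  fix x :: "real^'d" and i
  have "indicat_real {0..t} s *\<^sub>R (LBINT v. grad (H s) (x + axis i (2 * pi) - \<phi> (t - s) *\<^sub>R v) \<bullet> G t s (x + axis i (2 * pi)) v)
    = indicat_real {0..t} s *\<^sub>R (LBINT v. grad (H s) (x - \<phi> (t - s) *\<^sub>R v) \<bullet> G t s x v)" for s
  proof (cases "s \<in> {0..t}")
    case True
    then have s: "s \<in> {0..T}" using t by auto
    have "periodic (grad (H s))"
      using smooth_function_facts(3)[OF H s] by (simp add: C1_periodic_def periodic_grad)
    then have "grad (H s) (x + axis i (2 * pi) - \<phi> (t - s) *\<^sub>R v) = grad (H s) (x - \<phi> (t - s) *\<^sub>R v)" for v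
      unfolding periodic_def by (metis add.commute add_diff_eq)
    moreover have "G t s (x + axis i (2 * pi)) v = G t s x v" for v
      using G t s unfolding smooth_field_def periodic_def by blast
    ultimately show ?thesis by simp
  qed simp
  note eq = this
  show "averaging \<phi> G H t (x + axis i (2 * pi)) = averaging \<phi> G H t x"
    unfolding averaging_def set_lebesgue_integral_def by (simp only: eq)
qed

lemma averaging_in_L2:
  assumes "smooth_function T H" shows "in_L2 T (averaging \<phi> G H)"
proof -
  have "space_time_sq T (averaging \<phi> G H) \<le> ennreal (op_const\<^sup>2) * space_time_sq T H"
    by (rule averaging_sq[OF assms])
  also have "\<dots> < \<infinity>" using smooth_function_sq_finite[OF assms] by (simp add: ennreal_mult_less_top)
  finally show ?thesis
    using averaging_periodic[OF assms] averaging_measurable[OF assms] by (simp add: in_L2_iff[OF T])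
qed

lemma averaging_sq_diff_via:
  assumes "smooth_function T H1" "smooth_function T H2" and H: "fun_ext T H \<in> borel_measurable borel"
  shows "space_time_sq T (\<lambda>t x. averaging \<phi> G H1 t x - averaging \<phi> G H2 t x)
    \<le> ennreal (op_const\<^sup>2) * (2 * space_time_sq T (\<lambda>t x. H1 t x - H t x) + 2 * space_time_sq T (\<lambda>t x. H2 t x - H t x))"
proof -
  have "space_time_sq T (\<lambda>t x. H1 t x - H2 t x)
    \<le> 2 * space_time_sq T (\<lambda>t x. H1 t x - H t x) + 2 * space_time_sq T (\<lambda>t x. H t x - H2 t x)"
    by (intro space_time_sq_triangle fun_ext_measurable assms)
  also have "space_time_sq T (\<lambda>t x. H t x - H2 t x) = space_time_sq T (\<lambda>t x. H2 t x - H t x)"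
    by (rule space_time_sq_commute)
  finally show ?thesis
    by (intro order_trans[OF averaging_sq_diff[OF assms(1,2)]] mult_left_mono) auto
qed

text \<open>The images of one approximating sequence are Cauchy and define the limit; the images of
  any other approximating sequence are compared with these, so the limit is independent of the
  choice.\<close>

lemma extension_exists:
  assumes H: "in_L2 T H"
  shows "\<exists>U. extends_to T (averaging \<phi> G) H U"
proof -
  have Hm: "fun_ext T H \<in> borel_measurable borel" using H by (simp add: in_L2_iff[OF T])
  obtain Hn where Hn: "\<And>n::nat. smooth_function T (Hn n)"
    and Hn_lim: "(\<lambda>n. space_time_sq T (\<lambda>t x. Hn n t x - H t x)) \<longlonglongrightarrow> 0"
    using smooth_dense[OF T H] by blast
  define A where "A n = averaging \<phi> G (Hn n)" for n
  define u where "u n = fun_ext T (A n)" for n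
  have um: "u n \<in> borel_measurable borel" for n
    unfolding u_def A_def by (rule averaging_measurable[OF Hn])
  have Cauchy: "\<exists>N. \<forall>m\<ge>N. \<forall>n\<ge>N. (\<integral>\<^sup>+z. ennreal ((u m z - u n z)\<^sup>2) \<partial>cyl T) \<le> ennreal \<epsilon>" if "\<epsilon> > 0" for \<epsilon> :: real
  proof -
    \<comment> \<open>The added 1 permits division when \<open>op_const\<close> is 0. The factor 4
      in \<delta> absorbs the two summands with factor 2 from the triangle inequality through
      \<open>H\<close>.\<close>
    define X where "X = op_const\<^sup>2 + 1"
    have X: "X > 0" by (simp add: X_def add_nonneg_pos)
    define \<delta> where "\<delta> = \<epsilon> / (4 * X)"
    have \<delta>: "\<delta> > 0" using \<open>\<epsilon> > 0\<close> X by (simp add: \<delta>_def)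
    have d4: "op_const\<^sup>2 * (4 * \<delta>) \<le> \<epsilon>"
    proof -
      have "X * (4 * \<delta>) = \<epsilon>" using X by (simp add: \<delta>_def)
      then show ?thesis using \<delta> by (simp add: X_def algebra_simps)
    qed
    from order_tendstoD(2)[OF Hn_lim, of "ennreal \<delta>"] \<delta>
    obtain N where N: "\<And>n. n \<ge> N \<Longrightarrow> space_time_sq T (\<lambda>t x. Hn n t x - H t x) \<le> ennreal \<delta>"
      by (auto simp: eventually_sequentially intro: less_imp_le)
    have "(\<integral>\<^sup>+z. ennreal ((u m z - u n z)\<^sup>2) \<partial>cyl T) \<le> ennreal \<epsilon>" if "m \<ge> N" "n \<ge> N" for m n
    proof -
      have "(\<integral>\<^sup>+z. ennreal ((u m z - u n z)\<^sup>2) \<partial>cyl T) = space_time_sq T (\<lambda>t x. A m t x - A n t x)"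
        using um by (simp add: space_time_sq_diff u_def)
      also have "\<dots> \<le> ennreal (op_const\<^sup>2) * (2 * space_time_sq T (\<lambda>t x. Hn m t x - H t x) + 2 * space_time_sq T (\<lambda>t x. Hn n t x - H t x))"
        unfolding A_def by (rule averaging_sq_diff_via[OF Hn Hn Hm])
      also have "\<dots> \<le> ennreal (op_const\<^sup>2) * (2 * ennreal \<delta> + 2 * ennreal \<delta>)"
        using N that by (intro mult_left_mono add_mono) auto
      also have "\<dots> = ennreal (op_const\<^sup>2 * (4 * \<delta>))"
        using ennreal_quarters[of "4 * \<delta>"] \<delta> by (simp add: ennreal_mult')
      also have "\<dots> \<le> ennreal \<epsilon>" by (rule ennreal_leI[OF d4])
      finally show ?thesis .
    qed
    then show ?thesis by blast
  qed
  have um': "\<And>n. u n \<in> borel_measurable (cyl T)"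
    using um by (simp add: measurable_cong_sets[OF sets_cyl refl])
  obtain r where r: "strict_mono (r :: nat \<Rightarrow> nat)"
    and lim: "(\<lambda>n. \<integral>\<^sup>+z. ennreal ((u n z - (if convergent (\<lambda>k. u (r k) z) then lim (\<lambda>k. u (r k) z) else 0))\<^sup>2) \<partial>cyl T) \<longlonglongrightarrow> 0"
    using L2_Cauchy_limit[OF finite_measure_cyl um' Cauchy] by blast
  define U0 where "U0 z = (if convergent (\<lambda>k. u (r k) z) then lim (\<lambda>k. u (r k) z) else 0)" for z
  define U where "U t x = U0 (t, x)" for t x
  have U0m: "U0 \<in> borel_measurable borel"
    using um unfolding U0_def Cauchy_convergent_iff[symmetric] by measurable
  have Um: "fun_ext T U \<in> borel_measurable borel"
    using U0m time_slab_borel unfolding fun_ext_def U_def by measurable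
  have "(\<lambda>n. space_time_sq T (\<lambda>t x. A n t x - U t x)) \<longlonglongrightarrow> 0"
  proof -
    have "space_time_sq T (\<lambda>t x. A n t x - U t x) = (\<integral>\<^sup>+z. ennreal ((u n z - U0 z)\<^sup>2) \<partial>cyl T)" for n
    proof -
      have "space_time_sq T (\<lambda>t x. A n t x - U t x) = (\<integral>\<^sup>+z. ennreal ((u n z - fun_ext T U z)\<^sup>2) \<partial>cyl T)"
        using um Um by (simp add: space_time_sq_diff u_def)
      also have "\<dots> = (\<integral>\<^sup>+z. ennreal ((u n z - U0 z)\<^sup>2) \<partial>cyl T)"
        by (rule nn_integral_cong_AE) (use AE_cyl[of T] in \<open>auto elim!: eventually_mono simp: fun_ext_def U_def\<close>)
      finally show ?thesis .
    qed
    then show ?thesis using lim by (simp add: U0_def)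
  qed
  note AU = this
  have U: "in_L2 T U"
    unfolding in_L2_iff[OF T]
  proof (intro conjI ballI Um)
    fix t assume t: "t \<in> {0..T}"
    \<comment> \<open>Periodicity of every member of the sequence makes the two pointwise limits
      literally the same expression.\<close>
    have "u k (t, x + axis i (2 * pi)) = u k (t, x)" for k x i
      using averaging_periodic[OF Hn t] t by (simp add: u_def fun_ext_mem A_def periodic_def)
    then show "periodic (U t)" by (simp add: periodic_def U_def U0_def)
  next
    \<comment> \<open>A single member at squared distance below 1 suffices for finiteness of the
      norm of the limit.\<close>
    from order_tendstoD(2)[OF AU, of 1]
    obtain n where n: "space_time_sq T (\<lambda>t x. A n t x - U t x) < 1"
      by (auto simp: eventually_sequentially)
    have An: "in_L2 T (A n)" unfolding A_def by (rule averaging_in_L2[OF Hn])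
    have "space_time_sq T U \<le> 2 * space_time_sq T (\<lambda>t x. U t x - A n t x) + 2 * space_time_sq T (A n)"
      using An Um by (intro space_time_sq_triangle0) (auto simp: in_L2_iff[OF T])
    also have "\<dots> < \<infinity>"
      using n An unfolding space_time_sq_commute[of T U]
      by (auto simp: in_L2_iff[OF T] ennreal_mult_less_top intro: less_trans)
    finally show "space_time_sq T U < \<infinity>" .
  qed
  show ?thesis
    unfolding extends_to_def L2_norm_tendsto_0_iff
  proof (intro exI[of _ U] conjI U allI impI)
    fix Hn' n
    assume "(\<forall>n. smooth_function T (Hn' n)) \<and> (\<lambda>n. space_time_sq T (\<lambda>t x. Hn' n t x - H t x)) \<longlonglongrightarrow> 0"
    then show "in_L2 T (averaging \<phi> G (Hn' n))" by (intro averaging_in_L2) simp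
  next
    fix Hn'
    assume Hn': "(\<forall>n. smooth_function T (Hn' n)) \<and> (\<lambda>n. space_time_sq T (\<lambda>t x. Hn' n t x - H t x)) \<longlonglongrightarrow> 0"
    \<comment> \<open>The bound obtained by passing from the new images to the old ones, through
      \<open>H\<close>, and from there to \<open>U\<close>; every part tends to 0.\<close>
    define R where "R n = 2 * (ennreal (op_const\<^sup>2) * (2 * space_time_sq T (\<lambda>t x. Hn' n t x - H t x) + 2 * space_time_sq T (\<lambda>t x. Hn n t x - H t x)))
      + 2 * space_time_sq T (\<lambda>t x. A n t x - U t x)" for n
    have "R \<longlonglongrightarrow> 2 * (ennreal (op_const\<^sup>2) * (2 * 0 + 2 * 0)) + 2 * 0"
      unfolding R_def using Hn' Hn_lim AU
      by (intro tendsto_add ennreal_tendsto_cmult) auto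
    then have R0: "R \<longlonglongrightarrow> 0" by simp
    have le: "space_time_sq T (\<lambda>t x. averaging \<phi> G (Hn' n) t x - U t x) \<le> R n" for n
    proof -
      have "space_time_sq T (\<lambda>t x. averaging \<phi> G (Hn' n) t x - U t x)
        \<le> 2 * space_time_sq T (\<lambda>t x. averaging \<phi> G (Hn' n) t x - A n t x) + 2 * space_time_sq T (\<lambda>t x. A n t x - U t x)"
        using Hn' um[of n] Um by (intro space_time_sq_triangle averaging_measurable) (auto simp: u_def)
      also have "\<dots> \<le> R n"
        unfolding R_def A_def using Hn'
        by (intro add_mono mult_left_mono averaging_sq_diff_via Hn Hm) auto
      finally show ?thesis .
    qed
    show "(\<lambda>n. space_time_sq T (\<lambda>t x. averaging \<phi> G (Hn' n) t x - U t x)) \<longlonglongrightarrow> 0"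
      by (rule tendsto_sandwich[OF _ _ tendsto_const R0]) (auto intro!: always_eventually le)
  qed
qed

text \<open>The squared triangle inequality is used twice, once for \<open>U\<close> against its
  approximants and once for the approximants against \<open>H\<close>. In the limit this leaves 4
  times \<open>op_const\<close> squared, that is a factor 2 after taking roots.\<close>

lemma extension_bound:
  assumes H: "in_L2 T H" and U: "extends_to T (averaging \<phi> G) H U"
  shows "L2_norm T U \<le> ennreal (2 * (uniform_const TYPE('d) p \<sigma> * \<gamma>)) * L2_norm T H"
proof -
  have Hm: "fun_ext T H \<in> borel_measurable borel" using H by (simp add: in_L2_iff[OF T])
  have Um: "fun_ext T U \<in> borel_measurable borel" using U by (simp add: extends_to_def in_L2_iff[OF T])
  obtain Hn where Hn: "\<And>n::nat. smooth_function T (Hn n)"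
    and Hn_lim: "(\<lambda>n. space_time_sq T (\<lambda>t x. Hn n t x - H t x)) \<longlonglongrightarrow> 0"
    using smooth_dense[OF T H] by blast
  have AU: "(\<lambda>n. space_time_sq T (\<lambda>t x. averaging \<phi> G (Hn n) t x - U t x)) \<longlonglongrightarrow> 0"
    using U Hn Hn_lim unfolding extends_to_def L2_norm_tendsto_0_iff by blast
  define R where "R n = 2 * space_time_sq T (\<lambda>t x. averaging \<phi> G (Hn n) t x - U t x)
      + 2 * (ennreal (op_const\<^sup>2) * (2 * space_time_sq T (\<lambda>t x. Hn n t x - H t x) + 2 * space_time_sq T H))" for n
  have "R \<longlonglongrightarrow> 2 * 0 + 2 * (ennreal (op_const\<^sup>2) * (2 * 0 + 2 * space_time_sq T H))"
    unfolding R_def using Hn_lim AU by (intro tendsto_add ennreal_tendsto_cmult tendsto_const) auto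
  moreover have "space_time_sq T U \<le> R n" for n
  proof -
    have "space_time_sq T U \<le> 2 * space_time_sq T (\<lambda>t x. U t x - averaging \<phi> G (Hn n) t x) + 2 * space_time_sq T (averaging \<phi> G (Hn n))"
      by (intro space_time_sq_triangle0 Um averaging_measurable Hn)
    also have "space_time_sq T (\<lambda>t x. U t x - averaging \<phi> G (Hn n) t x) = space_time_sq T (\<lambda>t x. averaging \<phi> G (Hn n) t x - U t x)"
      by (rule space_time_sq_commute)
    also have "space_time_sq T (averaging \<phi> G (Hn n)) \<le> ennreal (op_const\<^sup>2) * (2 * space_time_sq T (\<lambda>t x. Hn n t x - H t x) + 2 * space_time_sq T H)"
      by (intro order_trans[OF averaging_sq[OF Hn]] mult_left_mono space_time_sq_triangle0 fun_ext_measurable Hn Hm) auto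
    finally show ?thesis by (simp add: R_def add_left_mono mult_left_mono)
  qed
  ultimately have "space_time_sq T U \<le> 2 * 0 + 2 * (ennreal (op_const\<^sup>2) * (2 * 0 + 2 * space_time_sq T H))"
    by (intro LIMSEQ_le_const) auto
  also have "\<dots> = (ennreal (2 * op_const))\<^sup>2 * space_time_sq T H"
  proof -
    have "(ennreal (2 * op_const))\<^sup>2 = 4 * ennreal (op_const\<^sup>2)"
      using op_const_nonneg by (simp add: ennreal_power power_mult_distrib ennreal_mult')
    moreover have "2 * (c * (2 * x)) = 4 * c * x" for c x :: ennreal
      by (simp add: mult_ac flip: mult.assoc)
    ultimately show ?thesis by simp
  qed
  also have "\<dots> = (ennreal (2 * op_const) * L2_norm T H)\<^sup>2"
    by (simp add: power_mult_distrib L2_norm_eq ennreal_sqrt_power2)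
  finally show ?thesis unfolding L2_norm_eq ennreal_sqrt_le_iff op_const_def .
qed

end

text \<open>Covers the case of an infinite norm of the field, where \<open>\<infinity> * 0 = 0\<close> on the right-hand side.\<close>

lemma extension_of_null:
  fixes H :: "real \<Rightarrow> real^'d::finite \<Rightarrow> real"
  assumes H: "L2_norm T H = 0" and U: "extends_to T (averaging \<phi> G) H U"
  shows "L2_norm T U = 0"
proof -
  have "smooth_on (\<lambda>(t, x). 0 :: real) (UNIV :: (real \<times> (real^'d)) set)"
    using Ck_on_const[OF open_UNIV, where 'a = "real \<times> (real^'d)" and 'b = real]
    by (simp add: smooth_on_def case_prod_beta')
  then have "smooth_function T (\<lambda>t (x::real^'d). 0)"
    unfolding smooth_function_def by (intro conjI exI[of _ UNIV]) (auto simp: periodic_def)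
  moreover have "space_time_sq T (\<lambda>t x. 0 - H t x) = space_time_sq T H"
    by (simp add: space_time_sq_def)
  then have "(\<lambda>n::nat. L2_norm T (\<lambda>t x. 0 - H t x)) \<longlonglongrightarrow> 0" using H by (simp add: L2_norm_eq)
  \<comment> \<open>The constant sequence 0 is an admissible approximation, being at distance 0 from
    \<open>H\<close>; its images vanish, so \<open>U\<close> has distance 0 from 0.\<close>
  ultimately have "(\<lambda>n::nat. L2_norm T (\<lambda>t x. averaging \<phi> G (\<lambda>t x. 0) t x - U t x)) \<longlonglongrightarrow> 0"
    using U unfolding extends_to_def by (elim conjE allE[of _ "\<lambda>n t x. 0"]) simp
  moreover have "averaging \<phi> G (\<lambda>t x. 0) t x = 0" for t x
    by (simp add: averaging_def grad_def partial_def zero_vec_def[symmetric])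
  moreover have "space_time_sq T (\<lambda>t x. - U t x) = space_time_sq T U"
    by (simp add: space_time_sq_def)
  ultimately have "(\<lambda>n::nat. L2_norm T U) \<longlonglongrightarrow> 0" by (simp add: L2_norm_eq)
  then show ?thesis by (simp add: LIMSEQ_const_iff)
qed

theorem proposition4p4:
  fixes p :: nat and \<sigma> :: real
  assumes "p > 1 + CARD('d::finite)" and "\<sigma> > CARD('d) / 2"
  shows "\<exists>C>0. \<forall>T>0. \<forall>G :: real \<Rightarrow> real \<Rightarrow> real^'d \<Rightarrow> real^'d \<Rightarrow> real^'d. \<forall>H.
    smooth_field T G \<and> in_L2 T H \<longrightarrow>
      (sup_Hps_norm T p \<sigma> G < \<infinity> \<longrightarrow>
        (\<exists>U. extends_to T (K_free G) H U) \<and> (\<exists>V. extends_to T (K_fric G) H V)) \<and>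
      (\<forall>U V. extends_to T (K_free G) H U \<and> extends_to T (K_fric G) H V \<longrightarrow>
        L2_norm T U + L2_norm T V \<le> ennreal C * sup_Hps_norm T p \<sigma> G * L2_norm T H)"
proof -
  define \<kappa> where "\<kappa> = uniform_const TYPE('d) p \<sigma>"
  \<comment> \<open>Each operator contributes 2 \<kappa>; the added 1 guarantees C > 0.\<close>
  define C where "C = 4 * \<kappa> + 1"
  have \<kappa>: "\<kappa> \<ge> 0" using weight_const(2)[OF assms(2)] by (simp add: \<kappa>_def uniform_const_def)
  have C: "C > 0" using \<kappa> by (simp add: C_def)
  have setting: "averaging_setting T p \<sigma> \<gamma> \<phi> G"
    if "T > 0" "smooth_field T G" "sup_Hps_norm T p \<sigma> G \<le> ennreal \<gamma>" "\<gamma> \<ge> 0"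
      "\<phi> = (\<lambda>\<tau>. \<tau>) \<or> \<phi> = (\<lambda>\<tau>. exp \<tau> - 1)"
    for T \<gamma> \<phi> and G :: "real \<Rightarrow> real \<Rightarrow> real^'d \<Rightarrow> real^'d \<Rightarrow> real^'d"
  proof
    show "continuous_on UNIV \<phi>" using that(5) by (auto intro!: continuous_intros)
    have "\<tau> \<le> exp \<tau> - 1" for \<tau> :: real using exp_ge_add_one_self[of \<tau>] by linarith
    then show "\<tau> \<le> \<phi> \<tau>" if "\<tau> \<ge> 0" for \<tau>
      using \<open>\<phi> = _ \<or> _\<close> by (elim disjE) simp_all
  qed (use that assms in auto)
  show ?thesis
  proof (intro exI[of _ C] conjI C allI impI)
    fix T :: real and G :: "real \<Rightarrow> real \<Rightarrow> real^'d \<Rightarrow> real^'d \<Rightarrow> real^'d" and H :: "real \<Rightarrow> real^'d \<Rightarrow> real"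
    assume T: "T > 0" and GH: "smooth_field T G \<and> in_L2 T H" and fin: "sup_Hps_norm T p \<sigma> G < \<infinity>"
    then have g: "sup_Hps_norm T p \<sigma> G \<le> ennreal (enn2real (sup_Hps_norm T p \<sigma> G))" by simp
    show "\<exists>U. extends_to T (K_free G) H U" "\<exists>V. extends_to T (K_fric G) H V"
      unfolding K_free_averaging K_fric_averaging
      using GH by (auto intro!: averaging_setting.extension_exists setting T g)
  next
    fix T :: real and G :: "real \<Rightarrow> real \<Rightarrow> real^'d \<Rightarrow> real^'d \<Rightarrow> real^'d" and H U V :: "real \<Rightarrow> real^'d \<Rightarrow> real"
    assume T: "T > 0" and GH: "smooth_field T G \<and> in_L2 T H"
      and UV: "extends_to T (K_free G) H U \<and> extends_to T (K_fric G) H V"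
    let ?s = "sup_Hps_norm T p \<sigma> G"
    show "L2_norm T U + L2_norm T V \<le> ennreal C * ?s * L2_norm T H"
    \<comment> \<open>An infinite norm of the field makes the right-hand side infinite unless
      \<open>H\<close> is null, in which case both extended values are null as well.\<close>
    proof (cases "?s < \<infinity>")
      case True
      define \<gamma> where "\<gamma> = enn2real ?s"
      have s: "?s = ennreal \<gamma>" "\<gamma> \<ge> 0" using True by (simp_all add: \<gamma>_def)
      have "L2_norm T U \<le> ennreal (2 * (\<kappa> * \<gamma>)) * L2_norm T H" "L2_norm T V \<le> ennreal (2 * (\<kappa> * \<gamma>)) * L2_norm T H"
      proof -
        have "averaging_setting T p \<sigma> \<gamma> (\<lambda>\<tau>. \<tau>) G" "averaging_setting T p \<sigma> \<gamma> (\<lambda>\<tau>. exp \<tau> - 1) G"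
          using GH s by (auto intro!: setting T)
        from this[THEN averaging_setting.extension_bound]
        show "L2_norm T U \<le> ennreal (2 * (\<kappa> * \<gamma>)) * L2_norm T H" "L2_norm T V \<le> ennreal (2 * (\<kappa> * \<gamma>)) * L2_norm T H"
          using GH UV unfolding K_free_averaging K_fric_averaging \<kappa>_def by blast+
      qed
      then have "L2_norm T U + L2_norm T V \<le> (ennreal (2 * (\<kappa> * \<gamma>)) + ennreal (2 * (\<kappa> * \<gamma>))) * L2_norm T H"
        by (simp add: add_mono distrib_right)
      also have "ennreal (2 * (\<kappa> * \<gamma>)) + ennreal (2 * (\<kappa> * \<gamma>)) = ennreal (4 * \<kappa> * \<gamma>)"
        using \<kappa> s(2) by (subst ennreal_plus[symmetric]) (auto simp: mult_ac)
      also have "ennreal (4 * \<kappa> * \<gamma>) * L2_norm T H \<le> ennreal (C * \<gamma>) * L2_norm T H"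
        using s(2) by (intro mult_right_mono ennreal_leI) (auto simp: C_def)
      also have "ennreal (C * \<gamma>) = ennreal C * ?s" using C s by (simp add: ennreal_mult)
      finally show ?thesis .
    next
      case False
      then have s: "?s = \<infinity>" by (metis infinity_ennreal_def less_top)
      show ?thesis
      proof (cases "L2_norm T H = 0")
        case True
        then show ?thesis
          using UV extension_of_null unfolding K_free_averaging K_fric_averaging by fastforce
      next
        case False
        then show ?thesis using C by (simp add: s ennreal_mult_top ennreal_top_mult)
      qed
    qed
  qed
qed

end
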